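(* Let $\Delta\in\mathbb{R}$. If $0<g<1/2$, then the eigenvalues $E^{\pm}_n$ of the two-photon quantum Rabi model Hamiltonian $$\hat{\mathbf H}=\frac{\Delta}{2}\,\hat\sigma_z+\hat a^+\hat a+g\,(\hat a^2+\hat a^{+2})\,\hat\sigma_x$$ have the following three-term asymptotic formula as $n\to\infty$: $$E^{\pm}_n=n\sqrt{1-4g^2}+\frac{\sqrt{1-4g^2}-1}{2}\pm(-1)^{[n/2]}\,\frac{\Delta}{2}\,\sqrt{\frac{\sqrt{1-4g^2}}{\pi g\,n}}\,\cos\left(A\,(n+\tfrac12)-\frac{\pi}{2}\,n\right)+O\left(\frac{\ln n}{n}\right),$$ where $A=\arctan\dfrac{\sqrt{1-4g^2}}{2g}$ and $[\cdot]$ is the integer part.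
   Context: The operator $\hat{\mathbf H}$ acts in $H=H_2\otimes\mathbb{C}^2$. Here $H_2$ has orthonormal basis $|n\rangle$, $n=0,1,2,\dots$, with annihilation and creation operators $\hat a|n\rangle=\sqrt n\,|n-1\rangle$, $\hat a^+|n\rangle=\sqrt{n+1}\,|n+1\rangle$, $[\hat a,\hat a^+]=1$; $\mathbb{C}^2$ has basis $|+\rangle,|-\rangle$, with $\hat\sigma_z=\begin{pmatrix}1&0\\0&-1\end{pmatrix}$, $\hat\sigma_x=\begin{pmatrix}0&1\\1&0\end{pmatrix}$, so $\hat\sigma_z|\pm\rangle=\pm|\pm\rangle$. Write $|n,\pm\rangle=|n\rangle|\pm\rangle$. The closed subspaces with orthonormal bases $$H_1'=\{|0,+\rangle,|1,+\rangle,|2,-\rangle,|3,-\rangle,|4,+\rangle,|5,+\rangle,|6,-\rangle,|7,-\rangle,\dots\},$$ $$H_2'=\{|0,-\rangle,|1,-\rangle,|2,+\rangle,|3,+\rangle,|4,-\rangle,|5,-\rangle,|6,+\rangle,|7,+\rangle,\dots\}$$ are invariant for $\hat{\mathbf H}$ and $H=H_1'\oplus H_2'$. In these bases the restrictions of $\hat{\mathbf H}$ to $H_1'$ and $H_2'$ are $\hat{\mathbf H}_i=a^+a+g(a^2+a^{+2})+\hat{\mathbf V}_i$, $i=1,2$, where $a,a^+$ are the annihilation and creation operators with respect to the listed basis (indexed from $0$), $\hat{\mathbf V}_1=\frac{\Delta}{2}\,\mathrm{diag}\{1,1,-1,-1,1,1,\dots\}$ and $\hat{\mathbf V}_2=-\hat{\mathbf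 V}_1$. For $0<g<1/2$ the spectrum is discrete. $E_n^{+}$ and $E_n^{-}$, $n=0,1,2,\dots$, denote the eigenvalues of $\hat{\mathbf H}_1$ and $\hat{\mathbf H}_2$ respectively, numbered in nondecreasing order with multiplicity. *)

theory Defs
  imports "HOL-Analysis.Analysis" "HOL-Library.Function_Algebras" "HOL-Library.Landau_Symbols"
begin

datatype spin = Up | Down

fun flip :: "spin \<Rightarrow> spin" where
  "flip Up = Down"
| "flip Down = Up"

text \<open>A vector of the tensor product is represented by its coordinates in the orthonormal basis
  \<open>|n,\<plusminus>\<rangle>\<close>: \<open>x (n, Up)\<close> is the coefficient of \<open>|n,+\<rangle>\<close> and \<open>x (n, Down)\<close> that of \<open>|n,-\<rangle>\<close>.
  The Hilbert space consists of the square-summable such families. The operators below are given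
  by their coordinate formulas on arbitrary families; domains are imposed separately.\<close>

type_synonym state = "nat \<times> spin \<Rightarrow> complex"

definition ell2 :: "state set" where
  "ell2 = {x. (\<lambda>i. (cmod (x i))\<^sup>2) summable_on UNIV}"

definition annihilation :: "state \<Rightarrow> state" where
  "annihilation x = (\<lambda>(n, s). complex_of_real (sqrt (real (n + 1))) * x (n + 1, s))"

definition creation :: "state \<Rightarrow> state" where
  "creation x = (\<lambda>(n, s). if n = 0 then 0 else complex_of_real (sqrt (real n)) * x (n - 1, s))"

definition sigma_z :: "state \<Rightarrow> state" where
  "sigma_z x = (\<lambda>(n, s). case s of Up \<Rightarrow> x (n, s) | Down \<Rightarrow> - x (n, s))"

definition sigma_x :: "state \<Rightarrow> state" where
  "sigma_x x = (\<lambda>(n, s). x (n, flip s))"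

definition rabi_hamiltonian :: "real \<Rightarrow> real \<Rightarrow> state \<Rightarrow> state" where
  "rabi_hamiltonian \<Delta> g x = (\<lambda>i.
     complex_of_real (\<Delta> / 2) * sigma_z x i
     + creation (annihilation x) i
     + complex_of_real g * (annihilation (annihilation (sigma_x x)) i
                            + creation (creation (sigma_x x)) i))"

text \<open>The natural domain of the operator sum. The domain of \<open>a\<^sup>+ a\<close>, i.e. the vectors with
  \<open>\<Sum> n\<^sup>2 |x(n,s)|\<^sup>2 < \<infinity>\<close>, is contained in the domains of the other summands, and for
  \<open>0 < g < 1/2\<close> the Hamiltonian is self-adjoint on it.\<close>

definition rabi_domain :: "state set" where
  "rabi_domain = {x \<in> ell2. creation (annihilation x) \<in> ell2}"

text \<open>Basis labels of the two invariant subspaces: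
  \<open>|0,+\<rangle>, |1,+\<rangle>, |2,-\<rangle>, |3,-\<rangle>, |4,+\<rangle>, \<dots>\<close> and \<open>|0,-\<rangle>, |1,-\<rangle>, |2,+\<rangle>, |3,+\<rangle>, |4,-\<rangle>, \<dots>\<close>.\<close>

definition basis_plus :: "(nat \<times> spin) set" where
  "basis_plus = {(n, s). s = (if even (n div 2) then Up else Down)}"

definition basis_minus :: "(nat \<times> spin) set" where
  "basis_minus = {(n, s). s = (if even (n div 2) then Down else Up)}"

text \<open>The closed subspace with orthonormal basis \<open>{|n,s\<rangle> : (n,s) \<in> B}\<close>.\<close>

definition subspace_of :: "(nat \<times> spin) set \<Rightarrow> state set" where
  "subspace_of B = {x \<in> ell2. \<forall>i. i \<notin> B \<longrightarrow> x i = 0}"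

text \<open>Eigenspace (including \<open>0\<close>) of the restriction of the Hamiltonian to \<open>subspace_of B\<close>.\<close>

definition rabi_eigenspace :: "real \<Rightarrow> real \<Rightarrow> (nat \<times> spin) set \<Rightarrow> complex \<Rightarrow> state set" where
  "rabi_eigenspace \<Delta> g B l =
     {x \<in> rabi_domain \<inter> subspace_of B. rabi_hamiltonian \<Delta> g x = (\<lambda>i. l * x i)}"

definition state_scale :: "complex \<Rightarrow> state \<Rightarrow> state" where
  "state_scale c x = (\<lambda>i. c * x i)"

global_interpretation state: vector_space state_scale
  by unfold_locales (simp_all add: state_scale_def plus_fun_def algebra_simps)

text \<open>\<open>E 0 \<le> E 1 \<le> \<dots>\<close> lists the eigenvalues of that restriction, each as often as its
  (geometric) multiplicity, the complex dimension of the eigenspace. The condition ranges over all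
  complex \<open>l\<close>: for \<open>l\<close> not an eigenvalue it says that \<open>l\<close> does not occur. The convention
  that \<open>dim\<close> is \<open>0\<close> in infinite dimension is harmless here: on each of the two invariant
  subspaces the eigenvalue equation is a recurrence of step two in \<open>n\<close>, so the eigenspaces
  have dimension at most two.\<close>

definition lists_eigenvalues ::
    "real \<Rightarrow> real \<Rightarrow> (nat \<times> spin) set \<Rightarrow> (nat \<Rightarrow> real) \<Rightarrow> bool" where
  "lists_eigenvalues \<Delta> g B E \<longleftrightarrow>
     mono E \<and>
     (\<forall>l. finite {n. complex_of_real (E n) = l} \<and>
          card {n. complex_of_real (E n) = l} = state.dim (rabi_eigenspace \<Delta> g B l))"

definition rabi_asymptotic :: "real \<Rightarrow> real \<Rightarrow> real \<Rightarrow> nat \<Rightarrow> real" where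
  "rabi_asymptotic \<Delta> g \<epsilon> n =
     real n * sqrt (1 - 4 * g\<^sup>2) + (sqrt (1 - 4 * g\<^sup>2) - 1) / 2
     + \<epsilon> * (-1) ^ (n div 2) * (\<Delta> / 2) * sqrt (sqrt (1 - 4 * g\<^sup>2) / (pi * g * real n))
       * cos (arctan (sqrt (1 - 4 * g\<^sup>2) / (2 * g)) * (real n + 1 / 2) - pi / 2 * real n)"

end

theory Submission
  imports Defs "HOL-Complex_Analysis.Great_Picard"
begin

text \<open>
  On each invariant subspace the Hamiltonian is \<open>H\<^sub>0 + V\<close> with
  \<open>H\<^sub>0 = a\<^sup>+ a + g (a\<^sup>2 + a\<^sup>+\<^sup>2)\<close> and \<open>V\<close> a multiple of \<open>diag(1, 1, -1, -1, \<dots>)\<close>. A Bogoliubov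
  transformation diagonalises \<open>H\<^sub>0\<close>: its eigenvectors are the squeezed number states \<open>\<phi>\<^sub>n\<close>, with
  eigenvalues \<open>\<lambda>\<^sub>n\<close> linear in \<open>n\<close>. The variational principle with the trial spaces
  \<open>span {\<phi>\<^sub>0, \<dots>, \<phi>\<^sub>n}\<close> and \<open>{\<phi>\<^sub>0, \<dots>, \<phi>\<^sub>n\<^sub>-\<^sub>1}\<^sup>\<bottom>\<close> gives
  \<open>E\<^sub>n = \<lambda>\<^sub>n + V\<^sub>n\<^sub>n + O(s\<^sub>n)\<close>, where \<open>s\<^sub>n\<close> is the second-order sum of \<open>|V\<^sub>m\<^sub>n|\<^sup>2 / |m - n|\<close> over
  \<open>m \<noteq> n\<close>. The bound \<open>|V\<^sub>m\<^sub>n|\<^sup>2 = O(1/n)\<close> for \<open>|m - n| \<le> c n\<close>, obtained from the three-term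
  recurrence in \<open>m\<close>, yields \<open>s\<^sub>n = O(ln n / n)\<close>. The diagonal entries \<open>V\<^sub>n\<^sub>n\<close> are, up to sign and a
  constant, the Legendre polynomials at \<open>cos \<theta> = \<surd>(1 - 4 g\<^sup>2)\<close>, whose asymptotics
  produce the oscillating term.
\<close>

section \<open>The spectrum of a perturbed oscillator\<close>

text \<open>Everything passes through one inequality: \<open><x, V x>\<close> differs from
  \<open>V_nn |x|^2\<close> by at most a small multiple of \<open>|x|^2\<close> plus the form of
  \<open>|H_0 - lambda_n|\<close> at \<open>x\<close>. On each trial space
  \<open>H_0 - lambda_n\<close> has a fixed sign, so that form cancels exactly. Since the hypothesis
  on the eigenvalue list only counts eigenvectors, the variational principle is run as dimension
  counting: too many low eigenvectors contradict the lower bound, and if there are too few,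
  compactness produces one more. The obstacle is that \<open>V\<close> is bounded but not small;
  only its entries near the diagonal at high level are. They are small because
  \<open>J = diag(1, 1, -1, -1, ...)\<close> anticommutes with \<open>a^2\<close> and its adjoint,
  so that each column of the matrix solves a second-order difference equation that oscillates near
  the diagonal. Diagonal entries are needed with their phase. For them \<open>J\<close> is written
  as the real plus the imaginary part of \<open>i^N\<close>, which carries \<open>a\<close> into a
  multiple of itself; this first-order relation leads to the Legendre recurrence.\<close>

lemma quadratic_nonneg_imp_zero:
  fixes a b :: real
  assumes "\<And>t. 0 \<le> 2 * t * b + t\<^sup>2 * a"
  shows "b = 0"
proof (rule ccontr)
  assume "b \<noteq> 0"
  define k where "k = \<bar>a\<bar> + 1"
  have k: "k > 0" "a < 2 * k" by (auto simp: k_def)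
  have "0 \<le> 2 * (- b / k) * b + (- b / k)\<^sup>2 * a" by (rule assms)
  also have "\<dots> = b\<^sup>2 / k\<^sup>2 * (a - 2 * k)"
    using k by (simp add: field_simps power2_eq_square)
  also have "\<dots> < 0" using k \<open>b \<noteq> 0\<close> by (intro mult_pos_neg) auto
  finally show False by simp
qed

lemma finite_orthogonal_projection:
  fixes h :: "'a::real_inner"
  assumes "finite W"
  obtains p where "p \<in> span W" "\<And>u. u \<in> W \<Longrightarrow> inner u (h - p) = 0"
proof -
  obtain C where C: "finite C" "span C = span W" "pairwise orthogonal C"
    using basis_orthogonal[OF assms] by blast
  \<comment> \<open>The orthogonal family may contain 0, whose coefficient is then
    \<open>0 / 0 = 0\<close>.\<close>
  define p where "p = (\<Sum>u\<in>C. (inner u h / inner u u) *\<^sub>R u)"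
  have C0: "inner u (h - p) = 0" if "u \<in> C" for u
  proof -
    have "inner u p = (\<Sum>u'\<in>C. if u' = u then inner u h else 0)"
      unfolding p_def inner_sum_right
    proof (rule sum.cong[OF refl])
      fix u' assume "u' \<in> C"
      then show "inner u ((inner u' h / inner u' u') *\<^sub>R u') = (if u' = u then inner u h else 0)"
        using C(3) that by (cases "u' = u"; cases "u = 0") (auto simp: pairwise_def orthogonal_def)
    qed
    then show ?thesis using that C(1) by (simp add: inner_diff_right)
  qed
  have *: "inner (h - p) u = 0" if "u \<in> span C" for u
  proof (rule span_induct[OF that])
    show "subspace {u. inner (h - p) u = 0}" by (auto simp: subspace_def inner_add_right)
  qed (simp add: C0 inner_commute)
  show ?thesis
  proof
    show "p \<in> span W" unfolding p_def C(2)[symmetric] by (intro span_sum span_scale span_base)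
    show "inner u (h - p) = 0" if "u \<in> W" for u
      using *[of u] that C(2) by (simp add: span_base inner_commute)
  qed
qed

text \<open>Models \<open>H_0 + V\<close> through the spectral data of \<open>H_0\<close>:
  \<open>\<phi> j\<close> has eigenvalue \<open>w * j + c\<close>, and \<open>parseval\<close>
  expresses completeness of the family. The unbounded operator itself is never formed.\<close>

locale perturbed_oscillator =
  fixes \<phi> :: "nat \<Rightarrow> 'a::{real_inner,complete_space}" and V :: "'a \<Rightarrow> 'a" and w c v :: real
  assumes w_pos: "0 < w"
    and orthonormal: "inner (\<phi> i) (\<phi> j) = (if i = j then 1 else 0)"
    and parseval: "(\<lambda>j. (inner (\<phi> j) x)\<^sup>2) sums inner x x"
    and V_linear: "linear V"
    and V_sym: "inner x (V y) = inner (V x) y"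
    and V_bound: "norm (V x) \<le> v * norm x"
begin

definition lam :: "nat \<Rightarrow> real" where "lam j = w * real j + c"

text \<open>The equation \<open>(H_0 + V) x = l x\<close> in weak form, tested against each basis
  vector. Membership in a domain is thereby a consequence instead of part of the definition.\<close>

definition eigenspace :: "real \<Rightarrow> 'a set" where
  "eigenspace l = {x. \<forall>j. lam j * inner (\<phi> j) x + inner (\<phi> j) (V x) = l * inner (\<phi> j) x}"

definition form_domain :: "'a set" where
  "form_domain = {x. summable (\<lambda>j. real j * (inner (\<phi> j) x)\<^sup>2)}"

lemma parseval_polar: "(\<lambda>j. inner (\<phi> j) x * inner (\<phi> j) y) sums inner x y"
proof -
  have "(\<lambda>j. ((inner (\<phi> j) (x + y))\<^sup>2 - (inner (\<phi> j) x)\<^sup>2 - (inner (\<phi> j) y)\<^sup>2) / 2)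
          sums ((inner (x + y) (x + y) - inner x x - inner y y) / 2)"
    by (intro sums_divide sums_diff parseval)
  moreover have "(inner (x + y) (x + y) - inner x x - inner y y) / 2 = inner x y"
    by (simp add: inner_add_left inner_add_right inner_commute)
  moreover have "((inner (\<phi> j) (x + y))\<^sup>2 - (inner (\<phi> j) x)\<^sup>2 - (inner (\<phi> j) y)\<^sup>2) / 2
      = inner (\<phi> j) x * inner (\<phi> j) y" for j
    by (simp add: inner_add_right power2_sum)
  ultimately show ?thesis by simp
qed

lemma v_nonneg: "0 \<le> v"
proof -
  have "norm (\<phi> 0) = 1" using orthonormal[of 0 0] by (simp add: norm_eq_sqrt_inner)
  then show ?thesis using order_trans[OF norm_ge_zero V_bound[of "\<phi> 0"]] by simp
qed

lemma inner_V_bound: "\<bar>inner x (V y)\<bar> \<le> v * norm x * norm y"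
proof -
  have "\<bar>inner x (V y)\<bar> \<le> norm x * norm (V y)" by (rule Cauchy_Schwarz_ineq2)
  also have "\<dots> \<le> norm x * (v * norm y)" by (intro mult_left_mono V_bound) auto
  finally show ?thesis by (simp add: mult_ac)
qed

lemma V_add: "V (x + y) = V x + V y" using V_linear by (simp add: linear_add)
lemma V_scale: "V (r *\<^sub>R x) = r *\<^sub>R V x" using V_linear by (simp add: linear_scale)
lemma V_zero: "V 0 = 0" using V_linear by (simp add: linear_0)

lemma inner_V_sum:
  assumes "finite F"
  shows "inner (\<Sum>i\<in>F. a i *\<^sub>R \<phi> i) (V (\<Sum>j\<in>F. a j *\<^sub>R \<phi> j)) =
    (\<Sum>i\<in>F. \<Sum>j\<in>F. a i * a j * inner (\<phi> i) (V (\<phi> j)))"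
proof -
  have "V (\<Sum>j\<in>F. a j *\<^sub>R \<phi> j) = (\<Sum>j\<in>F. a j *\<^sub>R V (\<phi> j))"
    using V_linear by (simp add: linear_sum linear_scale)
  then show ?thesis
    by (simp add: inner_sum_left inner_sum_right sum_distrib_left, subst sum.swap, simp add: mult_ac)
qed

lemma coeff_sum:
  assumes "finite F"
  shows "inner (\<phi> i) (\<Sum>j\<in>F. a j *\<^sub>R \<phi> j) = (if i \<in> F then a i else 0)"
  using assms by (simp add: inner_sum_right orthonormal if_distrib cong: if_cong)

text \<open>\<open>M\<close> is the form of \<open>|\<Lambda> - \<lambda>\<^sub>n|\<close> at \<open>x\<close>. Near level \<open>n\<close> the entries of \<open>V\<close> are small,
  while components far from level \<open>n\<close> are controlled by \<open>M\<close> alone; the row of \<open>V\<close> through \<open>n\<close>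
  enters only through the second-order quantity \<open>s\<close>.\<close>

lemma form_bound:
  assumes K: "K > 0" and small: "2 * real K * \<epsilon> + 2 * v / sqrt (real K) + v / real K + \<epsilon> \<le> w / 2"
    and near: "\<And>i j. i \<le> n + K \<Longrightarrow> n \<le> i + K \<Longrightarrow> j \<le> n + K \<Longrightarrow> n \<le> j + K \<Longrightarrow>
      \<bar>inner (\<phi> i) (V (\<phi> j))\<bar> \<le> \<epsilon>"
    and row: "\<And>F. finite F \<Longrightarrow> n \<notin> F \<Longrightarrow>
      (\<Sum>m\<in>F. (inner (\<phi> m) (V (\<phi> n)))\<^sup>2 / \<bar>real m - real n\<bar>) \<le> w * s"
    and M: "(\<lambda>j. w * \<bar>real j - real n\<bar> * (inner (\<phi> j) x)\<^sup>2) sums M"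
  shows "\<bar>inner x (V x) - inner (\<phi> n) (V (\<phi> n)) * inner x x\<bar> \<le> 2 * s * inner x x + M"
proof -
  define cf where "cf j = inner (\<phi> j) x" for j
  define V0 where "V0 = inner (\<phi> n) (V (\<phi> n))"
  \<comment> \<open>Splits \<open>x\<close> into its component at level \<open>n\<close>, the part
    \<open>zn\<close> within distance \<open>K\<close> of it, and the remote part \<open>zf\<close>.
    Small entries of \<open>V\<close> handle \<open>zn\<close>; on \<open>zf\<close> the weight in
    \<open>M\<close> is at least \<open>w * K\<close>.\<close>
  define z where "z = x - cf n *\<^sub>R \<phi> n"
  define Nr where "Nr = {n - K..n + K} - {n}"
  define zn where "zn = (\<Sum>j\<in>Nr. cf j *\<^sub>R \<phi> j)"
  define zf where "zf = z - zn"
  have finNr: "finite Nr" by (simp add: Nr_def)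
  have cfz: "inner (\<phi> j) z = (if j = n then 0 else cf j)" for j
    by (simp add: z_def inner_diff_right orthonormal cf_def)
  have cfzn: "inner (\<phi> j) zn = (if j \<in> Nr then cf j else 0)" for j
    unfolding zn_def by (rule coeff_sum[OF finNr])
  have cfzf: "inner (\<phi> j) zf = (if j = n \<or> j \<in> Nr then 0 else cf j)" for j
    unfolding zf_def inner_diff_right cfz cfzn by (auto simp: Nr_def)
  have M0: "M \<ge> 0"
    using sums_le[OF _ sums_zero M] w_pos by auto
  have eps: "\<epsilon> \<ge> 0" using near[of n n] by simp
  have wz: "w * inner z z \<le> M"
  proof -
    show ?thesis
    proof (rule sums_le[OF _ sums_mult[OF parseval] M])
      fix j
      show "w * (inner (\<phi> j) z)\<^sup>2 \<le> w * \<bar>real j - real n\<bar> * (inner (\<phi> j) x)\<^sup>2"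
      proof (cases "j = n")
        case False
        then have "1 \<le> \<bar>real j - real n\<bar>" by linarith
        then have "w * (cf j)\<^sup>2 * 1 \<le> w * (cf j)\<^sup>2 * \<bar>real j - real n\<bar>"
          using w_pos by (intro mult_left_mono) auto
        with False show ?thesis by (simp add: cfz cf_def mult_ac)
      qed (use w_pos cfz in auto)
    qed
  qed
  have wzf: "w * real K * inner zf zf \<le> M"
  proof -
    show ?thesis
    proof (rule sums_le[OF _ sums_mult[OF parseval] M])
      fix j
      show "w * real K * (inner (\<phi> j) zf)\<^sup>2 \<le> w * \<bar>real j - real n\<bar> * (inner (\<phi> j) x)\<^sup>2"
      proof (cases "j = n \<or> j \<in> Nr")
        case False
        then have "real K \<le> \<bar>real j - real n\<bar>" by (auto simp: Nr_def)
        then have "w * (cf j)\<^sup>2 * real K \<le> w * (cf j)\<^sup>2 * \<bar>real j - real n\<bar>"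
          using w_pos by (intro mult_left_mono) auto
        with False show ?thesis by (simp add: cfzf cf_def mult_ac)
      qed (use w_pos cfzf in auto)
    qed
  qed
  have zn_z: "inner zn zn \<le> inner z z"
    by (rule sums_le[OF _ parseval parseval]) (auto simp: cfz cfzn Nr_def)
  have zn_sum: "inner zn zn = (\<Sum>j\<in>Nr. (cf j)\<^sup>2)"
  proof -
    have "inner zn zn = (\<Sum>j\<in>Nr. cf j * inner (\<phi> j) zn)"
      by (subst (1) zn_def) (simp add: inner_sum_left)
    then show ?thesis by (simp add: cfzn power2_eq_square)
  qed
  \<comment> \<open>Off level \<open>n\<close> the weight in \<open>M\<close> is at least
    \<open>w\<close>, and beyond the window at least \<open>w * K\<close>. Hence \<open>r\<close>
    bounds \<open>norm z\<close> and \<open>norm zn\<close>, and \<open>r / sqrt K\<close> bounds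
    \<open>norm zf\<close>.\<close>
  define r where "r = sqrt (M / w)"
  have r0: "r \<ge> 0" and r2: "r\<^sup>2 = M / w" using M0 w_pos by (auto simp: r_def)
  have nz: "norm z \<le> r"
  proof (rule power2_le_imp_le[OF _ r0])
    show "(norm z)\<^sup>2 \<le> r\<^sup>2" using wz w_pos by (simp add: power2_norm_eq_inner r2 field_simps)
  qed
  have nzn: "norm zn \<le> r"
    using zn_z nz by (metis norm_le order_trans)
  have nzf: "norm zf \<le> r / sqrt (real K)"
  proof (rule power2_le_imp_le)
    show "(norm zf)\<^sup>2 \<le> (r / sqrt (real K))\<^sup>2"
      using wzf w_pos K by (simp add: power2_norm_eq_inner power_divide r2 field_simps)
  qed (use r0 in auto)
  have "card Nr \<le> 2 * K"
  proof -
    have "card Nr = card {n - K..n + K} - 1" by (simp add: Nr_def)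
    also have "\<dots> \<le> 2 * K" by simp
    finally show ?thesis .
  qed
  then have cardNr: "real (card Nr) \<le> 2 * real K" by linarith
  have nn: "\<bar>inner zn (V zn)\<bar> \<le> 2 * real K * \<epsilon> * r\<^sup>2"
  proof -
    have "\<bar>inner zn (V zn)\<bar> = \<bar>\<Sum>i\<in>Nr. \<Sum>j\<in>Nr. cf i * cf j * inner (\<phi> i) (V (\<phi> j))\<bar>"
      unfolding zn_def by (simp add: inner_V_sum[OF finNr])
    also have "\<dots> \<le> (\<Sum>i\<in>Nr. \<Sum>j\<in>Nr. \<bar>cf i * cf j * inner (\<phi> i) (V (\<phi> j))\<bar>)"
      by (rule order_trans[OF sum_abs]) (intro sum_mono sum_abs)
    also have "\<dots> \<le> (\<Sum>i\<in>Nr. \<Sum>j\<in>Nr. \<bar>cf i\<bar> * \<bar>cf j\<bar> * \<epsilon>)"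
    proof (intro sum_mono)
      fix i j assume "i \<in> Nr" "j \<in> Nr"
      then have "\<bar>inner (\<phi> i) (V (\<phi> j))\<bar> \<le> \<epsilon>" by (intro near) (auto simp: Nr_def)
      then show "\<bar>cf i * cf j * inner (\<phi> i) (V (\<phi> j))\<bar> \<le> \<bar>cf i\<bar> * \<bar>cf j\<bar> * \<epsilon>"
        by (simp add: abs_mult mult_left_mono)
    qed
    also have "\<dots> = \<epsilon> * (\<Sum>i\<in>Nr. \<bar>cf i\<bar>)\<^sup>2"
      by (simp add: power2_eq_square sum_product sum_distrib_left mult_ac)
    also have "\<dots> \<le> \<epsilon> * (inner zn zn * (2 * real K))"
    proof (rule mult_left_mono[OF _ eps])
      have "(\<Sum>i\<in>Nr. 1 * \<bar>cf i\<bar>)\<^sup>2 \<le> (\<Sum>i\<in>Nr. 1\<^sup>2) * (\<Sum>i\<in>Nr. \<bar>cf i\<bar>\<^sup>2)"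
        by (rule Cauchy_Schwarz_ineq_sum)
      also have "\<dots> = real (card Nr) * inner zn zn" by (simp add: zn_sum)
      also have "\<dots> \<le> 2 * real K * inner zn zn" by (intro mult_right_mono cardNr) auto
      finally show "(\<Sum>i\<in>Nr. \<bar>cf i\<bar>)\<^sup>2 \<le> inner zn zn * (2 * real K)" by (simp add: mult_ac)
    qed
    also have "\<dots> \<le> \<epsilon> * (r\<^sup>2 * (2 * real K))"
    proof (intro mult_left_mono mult_right_mono eps)
      show "inner zn zn \<le> r\<^sup>2"
        using nzn power_mono[OF nzn norm_ge_zero, of 2] by (simp add: power2_norm_eq_inner)
    qed auto
    finally show ?thesis by (simp add: mult_ac)
  qed
  have zVz: "\<bar>inner z (V z)\<bar> \<le> (2 * real K * \<epsilon> + 2 * v / sqrt (real K) + v / real K) * r\<^sup>2"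
  proof -
    have z: "z = zn + zf" by (simp add: zf_def)
    have "inner z (V z) = inner zn (V zn) + 2 * inner zn (V zf) + inner zf (V zf)"
      unfolding z by (simp add: V_add inner_add_left inner_add_right V_sym[of zf zn] inner_commute)
    moreover have "\<bar>inner zn (V zf)\<bar> \<le> v * r * (r / sqrt (real K))"
      by (rule order_trans[OF inner_V_bound]) (intro mult_mono nzn nzf v_nonneg mult_nonneg_nonneg, auto simp: r0)
    moreover have "\<bar>inner zf (V zf)\<bar> \<le> v * (r / sqrt (real K)) * (r / sqrt (real K))"
      by (rule order_trans[OF inner_V_bound]) (intro mult_mono nzn nzf v_nonneg mult_nonneg_nonneg, auto simp: r0)
    ultimately have "\<bar>inner z (V z)\<bar> \<le> 2 * real K * \<epsilon> * r\<^sup>2 + 2 * (v * r * (r / sqrt (real K)))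
      + v * (r / sqrt (real K)) * (r / sqrt (real K))" using nn by linarith
    also have "\<dots> = (2 * real K * \<epsilon> + 2 * v / sqrt (real K) + v / real K) * r\<^sup>2"
      using K by (simp add: field_simps power2_eq_square)
    finally show ?thesis .
  qed
  have cross: "(inner (V (\<phi> n)) z)\<^sup>2 \<le> s * M"
  proof -
    have "(\<lambda>j. inner (\<phi> j) (V (\<phi> n)) * inner (\<phi> j) z) sums inner (V (\<phi> n)) z"
      by (rule parseval_polar)
    then have "(\<lambda>N. (\<Sum>j<N. inner (\<phi> j) (V (\<phi> n)) * inner (\<phi> j) z)\<^sup>2)
        \<longlonglongrightarrow> (inner (V (\<phi> n)) z)\<^sup>2"
      unfolding sums_def by (intro tendsto_power)
    then show ?thesis
    proof (rule LIMSEQ_le_const2, intro exI allI impI)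
      fix N :: nat
      define F where "F = {..<N} - {n}"
      have F: "finite F" "n \<notin> F" by (auto simp: F_def)
      have "(\<Sum>j<N. inner (\<phi> j) (V (\<phi> n)) * inner (\<phi> j) z)
          = (\<Sum>j\<in>F. inner (\<phi> j) (V (\<phi> n)) * inner (\<phi> j) z)"
        by (rule sum.mono_neutral_right) (auto simp: F_def cfz)
      \<comment> \<open>Cauchy-Schwarz with the square root of the weight split between the factors:
        one sum becomes the second-order quantity \<open>s\<close>, the other a partial sum of
        \<open>M\<close>.\<close>
      also have "\<dots> = (\<Sum>j\<in>F. (inner (\<phi> j) (V (\<phi> n)) / sqrt (w * \<bar>real j - real n\<bar>))
           * (sqrt (w * \<bar>real j - real n\<bar>) * cf j))"
        using w_pos by (intro sum.cong refl) (auto simp: cfz F_def)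
      finally have "(\<Sum>j<N. inner (\<phi> j) (V (\<phi> n)) * inner (\<phi> j) z)\<^sup>2 \<le>
        (\<Sum>j\<in>F. (inner (\<phi> j) (V (\<phi> n)) / sqrt (w * \<bar>real j - real n\<bar>))\<^sup>2)
        * (\<Sum>j\<in>F. (sqrt (w * \<bar>real j - real n\<bar>) * cf j)\<^sup>2)"
        by (simp only: Cauchy_Schwarz_ineq_sum)
      also have "\<dots> = ((\<Sum>j\<in>F. (inner (\<phi> j) (V (\<phi> n)))\<^sup>2 / \<bar>real j - real n\<bar>) / w)
        * (\<Sum>j\<in>F. w * \<bar>real j - real n\<bar> * (cf j)\<^sup>2)"
        using w_pos by (simp add: power_divide power_mult_distrib sum_divide_distrib abs_mult mult_ac)
      also have "\<dots> \<le> s * M"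
      proof (intro mult_mono)
        show "(\<Sum>j\<in>F. (inner (\<phi> j) (V (\<phi> n)))\<^sup>2 / \<bar>real j - real n\<bar>) / w \<le> s"
          using row[OF F] w_pos by (simp add: field_simps)
        show "(\<Sum>j\<in>F. w * \<bar>real j - real n\<bar> * (cf j)\<^sup>2) \<le> M"
          using sum_le_suminf[OF sums_summable[OF M] F(1)] w_pos sums_unique[OF M]
          by (auto simp: cf_def)
        show "0 \<le> s" using row[of "{}"] w_pos by (simp add: zero_le_mult_iff)
      qed (use w_pos in \<open>auto intro!: sum_nonneg\<close>)
      finally show "(\<Sum>j<N. inner (\<phi> j) (V (\<phi> n)) * inner (\<phi> j) z)\<^sup>2 \<le> s * M" .
    qed
  qed
  have s0: "0 \<le> s" using row[of "{}"] w_pos by (simp add: zero_le_mult_iff)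
  have x: "x = cf n *\<^sub>R \<phi> n + z" by (simp add: z_def)
  have xVx: "inner x (V x) = (cf n)\<^sup>2 * V0 + 2 * cf n * inner (V (\<phi> n)) z + inner z (V z)"
    by (subst (1 2) x) (simp add: V_add V_scale inner_add_left inner_add_right V_sym[of z "\<phi> n"]
      V0_def power2_eq_square inner_commute algebra_simps)
  have xx: "inner x x = (cf n)\<^sup>2 + inner z z"
    by (subst (1 2) x) (use cfz[of n] in \<open>simp add: inner_add_left inner_add_right orthonormal
      power2_eq_square inner_commute\<close>)
  have V0: "\<bar>V0\<bar> \<le> \<epsilon>" unfolding V0_def by (intro near) auto
  \<comment> \<open>The total budget is one full \<open>M\<close>, because \<open>M\<close> is later
    cancelled against the form of \<open>H_0 - lam n\<close>. Half of it absorbs the cross term by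
    completing a square; \<open>c2\<close> spends the other half on \<open>z\<close>.\<close>
  have c1: "\<bar>2 * cf n * inner (V (\<phi> n)) z\<bar> \<le> 2 * s * (cf n)\<^sup>2 + M / 2"
  proof -
    have "\<bar>inner (V (\<phi> n)) z\<bar> \<le> sqrt (s * M)"
      using cross by (intro real_le_rsqrt) auto
    then have "\<bar>2 * cf n * inner (V (\<phi> n)) z\<bar> \<le> 2 * \<bar>cf n\<bar> * (sqrt s * sqrt M)"
      by (simp add: abs_mult mult_left_mono real_sqrt_mult)
    also have "\<dots> \<le> 2 * s * (cf n)\<^sup>2 + M / 2"
    proof -
      have "0 \<le> 2 * (sqrt s * \<bar>cf n\<bar> - sqrt M / 2)\<^sup>2" by simp
      also have "\<dots> = 2 * s * (cf n)\<^sup>2 + M / 2 - 2 * \<bar>cf n\<bar> * (sqrt s * sqrt M)"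
        using s0 M0 by (simp add: power2_diff power_mult_distrib power_divide algebra_simps)
      finally show ?thesis by linarith
    qed
    finally show ?thesis .
  qed
  have c2: "\<bar>inner z (V z)\<bar> + \<bar>V0\<bar> * inner z z \<le> M / 2"
  proof -
    have "\<bar>V0\<bar> * inner z z \<le> \<epsilon> * r\<^sup>2"
      using wz w_pos by (intro mult_mono V0 eps) (auto simp: r2 field_simps)
    then have "\<bar>inner z (V z)\<bar> + \<bar>V0\<bar> * inner z z
        \<le> (2 * real K * \<epsilon> + 2 * v / sqrt (real K) + v / real K + \<epsilon>) * r\<^sup>2"
      using zVz by (simp add: algebra_simps)
    also have "\<dots> \<le> w / 2 * r\<^sup>2" by (intro mult_right_mono small) auto
    also have "\<dots> = M / 2" using w_pos by (simp add: r2)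
    finally show ?thesis .
  qed
  have "inner x (V x) - V0 * inner x x = 2 * cf n * inner (V (\<phi> n)) z + inner z (V z) - V0 * inner z z"
    by (simp add: xVx xx algebra_simps)
  moreover have "\<bar>V0 * inner z z\<bar> = \<bar>V0\<bar> * inner z z" by (simp add: abs_mult)
  ultimately have "\<bar>inner x (V x) - V0 * inner x x\<bar> \<le> 2 * s * (cf n)\<^sup>2 + M"
    using c1 c2 by linarith
  also have "\<dots> \<le> 2 * s * inner x x + M" using s0 by (simp add: xx mult_left_mono)
  finally show ?thesis by (simp add: V0_def)
qed

section \<open>Eigenspaces and the lower bound by dimension counting\<close>

lemma subspace_eigenspace: "subspace (eigenspace l)"
proof -
  have "lam j * (r * p) + r * q = l * (r * p)" if "lam j * p + q = l * p" for j r p q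
  proof -
    have "lam j * (r * p) + r * q = r * (lam j * p + q)" by (simp add: algebra_simps)
    then show ?thesis by (simp add: that)
  qed
  moreover have "lam j * (p + p') + (q + q') = l * (p + p')"
    if "lam j * p + q = l * p" "lam j * p' + q' = l * p'" for j p q p' q'
    using that by (simp add: algebra_simps)
  ultimately show ?thesis unfolding subspace_def eigenspace_def
    by (auto simp: V_add V_scale V_zero inner_add_right)
qed

text \<open>Sums the weak equation against the coefficients of an arbitrary \<open>y\<close>. With
  \<open>y = x\<close> it puts eigenvectors into the form domain; with two eigenvectors exchanged it
  makes different eigenspaces orthogonal.\<close>

lemma eigenvector_pairing:
  assumes "x \<in> eigenspace l"
  shows "(\<lambda>j. lam j * (inner (\<phi> j) x * inner (\<phi> j) y)) sums (l * inner x y - inner (V x) y)"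
proof -
  have "(\<lambda>j. l * (inner (\<phi> j) x * inner (\<phi> j) y) - inner (\<phi> j) (V x) * inner (\<phi> j) y)
      sums (l * inner x y - inner (V x) y)"
    by (intro sums_diff sums_mult parseval_polar)
  moreover have "l * (inner (\<phi> j) x * inner (\<phi> j) y) - inner (\<phi> j) (V x) * inner (\<phi> j) y
      = lam j * (inner (\<phi> j) x * inner (\<phi> j) y)" for j
  proof -
    have "lam j * inner (\<phi> j) x + inner (\<phi> j) (V x) = l * inner (\<phi> j) x"
      using assms by (simp add: eigenspace_def)
    then have "(lam j * inner (\<phi> j) x + inner (\<phi> j) (V x)) * inner (\<phi> j) y
      = l * inner (\<phi> j) x * inner (\<phi> j) y" by simp
    then show ?thesis by (simp add: algebra_simps)
  qed
  ultimately show ?thesis by simp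
qed

lemma eigenspaces_orthogonal:
  assumes x: "x \<in> eigenspace l" and y: "y \<in> eigenspace l'" and "l \<noteq> l'"
  shows "inner x y = 0"
proof -
  have "l * inner x y - inner (V x) y = l' * inner y x - inner (V y) x"
    using sums_unique2[OF eigenvector_pairing[OF x, of y]] eigenvector_pairing[OF y, of x]
    by (simp add: mult.commute mult.left_commute)
  then have "(l - l') * inner x y = 0"
    using V_sym[of y x] by (simp add: algebra_simps inner_commute)
  with \<open>l \<noteq> l'\<close> show ?thesis by simp
qed

lemma summable_weighted_iff:
  "summable (\<lambda>j. (w * real j + d) * (inner (\<phi> j) x)\<^sup>2) \<longleftrightarrow> x \<in> form_domain"
proof -
  have s: "summable (\<lambda>j. d * (inner (\<phi> j) x)\<^sup>2)"
    using sums_summable[OF parseval] by (intro summable_mult)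
  have "summable (\<lambda>j. (w * real j + d) * (inner (\<phi> j) x)\<^sup>2) \<longleftrightarrow>
        summable (\<lambda>j. w * (real j * (inner (\<phi> j) x)\<^sup>2))"
    using summable_add[OF _ s, of "\<lambda>j. w * (real j * (inner (\<phi> j) x)\<^sup>2)"]
      summable_diff[OF _ s, of "\<lambda>j. (w * real j + d) * (inner (\<phi> j) x)\<^sup>2"]
    by (auto simp: algebra_simps)
  also have "\<dots> \<longleftrightarrow> x \<in> form_domain"
    using w_pos by (simp add: form_domain_def summable_cmult_iff)
  finally show ?thesis .
qed

text \<open>More than \<open>n\<close> independent eigenvectors have a nonzero combination
  \<open>x\<close> orthogonal to the first \<open>n\<close> levels. There
  \<open>\<bar>H_0 - lam n\<bar>\<close> is \<open>H_0 - lam n\<close>, so \<open>bound\<close>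
  forces the energy of \<open>x\<close> up to \<open>lam n + V0 - s\<close>, while its eigenvector
  expansion keeps the energy strictly below.\<close>

lemma card_eigenvectors_le:
  assumes bound: "\<And>x M. (\<lambda>j. w * \<bar>real j - real n\<bar> * (inner (\<phi> j) x)\<^sup>2) sums M \<Longrightarrow>
      \<bar>inner x (V x) - V0 * inner x x\<bar> \<le> s * inner x x + M"
    and B: "finite B" "independent B" "\<And>b. b \<in> B \<Longrightarrow> \<exists>l < lam n + V0 - s. b \<in> eigenspace l"
  shows "card B \<le> n"
proof (rule ccontr)
  assume "\<not> card B \<le> n"
  define f where "f x = (\<Sum>j<n. inner (\<phi> j) x *\<^sub>R \<phi> j)" for x
  have f_lin: "linear f"
    by (rule linearI) (simp_all add: f_def inner_add_right scaleR_add_left sum.distrib scaleR_sum_right)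
  have f_coeff: "inner (\<phi> j) (f x) = inner (\<phi> j) x" if "j < n" for j x
    unfolding f_def by (subst coeff_sum) (use that in auto)
  have "\<not> inj_on f (span B)"
  proof
    assume inj: "inj_on f (span B)"
    then have "independent (f ` B)"
      using linear_independent_injective_image[OF f_lin B(2)] by blast
    moreover have "f ` B \<subseteq> span (\<phi> ` {..<n})"
      unfolding f_def by (auto intro!: span_sum span_scale intro: span_base)
    ultimately have "card (f ` B) \<le> card (\<phi> ` {..<n})"
      using independent_span_bound[of "\<phi> ` {..<n}" "f ` B"] by simp
    moreover have "card (f ` B) = card B"
      using inj by (intro card_image) (meson inj_on_subset span_superset)
    moreover have "card (\<phi> ` {..<n}) \<le> n" using card_image_le[of "{..<n}" \<phi>] by simp
    ultimately show False using \<open>\<not> card B \<le> n\<close> by linarith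
  qed
  then obtain p q where pq: "p \<in> span B" "q \<in> span B" "p \<noteq> q" "f p = f q"
    by (auto simp: inj_on_def)
  define x where "x = p - q"
  have x: "x \<in> span B" "x \<noteq> 0" "f x = 0"
    using pq f_lin by (auto simp: x_def span_diff linear_diff)
  have low: "inner (\<phi> j) x = 0" if "j < n" for j
    using f_coeff[OF that, of x] x(3) by simp
  obtain e where e: "\<And>b. b \<in> B \<Longrightarrow> e b < lam n + V0 - s" "\<And>b. b \<in> B \<Longrightarrow> b \<in> eigenspace (e b)"
    using B(3) by metis
  obtain u where u: "x = (\<Sum>b\<in>B. u b *\<^sub>R b)"
    using x(1) span_finite[OF B(1)] by auto
  \<comment> \<open>Vectors of \<open>B\<close> inside one eigenspace need not be orthogonal.
    Grouping the combination by eigenvalue gives orthogonal pieces \<open>y l\<close>, in which the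
    energy is diagonal.\<close>
  define L where "L = e ` B"
  define y where "y l = (\<Sum>b\<in>{b\<in>B. e b = l}. u b *\<^sub>R b)" for l
  have L: "finite L" using B(1) by (simp add: L_def)
  have xy: "x = (\<Sum>l\<in>L. y l)"
    unfolding u y_def L_def by (rule sum.image_gen[OF B(1)])
  have y: "y l \<in> eigenspace l" for l
    unfolding y_def
    by (intro subspace_sum subspace_scale subspace_eigenspace) (use e(2) in auto)
  define Hx where "Hx = (\<Sum>l\<in>L. l *\<^sub>R y l)"
  have Hx_coeff: "inner (\<phi> j) Hx = lam j * inner (\<phi> j) x + inner (\<phi> j) (V x)" for j
  proof -
    have "V x = (\<Sum>l\<in>L. V (y l))" unfolding xy using V_linear by (simp add: linear_sum)
    then have "lam j * inner (\<phi> j) x + inner (\<phi> j) (V x)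
      = (\<Sum>l\<in>L. lam j * inner (\<phi> j) (y l) + inner (\<phi> j) (V (y l)))"
      by (simp add: xy inner_sum_right sum_distrib_left sum.distrib)
    also have "\<dots> = (\<Sum>l\<in>L. l * inner (\<phi> j) (y l))"
      using y by (intro sum.cong refl) (auto simp: eigenspace_def)
    finally show ?thesis by (simp add: Hx_def inner_sum_right)
  qed
  have orth: "inner (y l) (y l') = 0" if "l \<noteq> l'" for l l'
    using eigenspaces_orthogonal[OF y y that] .
  have xHx: "inner x Hx = (\<Sum>l\<in>L. l * inner (y l) (y l))"
  proof -
    have "inner x Hx = (\<Sum>l\<in>L. \<Sum>l'\<in>L. l * inner (y l') (y l))"
      by (simp add: xy Hx_def inner_sum_left inner_sum_right sum_distrib_left)
    also have "\<dots> = (\<Sum>l\<in>L. \<Sum>l'\<in>L. if l' = l then l * inner (y l) (y l) else 0)"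
      by (intro sum.cong refl) (auto simp: orth)
    finally show ?thesis using L by simp
  qed
  have xx: "inner x x = (\<Sum>l\<in>L. inner (y l) (y l))"
  proof -
    have "inner x x = (\<Sum>l\<in>L. \<Sum>l'\<in>L. inner (y l) (y l'))"
      by (simp add: xy inner_sum_left inner_sum_right, subst sum.swap, simp)
    also have "\<dots> = (\<Sum>l\<in>L. \<Sum>l'\<in>L. if l' = l then inner (y l) (y l) else 0)"
      by (intro sum.cong refl) (auto simp: orth)
    finally show ?thesis using L by simp
  qed
  have strict: "inner x Hx < (lam n + V0 - s) * inner x x"
    unfolding xHx xx sum_distrib_left
  proof (rule sum_strict_mono_ex1[OF L])
    show "\<forall>l\<in>L. l * inner (y l) (y l) \<le> (lam n + V0 - s) * inner (y l) (y l)"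
      using e(1) by (intro ballI mult_right_mono) (auto simp: L_def intro: less_imp_le)
    obtain l where l: "l \<in> L" "y l \<noteq> 0"
      using x(2) unfolding xy by (meson sum.neutral)
    then have "l < lam n + V0 - s" using e(1) by (auto simp: L_def)
    with l show "\<exists>l\<in>L. l * inner (y l) (y l) < (lam n + V0 - s) * inner (y l) (y l)"
      by (intro bexI[of _ l] mult_strict_right_mono) auto
  qed
  have "(\<lambda>j. inner (\<phi> j) x * inner (\<phi> j) Hx - inner (\<phi> j) x * inner (\<phi> j) (V x)
      - lam n * (inner (\<phi> j) x)\<^sup>2) sums (inner x Hx - inner x (V x) - lam n * inner x x)"
    by (intro sums_diff sums_mult parseval parseval_polar)
  \<comment> \<open>Below level \<open>n\<close> the coefficients of \<open>x\<close> vanish and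
    above it \<open>real j - real n\<close> is its own absolute value, so this series is exactly the
    one called \<open>M\<close> in \<open>bound\<close>.\<close>
  moreover have "inner (\<phi> j) x * inner (\<phi> j) Hx - inner (\<phi> j) x * inner (\<phi> j) (V x)
      - lam n * (inner (\<phi> j) x)\<^sup>2 = w * \<bar>real j - real n\<bar> * (inner (\<phi> j) x)\<^sup>2" for j
    using low[of j]
    by (cases "j < n") (auto simp: Hx_coeff lam_def algebra_simps power2_eq_square)
  ultimately have "(\<lambda>j. w * \<bar>real j - real n\<bar> * (inner (\<phi> j) x)\<^sup>2)
      sums (inner x Hx - inner x (V x) - lam n * inner x x)" by simp
  from bound[OF this] have "(lam n + V0 - s) * inner x x \<le> inner x Hx"
    by (auto simp: algebra_simps abs_le_iff)
  with strict show False by simp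
qed

section \<open>Compactness of form-bounded sets and existence of eigenvectors\<close>

lemma tail_bound:
  assumes "\<And>N. (\<Sum>j<N. (w * real j + 1) * (inner (\<phi> j) x)\<^sup>2) \<le> 1"
  shows "inner x x \<le> (\<Sum>j<N. (inner (\<phi> j) x)\<^sup>2) + 1 / (w * real N + 1)"
proof -
  have "(\<lambda>n. \<Sum>j<n. (inner (\<phi> j) x)\<^sup>2) \<longlonglongrightarrow> inner x x"
    using parseval unfolding sums_def .
  then show ?thesis
  proof (rule LIMSEQ_le_const2, intro exI allI impI)
    fix n assume n: "N \<le> n"
    have "(w * real N + 1) * (\<Sum>j\<in>{N..<n}. (inner (\<phi> j) x)\<^sup>2)
        \<le> (\<Sum>j\<in>{N..<n}. (w * real j + 1) * (inner (\<phi> j) x)\<^sup>2)"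
      unfolding sum_distrib_left using w_pos by (intro sum_mono mult_right_mono) auto
    also have "\<dots> \<le> (\<Sum>j<n. (w * real j + 1) * (inner (\<phi> j) x)\<^sup>2)"
      using w_pos by (intro sum_mono2) auto
    also have "\<dots> \<le> 1" by (rule assms)
    finally have "(\<Sum>j\<in>{N..<n}. (inner (\<phi> j) x)\<^sup>2) \<le> 1 / (w * real N + 1)"
      using w_pos by (simp add: field_simps add_pos_nonneg)
    moreover have "(\<Sum>j<n. (inner (\<phi> j) x)\<^sup>2)
        = (\<Sum>j<N. (inner (\<phi> j) x)\<^sup>2) + (\<Sum>j\<in>{N..<n}. (inner (\<phi> j) x)\<^sup>2)"
      using n by (metis lessThan_atLeast0 sum.atLeastLessThan_concat zero_le)
    ultimately show "(\<Sum>j<n. (inner (\<phi> j) x)\<^sup>2) \<le> (\<Sum>j<N. (inner (\<phi> j) x)\<^sup>2) + 1 / (w * real N + 1)"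
      by simp
  qed
qed

text \<open>A diagonal subsequence makes every coefficient converge. The weights grow with
  \<open>j\<close>, so tails are uniformly small and coefficientwise convergence becomes norm
  convergence. Imposing the bound on all partial sums makes closedness immediate.\<close>

lemma compact_ellipsoid:
  "compact {x. \<forall>N. (\<Sum>j<N. (w * real j + 1) * (inner (\<phi> j) x)\<^sup>2) \<le> 1}" (is "compact ?T")
  unfolding compact_eq_seq_compact_metric seq_compact_def
proof (intro allI impI)
  fix f :: "nat \<Rightarrow> 'a" assume f: "\<forall>n. f n \<in> ?T"
  have closed: "closed ?T"
    by (intro closed_Collect_all closed_Collect_le continuous_intros)
  have b: "norm (inner (\<phi> j) (f n)) \<le> 1" for j n
  proof -
    have "(inner (\<phi> j) (f n))\<^sup>2 \<le> (w * real j + 1) * (inner (\<phi> j) (f n))\<^sup>2"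
      using mult_right_mono[of 1 "w * real j + 1" "(inner (\<phi> j) (f n))\<^sup>2"] w_pos by simp
    also have "\<dots> \<le> (\<Sum>j<Suc j. (w * real j + 1) * (inner (\<phi> j) (f n))\<^sup>2)"
      using w_pos by (intro member_le_sum) auto
    also have "\<dots> \<le> 1" using f by blast
    finally show ?thesis by (simp add: abs_square_le_1)
  qed
  obtain k where k: "strict_mono k" "\<And>j. j \<in> UNIV \<Longrightarrow> \<exists>l. (\<lambda>n. inner (\<phi> j) (f (k n))) \<longlonglongrightarrow> l"
    using function_convergent_subsequence[of "UNIV :: nat set" "\<lambda>n j. inner (\<phi> j) (f n)" 1] b by auto
  have "Cauchy (f \<circ> k)"
  proof (rule metric_CauchyI)
    fix e :: real assume e: "e > 0"
    define A where "A = e\<^sup>2"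
    have A: "A > 0" using e by (simp add: A_def)
    obtain N :: nat where N: "real N > 8 / (A * w)" using reals_Archimedean2 by blast
    have N1: "4 / (w * real N + 1) < A / 2"
      using N A w_pos by (simp add: field_simps add_pos_nonneg)
    have "\<forall>j. Cauchy (\<lambda>n. inner (\<phi> j) (f (k n)))"
      using k(2) by (auto intro: LIMSEQ_imp_Cauchy)
    then have "\<forall>j. \<exists>M. \<forall>m\<ge>M. \<forall>n\<ge>M. dist (inner (\<phi> j) (f (k m))) (inner (\<phi> j) (f (k n))) < sqrt (A / (2 * (real N + 1)))"
      using A by (auto simp: Cauchy_def)
    then obtain M where M: "\<And>j m n. m \<ge> M j \<Longrightarrow> n \<ge> M j \<Longrightarrow>
       dist (inner (\<phi> j) (f (k m))) (inner (\<phi> j) (f (k n))) < sqrt (A / (2 * (real N + 1)))"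
      by metis
    define M' where "M' = (\<Sum>j<N. M j)"
    have M': "M j \<le> M'" if "j < N" for j
      unfolding M'_def using that by (intro member_le_sum) auto
    show "\<exists>M. \<forall>m\<ge>M. \<forall>n\<ge>M. dist ((f \<circ> k) m) ((f \<circ> k) n) < e"
    proof (intro exI allI impI)
      fix m n assume mn: "m \<ge> M'" "n \<ge> M'"
      define x where "x = f (k m)"
      define y where "y = f (k n)"
      have xT: "(\<Sum>j<N. (w * real j + 1) * (inner (\<phi> j) x)\<^sup>2) \<le> 1"
        and yT: "(\<Sum>j<N. (w * real j + 1) * (inner (\<phi> j) y)\<^sup>2) \<le> 1" for N
        using f by (auto simp: x_def y_def)
      \<comment> \<open>Half the difference of two points stays in the convex symmetric set, so
        \<open>tail_bound\<close> applies to it. The factor 4 lost by halving explains the choice of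
        \<open>N\<close>.\<close>
      have half: "(\<Sum>j<N. (w * real j + 1) * (inner (\<phi> j) ((1/2) *\<^sub>R (x - y)))\<^sup>2) \<le> 1" for N
      proof -
        have "(\<Sum>j<N. (w * real j + 1) * (inner (\<phi> j) ((1/2) *\<^sub>R (x - y)))\<^sup>2)
          \<le> (\<Sum>j<N. (w * real j + 1) * ((inner (\<phi> j) x)\<^sup>2 / 2 + (inner (\<phi> j) y)\<^sup>2 / 2))"
        proof (intro sum_mono mult_left_mono)
          fix j
          have "0 \<le> (inner (\<phi> j) x + inner (\<phi> j) y)\<^sup>2 / 4" by simp
          then show "(inner (\<phi> j) ((1/2) *\<^sub>R (x - y)))\<^sup>2 \<le> (inner (\<phi> j) x)\<^sup>2 / 2 + (inner (\<phi> j) y)\<^sup>2 / 2"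
            by (simp add: inner_diff_right power2_eq_square algebra_simps)
        qed (use w_pos in auto)
        also have "\<dots> = (\<Sum>j<N. (w * real j + 1) * (inner (\<phi> j) x)\<^sup>2) / 2
            + (\<Sum>j<N. (w * real j + 1) * (inner (\<phi> j) y)\<^sup>2) / 2"
          by (simp add: sum_divide_distrib flip: sum.distrib) (simp add: distrib_left)
        finally show ?thesis using xT[of N] yT[of N] by linarith
      qed
      have d: "(inner (\<phi> j) ((1/2) *\<^sub>R (x - y)))\<^sup>2 \<le> A / (8 * (real N + 1))" if "j < N" for j
      proof -
        have "\<bar>inner (\<phi> j) x - inner (\<phi> j) y\<bar> < sqrt (A / (2 * (real N + 1)))"
          using M[of j m n] M'[OF that] mn by (simp add: x_def y_def dist_real_def)
        then have "\<bar>inner (\<phi> j) x - inner (\<phi> j) y\<bar>\<^sup>2 \<le> (sqrt (A / (2 * (real N + 1))))\<^sup>2"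
          by (intro power_mono) auto
        then show ?thesis using A by (simp add: inner_diff_right power_divide field_simps)
      qed
      have "inner ((1/2) *\<^sub>R (x - y)) ((1/2) *\<^sub>R (x - y))
         \<le> (\<Sum>j<N. (inner (\<phi> j) ((1/2) *\<^sub>R (x - y)))\<^sup>2) + 1 / (w * real N + 1)"
        by (rule tail_bound[OF half])
      also have "\<dots> \<le> (\<Sum>j<N. A / (8 * (real N + 1))) + 1 / (w * real N + 1)"
        by (intro add_right_mono sum_mono d) auto
      also have "\<dots> \<le> A / 8 + 1 / (w * real N + 1)"
      proof -
        have "real N * (A / (8 * (real N + 1))) \<le> A / 8" using A by (simp add: field_simps)
        then show ?thesis by simp
      qed
      also have "\<dots> < A / 4" using N1 by simp
      finally have "inner (x - y) (x - y) < A" by simp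
      then have "(norm (x - y))\<^sup>2 < e\<^sup>2" by (simp add: A_def power2_norm_eq_inner)
      then have "norm (x - y) < e" using e by (intro power2_less_imp_less[of _ e]) auto
      then show "dist ((f \<circ> k) m) ((f \<circ> k) n) < e" by (simp add: dist_norm x_def y_def)
    qed
  qed
  then obtain l where l: "(f \<circ> k) \<longlonglongrightarrow> l" by (auto simp: Cauchy_convergent_iff convergent_def)
  moreover have "l \<in> ?T" using closed_sequentially[OF closed _ l] f by simp
  ultimately show "\<exists>l\<in>?T. \<exists>r. strict_mono r \<and> (f \<circ> r) \<longlonglongrightarrow> l" using k(1) by blast
qed

lemma subspace_form_domain: "subspace form_domain"
proof (rule subspaceI)
  show "0 \<in> form_domain" by (simp add: form_domain_def)
next
  fix x y assume xy: "x \<in> form_domain" "y \<in> form_domain"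
  have "summable (\<lambda>j. real j * (inner (\<phi> j) x + inner (\<phi> j) y)\<^sup>2)"
  proof (rule summable_comparison_test'[where N = 0])
    show "summable (\<lambda>j. 2 * (real j * (inner (\<phi> j) x)\<^sup>2) + 2 * (real j * (inner (\<phi> j) y)\<^sup>2))"
      using xy by (intro summable_add summable_mult) (auto simp: form_domain_def)
    fix j
    have "(inner (\<phi> j) x + inner (\<phi> j) y)\<^sup>2 \<le> 2 * (inner (\<phi> j) x)\<^sup>2 + 2 * (inner (\<phi> j) y)\<^sup>2"
      using zero_le_power2[of "inner (\<phi> j) x - inner (\<phi> j) y"] by (simp add: power2_eq_square algebra_simps)
    then have "real j * (inner (\<phi> j) x + inner (\<phi> j) y)\<^sup>2
        \<le> real j * (2 * (inner (\<phi> j) x)\<^sup>2 + 2 * (inner (\<phi> j) y)\<^sup>2)"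
      by (intro mult_left_mono) auto
    then show "norm (real j * (inner (\<phi> j) x + inner (\<phi> j) y)\<^sup>2)
        \<le> 2 * (real j * (inner (\<phi> j) x)\<^sup>2) + 2 * (real j * (inner (\<phi> j) y)\<^sup>2)"
      by (simp add: distrib_left mult.left_commute)
  qed
  then show "x + y \<in> form_domain" by (simp add: form_domain_def inner_add_right)
next
  fix r x assume "x \<in> form_domain"
  then have "summable (\<lambda>j. r\<^sup>2 * (real j * (inner (\<phi> j) x)\<^sup>2))"
    by (intro summable_mult) (simp add: form_domain_def)
  then show "r *\<^sub>R x \<in> form_domain"
    by (simp add: form_domain_def power_mult_distrib mult.left_commute)
qed

lemma eigenspace_subset_form_domain: "eigenspace l \<subseteq> form_domain"
proof
  fix x assume "x \<in> eigenspace l"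
  from sums_summable[OF eigenvector_pairing[OF this, of x]]
  have "summable (\<lambda>j. (w * real j + c) * (inner (\<phi> j) x)\<^sup>2)"
    by (simp add: lam_def power2_eq_square)
  then show "x \<in> form_domain" by (simp only: summable_weighted_iff)
qed

lemma basis_in_form_domain: "\<phi> i \<in> form_domain"
proof -
  have "(\<lambda>j. real j * (inner (\<phi> j) (\<phi> i))\<^sup>2) = (\<lambda>j. if j = i then real i else 0)"
    by (auto simp: orthonormal)
  then show ?thesis unfolding form_domain_def by simp
qed

text \<open>The positive form \<open>Q(x, y)\<close> of \<open>H + 1 - c + v\<close>, and the direct method: maximising
  \<open>|x|\<^sup>2\<close> over the compact set \<open>Q(x, x) \<le> 1\<close> in the orthogonal complement of \<open>W\<close>
  produces an eigenvector.\<close>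

lemma eigenvector_below:
  assumes W: "finite W" "\<And>u. u \<in> W \<Longrightarrow> \<exists>l. u \<in> eigenspace l"
    and x0: "x0 \<noteq> 0" "x0 \<in> form_domain" "\<And>u. u \<in> W \<Longrightarrow> inner u x0 = 0"
    and le: "(\<lambda>j. lam j * (inner (\<phi> j) x0)\<^sup>2) sums A" "A + inner x0 (V x0) \<le> \<mu> * inner x0 x0"
  shows "\<exists>x l. x \<noteq> 0 \<and> l \<le> \<mu> \<and> x \<in> eigenspace l \<and> (\<forall>u\<in>W. inner u x = 0)"
proof -
  define S where "S x y = (\<Sum>j. (w * real j + 1) * (inner (\<phi> j) x * inner (\<phi> j) y))" for x y
  define Q where "Q x y = S x y + (inner x (V y) + v * inner x y)" for x y
  have summ: "summable (\<lambda>j. (w * real j + 1) * (inner (\<phi> j) x * inner (\<phi> j) y))"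
    if "x \<in> form_domain" "y \<in> form_domain" for x y
  proof -
    have "summable (\<lambda>j. (1/2) * ((w * real j + 1) * (inner (\<phi> j) (x + y))\<^sup>2
        - (w * real j + 1) * (inner (\<phi> j) x)\<^sup>2 - (w * real j + 1) * (inner (\<phi> j) y)\<^sup>2))"
      using that by (intro summable_mult summable_diff) (auto simp: summable_weighted_iff subspace_add[OF subspace_form_domain])
    then show ?thesis
      by (rule summable_cong[THEN iffD1, rotated])
        (auto simp: inner_add_right power2_eq_square algebra_simps)
  qed
  note fd = subspace_add[OF subspace_form_domain] subspace_scale[OF subspace_form_domain]
  \<comment> \<open>The shift by \<open>v\<close> makes the perturbation nonnegative; together with
    weights at least 1 this gives \<open>Q x x\<close> at least \<open>inner x x\<close>.\<close>
  have V_pos: "0 \<le> inner x (V x) + v * inner x x" for x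
    using inner_V_bound[of x x] by (simp add: abs_le_iff norm_eq_sqrt_inner mult.assoc)
  have Q_ge: "inner x x \<le> Q x x" if "x \<in> form_domain" for x
  proof -
    have "inner x x \<le> S x x"
      unfolding S_def
    proof (rule sums_le[OF _ parseval summable_sums[OF summ[OF that that]]])
      fix j show "(inner (\<phi> j) x)\<^sup>2 \<le> (w * real j + 1) * (inner (\<phi> j) x * inner (\<phi> j) x)"
        using mult_right_mono[of 1 "w * real j + 1" "(inner (\<phi> j) x)\<^sup>2"] w_pos
        by (simp add: power2_eq_square)
    qed
    then show ?thesis using V_pos[of x] by (simp add: Q_def)
  qed
  \<comment> \<open>The constraint is put on every partial sum: this keeps \<open>K\<close> closed,
    and membership in the form domain is then derived from bounded partial sums.\<close>
  define K where "K = {x. (\<forall>u\<in>W. inner u x = 0) \<and>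
     (\<forall>N. (\<Sum>j<N. (w * real j + 1) * (inner (\<phi> j) x)\<^sup>2) + (inner x (V x) + v * inner x x) \<le> 1)}"
  have contV: "continuous_on UNIV V"
    using V_linear V_bound by (intro linear_continuous_on bounded_linear_intro[of _ v])
      (auto simp: linear_add linear_scale mult.commute)
  have closedK: "closed K"
  proof -
    have "K = {x. \<forall>u\<in>W. inner u x = 0} \<inter>
      {x. \<forall>N. (\<Sum>j<N. (w * real j + 1) * (inner (\<phi> j) x)\<^sup>2) + (inner x (V x) + v * inner x x) \<le> 1}"
      by (auto simp: K_def)
    moreover have "closed {x. \<forall>u\<in>W. inner u x = 0}"
    proof -
      have "{x. \<forall>u\<in>W. inner u x = 0} = (\<Inter>u\<in>W. {x. inner u x = 0})" by auto
      then show ?thesis by (auto intro!: closed_INT closed_Collect_eq continuous_intros)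
    qed
    moreover have "closed {x. \<forall>N. (\<Sum>j<N. (w * real j + 1) * (inner (\<phi> j) x)\<^sup>2)
        + (inner x (V x) + v * inner x x) \<le> 1}"
      by (intro closed_Collect_all closed_Collect_le continuous_intros contV)
    ultimately show ?thesis by auto
  qed
  have "K \<subseteq> {x. \<forall>N. (\<Sum>j<N. (w * real j + 1) * (inner (\<phi> j) x)\<^sup>2) \<le> 1}"
  proof
    fix x assume x: "x \<in> K"
    have "(\<Sum>j<N. (w * real j + 1) * (inner (\<phi> j) x)\<^sup>2) \<le> 1" for N
    proof -
      have "(\<Sum>j<N. (w * real j + 1) * (inner (\<phi> j) x)\<^sup>2) + (inner x (V x) + v * inner x x) \<le> 1"
        using x by (simp add: K_def)
      then show ?thesis using V_pos[of x] by linarith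
    qed
    then show "x \<in> {x. \<forall>N. (\<Sum>j<N. (w * real j + 1) * (inner (\<phi> j) x)\<^sup>2) \<le> 1}" by simp
  qed
  then have compactK: "compact K"
    using compact_Int_closed[OF compact_ellipsoid closedK] by (simp add: Int_absorb1)
  have K_in_domain: "x \<in> form_domain" and K_Q: "Q x x \<le> 1" if "x \<in> K" for x
  proof -
    have part: "(\<Sum>j<N. (w * real j + 1) * (inner (\<phi> j) x)\<^sup>2) \<le> 1 - (inner x (V x) + v * inner x x)" for N
      using that unfolding K_def by (auto simp: algebra_simps)
    have "summable (\<lambda>j. (w * real j + 1) * (inner (\<phi> j) x)\<^sup>2)"
      using w_pos part by (intro summableI_nonneg_bounded) auto
    then show D: "x \<in> form_domain" by (simp only: summable_weighted_iff)
    have "S x x \<le> 1 - (inner x (V x) + v * inner x x)"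
      unfolding S_def using part
      by (intro suminf_le_const summ[OF D D]) (simp_all add: power2_eq_square)
    then show "Q x x \<le> 1" by (simp add: Q_def)
  qed
  have scaled: "(1 / sqrt (Q x x)) *\<^sub>R x \<in> K" if "x \<in> form_domain" "\<forall>u\<in>W. inner u x = 0" "x \<noteq> 0" for x
  proof -
    have "0 < inner x x" using that(3) by simp
    then have Qp: "0 < Q x x" using Q_ge[OF that(1)] by linarith
    have "(\<Sum>j<N. (w * real j + 1) * (inner (\<phi> j) x)\<^sup>2) + (inner x (V x) + v * inner x x) \<le> Q x x" for N
    proof -
      have "(\<Sum>j<N. (w * real j + 1) * (inner (\<phi> j) x * inner (\<phi> j) x)) \<le> S x x"
        unfolding S_def using w_pos by (intro sum_le_suminf summ that(1)) auto
      then show ?thesis by (simp add: Q_def power2_eq_square)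
    qed
    moreover have "(\<Sum>j<N. (w * real j + 1) * (inner (\<phi> j) ((1 / sqrt (Q x x)) *\<^sub>R x))\<^sup>2)
       + (inner ((1 / sqrt (Q x x)) *\<^sub>R x) (V ((1 / sqrt (Q x x)) *\<^sub>R x))
       + v * inner ((1 / sqrt (Q x x)) *\<^sub>R x) ((1 / sqrt (Q x x)) *\<^sub>R x))
       = ((\<Sum>j<N. (w * real j + 1) * (inner (\<phi> j) x)\<^sup>2) + (inner x (V x) + v * inner x x)) / Q x x" for N
      using Qp by (simp add: V_scale power_divide add_divide_distrib sum_divide_distrib)
    ultimately show ?thesis using Qp that(2) by (simp add: K_def)
  qed
  have "K \<noteq> {}" using scaled[OF x0(2) _ x0(1)] x0(3) by blast
  then have "\<exists>x\<in>K. \<forall>y\<in>K. inner y y \<le> inner x x"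
    by (intro continuous_attains_sup compactK continuous_intros)
  then obtain x where x: "x \<in> K" "\<And>y. y \<in> K \<Longrightarrow> inner y y \<le> inner x x" by blast
  define \<kappa> where "\<kappa> = inner x x"
  have xD: "x \<in> form_domain" and xW: "\<forall>u\<in>W. inner u x = 0"
    using x(1) K_in_domain by (auto simp: K_def)
  have max: "inner y y \<le> \<kappa> * Q y y" if "y \<in> form_domain" "\<forall>u\<in>W. inner u y = 0" for y
  proof (cases "y = 0")
    case False
    then have "0 < inner y y" by simp
    then have Qp: "0 < Q y y" using Q_ge[OF that(1)] by linarith
    have "inner ((1 / sqrt (Q y y)) *\<^sub>R y) ((1 / sqrt (Q y y)) *\<^sub>R y) \<le> \<kappa>"
      unfolding \<kappa>_def by (rule x(2)[OF scaled[OF that False]])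
    then show ?thesis using Qp by (simp add: field_simps)
  qed (simp add: Q_def S_def V_zero)
  have x0Q: "inner x0 x0 \<le> \<kappa> * Q x0 x0" using max[OF x0(2)] x0(3) by blast
  have x0p: "0 < inner x0 x0" using x0(1) by simp
  have x0Qp: "0 < Q x0 x0" using Q_ge[OF x0(2)] x0p by linarith
  have \<kappa>: "\<kappa> > 0"
  proof (rule ccontr)
    assume "\<not> \<kappa> > 0"
    then have "\<kappa> * Q x0 x0 \<le> 0" using x0Qp by (intro mult_nonpos_nonneg) auto
    with x0Q x0p show False by linarith
  qed
  have Qx: "\<kappa> * Q x x = \<kappa>"
    using max[OF xD xW] mult_left_mono[OF K_Q[OF x(1)] less_imp_le[OF \<kappa>]] by (simp add: \<kappa>_def)
  have Q_expand: "Q (x + t *\<^sub>R h) (x + t *\<^sub>R h) = Q x x + 2 * t * Q x h + t\<^sup>2 * Q h h"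
    if h: "h \<in> form_domain" for h t
  proof -
    have "(\<lambda>j. (w * real j + 1) * (inner (\<phi> j) x * inner (\<phi> j) x)
      + 2 * t * ((w * real j + 1) * (inner (\<phi> j) x * inner (\<phi> j) h))
      + t\<^sup>2 * ((w * real j + 1) * (inner (\<phi> j) h * inner (\<phi> j) h))) sums (S x x + 2 * t * S x h + t\<^sup>2 * S h h)"
      unfolding S_def by (intro sums_add sums_mult summable_sums summ xD h)
    moreover have "(w * real j + 1) * (inner (\<phi> j) x * inner (\<phi> j) x)
      + 2 * t * ((w * real j + 1) * (inner (\<phi> j) x * inner (\<phi> j) h))
      + t\<^sup>2 * ((w * real j + 1) * (inner (\<phi> j) h * inner (\<phi> j) h))
      = (w * real j + 1) * (inner (\<phi> j) (x + t *\<^sub>R h) * inner (\<phi> j) (x + t *\<^sub>R h))" for j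
      by (simp add: inner_add_right power2_eq_square algebra_simps)
    ultimately have "S (x + t *\<^sub>R h) (x + t *\<^sub>R h) = S x x + 2 * t * S x h + t\<^sup>2 * S h h"
      unfolding S_def by (simp add: sums_iff)
    then show ?thesis
      by (simp add: Q_def V_add V_scale inner_add_left inner_add_right V_sym[of h x] inner_commute
        power2_eq_square algebra_simps)
  qed
  \<comment> \<open>Euler-Lagrange equation of the maximum: \<open>\<kappa> * Q - inner\<close> is a
    nonnegative quadratic form on the complement of \<open>W\<close> that vanishes at
    \<open>x\<close>, so its first variation there is zero.\<close>
  have variation: "\<kappa> * Q x h = inner x h" if h: "h \<in> form_domain" "\<forall>u\<in>W. inner u h = 0" for h
  proof -
    have "\<kappa> * Q x h - inner x h = 0"
    proof (rule quadratic_nonneg_imp_zero)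
      fix t :: real
      have "inner (x + t *\<^sub>R h) (x + t *\<^sub>R h) \<le> \<kappa> * Q (x + t *\<^sub>R h) (x + t *\<^sub>R h)"
        using xD xW h by (intro max) (simp_all add: inner_add_right fd)
      also have "\<dots> = \<kappa> + 2 * t * (\<kappa> * Q x h) + t\<^sup>2 * (\<kappa> * Q h h)"
        using Qx by (simp add: Q_expand[OF h(1)] algebra_simps)
      finally show "0 \<le> 2 * t * (\<kappa> * Q x h - inner x h) + t\<^sup>2 * (\<kappa> * Q h h - inner h h)"
        by (simp add: inner_add_left inner_add_right \<kappa>_def inner_commute power2_eq_square algebra_simps)
    qed
    then show ?thesis by simp
  qed
  have Q_add: "Q x (h + k) = Q x h + Q x k" if "h \<in> form_domain" "k \<in> form_domain" for h k
    using suminf_add[OF summ[OF xD that(1)] summ[OF xD that(2)]]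
    by (simp add: Q_def S_def inner_add_right V_add algebra_simps)
  have Q_scale: "Q x (r *\<^sub>R h) = r * Q x h" if "h \<in> form_domain" for h r
    using suminf_mult[OF summ[OF xD that], of r]
    by (simp add: Q_def S_def V_scale algebra_simps)
  \<comment> \<open>The vectors of \<open>W\<close> are eigenvectors, so orthogonality to
    \<open>x\<close> also makes them orthogonal to \<open>x\<close> with respect to
    \<open>Q\<close>. This extends the variational equation from the complement of \<open>W\<close>
    to all test vectors, in particular to each \<open>\<phi> j\<close>.\<close>
  have span_W: "p \<in> form_domain \<and> inner x p = 0 \<and> Q x p = 0" if "p \<in> span W" for p
    using that
  proof (induct rule: span_induct_alt)
    case base
    then show ?case using subspace_form_domain by (simp add: subspace_def Q_def S_def V_zero)
  next
    case (step r u y)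
    obtain l where l: "u \<in> eigenspace l" using W(2) step(1) by blast
    then have uD: "u \<in> form_domain" using eigenspace_subset_form_domain by blast
    have ux: "inner u x = 0" "inner x u = 0" using xW step(1) by (auto simp: inner_commute)
    have "(\<lambda>j. lam j * (inner (\<phi> j) u * inner (\<phi> j) x) + (1 - c) * (inner (\<phi> j) u * inner (\<phi> j) x))
       sums ((l * inner u x - inner (V u) x) + (1 - c) * inner u x)"
      by (intro sums_add sums_mult eigenvector_pairing l parseval_polar)
    then have "(\<lambda>j. (w * real j + 1) * (inner (\<phi> j) x * inner (\<phi> j) u)) sums (- inner (V u) x)"
      by (simp add: ux lam_def algebra_simps)
    then have "S x u = - inner (V u) x" unfolding S_def by (rule sums_unique[symmetric])
    then have "Q x u = 0" by (simp add: Q_def ux inner_commute)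
    then show ?case using step(2) uD ux
      by (simp add: Q_add Q_scale inner_add_right fd)
  qed
  have Qphi: "\<kappa> * Q x (\<phi> j) = inner x (\<phi> j)" for j
  proof -
    obtain p where p: "p \<in> span W" "\<And>u. u \<in> W \<Longrightarrow> inner u (\<phi> j - p) = 0"
      using finite_orthogonal_projection[OF W(1)] by blast
    note sp = span_W[OF p(1)]
    have hD: "\<phi> j - p \<in> form_domain"
      using sp by (intro subspace_diff subspace_form_domain basis_in_form_domain) auto
    have "\<kappa> * Q x (\<phi> j - p) = inner x (\<phi> j - p)" by (rule variation[OF hD]) (use p(2) in auto)
    moreover have "Q x (\<phi> j) = Q x (\<phi> j - p)" using Q_add[OF hD, of p] sp by simp
    ultimately show ?thesis using sp by (simp add: inner_diff_right)
  qed
  have S_phi: "S x (\<phi> j) = (w * real j + 1) * inner (\<phi> j) x" for j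
  proof -
    have "(\<lambda>i. (w * real i + 1) * (inner (\<phi> i) x * inner (\<phi> i) (\<phi> j)))
       = (\<lambda>i. if i = j then (w * real j + 1) * inner (\<phi> j) x else 0)"
      by (auto simp: orthonormal)
    then show ?thesis
      unfolding S_def using sums_single[of j "\<lambda>_. (w * real j + 1) * inner (\<phi> j) x"]
      by (simp add: sums_iff)
  qed
  \<comment> \<open>The variational equation says that \<open>1 / \<kappa>\<close> is the eigenvalue
    of the shifted form; removing the shift \<open>1 - c + v\<close> gives \<open>l\<close>.\<close>
  define l where "l = 1 / \<kappa> - v - 1 + c"
  have "x \<in> eigenspace l"
  proof -
    have "lam j * inner (\<phi> j) x + inner (\<phi> j) (V x) = l * inner (\<phi> j) x" for j
    proof -
      have "inner (\<phi> j) x / \<kappa> = Q x (\<phi> j)" using Qphi[of j] \<kappa> by (simp add: field_simps inner_commute)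
      then show ?thesis using V_sym[of x "\<phi> j"]
        by (simp add: Q_def S_phi l_def lam_def inner_commute algebra_simps)
    qed
    then show ?thesis by (simp add: eigenspace_def)
  qed
  moreover have "l \<le> \<mu>"
  proof -
    have "(\<lambda>j. lam j * (inner (\<phi> j) x0)\<^sup>2 + (1 - c) * (inner (\<phi> j) x0)\<^sup>2) sums (A + (1 - c) * inner x0 x0)"
      by (intro sums_add sums_mult parseval le)
    then have "(\<lambda>j. (w * real j + 1) * (inner (\<phi> j) x0 * inner (\<phi> j) x0)) sums (A + (1 - c) * inner x0 x0)"
      by (simp add: lam_def power2_eq_square algebra_simps)
    then have "S x0 x0 = A + (1 - c) * inner x0 x0" unfolding S_def by (rule sums_unique[symmetric])
    then have "Q x0 x0 \<le> (\<mu> + 1 - c + v) * inner x0 x0"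
      using le(2) by (simp add: Q_def algebra_simps)
    then have "inner x0 x0 \<le> \<kappa> * ((\<mu> + 1 - c + v) * inner x0 x0)"
      using x0Q \<kappa> by (meson less_imp_le mult_left_mono order_trans)
    then have "inner x0 x0 * 1 \<le> inner x0 x0 * (\<kappa> * (\<mu> + 1 - c + v))"
      by (simp add: mult_ac)
    then have "1 \<le> \<kappa> * (\<mu> + 1 - c + v)" using x0p by (simp only: mult_le_cancel_left_pos)
    then show ?thesis using \<kappa> by (simp add: l_def field_simps)
  qed
  moreover have "x \<noteq> 0" using \<kappa> by (auto simp: \<kappa>_def)
  ultimately show ?thesis using xW by blast
qed

text \<open>Orthogonality of different eigenspaces makes their bases disjoint and jointly
  independent. Multiplicities thus become the cardinality of a single independent set.\<close>

lemma eigenbases_Union: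
  assumes L: "finite L"
    and Bs: "\<And>l. l \<in> L \<Longrightarrow> finite (Bs l)" "\<And>l. l \<in> L \<Longrightarrow> independent (Bs l)"
      "\<And>l. l \<in> L \<Longrightarrow> span (Bs l) = eigenspace l"
  shows "independent (\<Union>l\<in>L. Bs l)" "card (\<Union>l\<in>L. Bs l) = (\<Sum>l\<in>L. card (Bs l))"
proof -
  have sub: "Bs l \<subseteq> eigenspace l" if "l \<in> L" for l
    using Bs(3)[OF that] span_superset by blast
  have disj: "Bs l \<inter> Bs l' = {}" if "l \<in> L" "l' \<in> L" "l \<noteq> l'" for l l'
  proof (rule ccontr)
    assume "Bs l \<inter> Bs l' \<noteq> {}"
    then obtain b where b: "b \<in> Bs l" "b \<in> Bs l'" by blast
    then have "inner b b = 0" using sub that by (intro eigenspaces_orthogonal) auto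
    then show False using b Bs(2)[OF that(1)] dependent_zero by auto
  qed
  show "card (\<Union>l\<in>L. Bs l) = (\<Sum>l\<in>L. card (Bs l))"
    using L Bs(1) disj by (intro card_UN_disjoint) auto
  have fin: "finite (\<Union>l\<in>L. Bs l)" using L Bs(1) by auto
  show "independent (\<Union>l\<in>L. Bs l)"
  proof (rule independent_if_scalars_zero[OF fin])
    fix u b assume u: "(\<Sum>b\<in>(\<Union>l\<in>L. Bs l). u b *\<^sub>R b) = 0" and "b \<in> (\<Union>l\<in>L. Bs l)"
    then obtain l where l: "l \<in> L" "b \<in> Bs l" by blast
    define y where "y l = (\<Sum>b\<in>Bs l. u b *\<^sub>R b)" for l
    have yE: "y l \<in> eigenspace l" if "l \<in> L" for l
      unfolding y_def using sub[OF that]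
      by (intro subspace_sum subspace_scale subspace_eigenspace) auto
    have "(\<Sum>l\<in>L. y l) = 0"
      using u sum.UNION_disjoint[OF L, of Bs "\<lambda>b. u b *\<^sub>R b"] Bs(1) disj by (simp add: y_def)
    then have "0 = inner (y l) (\<Sum>l\<in>L. y l)" by simp
    also have "\<dots> = (\<Sum>l'\<in>L. if l' = l then inner (y l) (y l) else 0)"
      unfolding inner_sum_right using eigenspaces_orthogonal[OF yE yE] l(1)
      by (intro sum.cong refl) auto
    also have "\<dots> = inner (y l) (y l)" using L l by simp
    finally have "(\<Sum>b\<in>Bs l. u b *\<^sub>R b) = 0" by (simp add: y_def)
    then show "u b = 0"
      using independentD[OF Bs(2)[OF l(1)] Bs(1)[OF l(1)] subset_refl] l(2) by blast
  qed
qed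

text \<open>If \<open>E n\<close> were too small, \<open>E 0, ..., E n\<close> would supply
  \<open>n + 1\<close> independent eigenvectors against \<open>card_eigenvectors_le\<close>. If it
  were too large, the eigenvectors up to \<open>\<mu>\<close> would have a basis \<open>W\<close> of
  at most \<open>n\<close> vectors, some \<open>x\<close> in the span of
  \<open>\<phi> 0, ..., \<phi> n\<close> would be orthogonal to \<open>W\<close> with energy at most
  \<open>\<mu>\<close>, and \<open>eigenvector_below\<close> would give an eigenvector missing from
  the list.\<close>

theorem eigenvalue_estimate:
  assumes bound: "\<And>x M. (\<lambda>j. w * \<bar>real j - real n\<bar> * (inner (\<phi> j) x)\<^sup>2) sums M \<Longrightarrow>
      \<bar>inner x (V x) - V0 * inner x x\<bar> \<le> s * inner x x + M"
    and E: "mono E"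
    and Bs: "\<And>l. finite (Bs l)" "\<And>l. independent (Bs l)" "\<And>l. span (Bs l) = eigenspace l"
      "\<And>l. card (Bs l) = card {k::nat. E k = l}" and fin: "\<And>l. finite {k. E k = l}"
  shows "\<bar>E n - (lam n + V0)\<bar> \<le> s"
proof -
  have cardW: "card (\<Union>l\<in>L. Bs l) = card {k. E k \<in> L}" if L: "finite L" for L
  proof -
    have "card (\<Union>l\<in>L. Bs l) = (\<Sum>l\<in>L. card {k. E k = l})"
      using eigenbases_Union(2)[OF L Bs(1-3)] Bs(4) by simp
    also have "\<dots> = card (\<Union>l\<in>L. {k. E k = l})"
      using L fin by (intro card_UN_disjoint[symmetric]) auto
    also have "(\<Union>l\<in>L. {k. E k = l}) = {k. E k \<in> L}" by auto
    finally show ?thesis .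
  qed
  have "lam n + V0 - s \<le> E n"
  proof (rule ccontr)
    assume lt: "\<not> lam n + V0 - s \<le> E n"
    define L where "L = E ` {..n}"
    have L: "finite L" by (simp add: L_def)
    have "card (\<Union>l\<in>L. Bs l) \<le> n"
    proof (rule card_eigenvectors_le[OF bound])
      show "finite (\<Union>l\<in>L. Bs l)" using L Bs(1) by auto
      show "independent (\<Union>l\<in>L. Bs l)" by (rule eigenbases_Union[OF L Bs(1-3)])
      fix b assume "b \<in> (\<Union>l\<in>L. Bs l)"
      then obtain k where k: "k \<le> n" "b \<in> Bs (E k)" by (auto simp: L_def)
      then have "b \<in> eigenspace (E k)" using Bs(3) span_superset by blast
      moreover have "E k < lam n + V0 - s" using monoD[OF E k(1)] lt by simp
      ultimately show "\<exists>l<lam n + V0 - s. b \<in> eigenspace l" by blast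
    qed
    moreover have "card {..n} \<le> card {k. E k \<in> L}"
    proof (rule card_mono)
      have "{k. E k \<in> L} = (\<Union>l\<in>L. {k. E k = l})" by auto
      then show "finite {k. E k \<in> L}" using L fin by auto
    qed (auto simp: L_def)
    ultimately show False using cardW[OF L] by simp
  qed
  moreover have "E n \<le> lam n + V0 + s"
  proof (rule ccontr)
    define \<mu> where "\<mu> = lam n + V0 + s"
    assume "\<not> E n \<le> lam n + V0 + s"
    then have gt: "\<mu> < E n" by (simp add: \<mu>_def)
    have sub: "{k. E k \<le> \<mu>} \<subseteq> {..<n}"
    proof
      fix k assume "k \<in> {k. E k \<le> \<mu>}"
      then show "k \<in> {..<n}" using gt monoD[OF E, of n k] by (cases "n \<le> k") auto
    qed
    define L where "L = E ` {k. E k \<le> \<mu>}"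
    have L: "finite L" using sub by (auto simp: L_def intro: finite_subset)
    define W where "W = (\<Union>l\<in>L. Bs l)"
    have Wfin: "finite W" using L Bs(1) by (auto simp: W_def)
    have "{k. E k \<in> L} = {k. E k \<le> \<mu>}" by (auto simp: L_def)
    then have "card W \<le> n"
      using cardW[OF L] card_mono[OF _ sub] by (simp add: W_def)
    define f where "f x = (\<Sum>u\<in>W. inner u x *\<^sub>R u)" for x
    have f_lin: "linear f"
      by (rule linearI) (simp_all add: f_def inner_add_right scaleR_add_left sum.distrib scaleR_sum_right)
    have inj_phi: "inj_on \<phi> {..n}"
      by (rule inj_onI) (metis orthonormal zero_neq_one)
    have "\<not> inj_on f (span (\<phi> ` {..n}))"
    proof
      assume inj: "inj_on f (span (\<phi> ` {..n}))"
      have "independent (\<phi> ` {..n})"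
      proof (rule pairwise_orthogonal_independent)
        show "pairwise orthogonal (\<phi> ` {..n})"
          by (auto simp: pairwise_def orthogonal_def orthonormal)
        show "0 \<notin> \<phi> ` {..n}" using orthonormal by (metis imageE inner_zero_left zero_neq_one)
      qed
      then have "independent (f ` \<phi> ` {..n})"
        using linear_independent_injective_image[OF f_lin _ inj] by blast
      moreover have "f ` \<phi> ` {..n} \<subseteq> span W"
        unfolding f_def by (auto intro!: span_sum span_scale intro: span_base)
      ultimately have "card (f ` \<phi> ` {..n}) \<le> card W"
        using independent_span_bound[OF Wfin] by blast
      moreover have "card (f ` \<phi> ` {..n}) = Suc n"
      proof -
        have "inj_on f (\<phi> ` {..n})" using inj by (meson inj_on_subset span_superset)
        then show ?thesis by (simp add: card_image inj_phi)
      qed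
      ultimately show False using \<open>card W \<le> n\<close> by simp
    qed
    then obtain p q where pq: "p \<in> span (\<phi> ` {..n})" "q \<in> span (\<phi> ` {..n})" "p \<noteq> q" "f p = f q"
      by (auto simp: inj_on_def)
    define x where "x = p - q"
    have x: "x \<in> span (\<phi> ` {..n})" "x \<noteq> 0" "f x = 0"
      using pq f_lin by (auto simp: x_def span_diff linear_diff)
    have "0 = inner x (f x)" using x(3) by simp
    also have "\<dots> = (\<Sum>u\<in>W. (inner u x)\<^sup>2)"
      by (simp add: f_def inner_sum_right power2_eq_square inner_commute)
    finally have xW: "inner u x = 0" if "u \<in> W" for u
      using that Wfin by (simp add: sum_nonneg_eq_0_iff)
    have high: "inner (\<phi> j) x = 0" if "n < j" for j
    proof -
      have "inner (\<phi> j) y = 0" if "y \<in> span (\<phi> ` {..n})" for y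
      proof (rule span_induct[OF that])
        show "subspace {y. inner (\<phi> j) y = 0}" by (auto simp: subspace_def inner_add_right)
      qed (use \<open>n < j\<close> in \<open>auto simp: orthonormal\<close>)
      with x(1) show ?thesis by blast
    qed
    define A where "A = (\<Sum>j\<le>n. lam j * (inner (\<phi> j) x)\<^sup>2)"
    have A: "(\<lambda>j. lam j * (inner (\<phi> j) x)\<^sup>2) sums A"
      unfolding A_def by (rule sums_finite) (auto simp: high)
    have "(\<lambda>j. lam n * (inner (\<phi> j) x)\<^sup>2 - lam j * (inner (\<phi> j) x)\<^sup>2) sums (lam n * inner x x - A)"
      by (intro sums_diff sums_mult parseval A)
    moreover have "lam n * (inner (\<phi> j) x)\<^sup>2 - lam j * (inner (\<phi> j) x)\<^sup>2
      = w * \<bar>real j - real n\<bar> * (inner (\<phi> j) x)\<^sup>2" for j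
      using high[of j] by (cases "n < j") (auto simp: lam_def algebra_simps)
    ultimately have "(\<lambda>j. w * \<bar>real j - real n\<bar> * (inner (\<phi> j) x)\<^sup>2) sums (lam n * inner x x - A)" by simp
    from bound[OF this] have le: "A + inner x (V x) \<le> \<mu> * inner x x"
      by (auto simp: \<mu>_def algebra_simps abs_le_iff)
    have xD: "x \<in> form_domain"
      using x(1) subspace_form_domain basis_in_form_domain span_minimal[of "\<phi> ` {..n}" form_domain] by blast
    have "\<exists>l. u \<in> eigenspace l" if "u \<in> W" for u
      using that Bs(3) span_base unfolding W_def by (metis UN_E)
    then obtain y l where y: "y \<noteq> 0" "l \<le> \<mu>" "y \<in> eigenspace l" "\<forall>u\<in>W. inner u y = 0"
      using eigenvector_below[OF Wfin _ x(2) xD xW A le] by blast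
    \<comment> \<open>A value \<open>l\<close> that does not occur in the list has multiplicity 0,
      hence an empty basis. So \<open>W\<close> carries every eigenspace with eigenvalue at most
      \<open>\<mu>\<close>.\<close>
    have "Bs l \<subseteq> W"
    proof (cases "l \<in> L")
      case False
      then have "{k. E k = l} = {}" using y(2) by (auto simp: L_def)
      then have "Bs l = {}" using Bs(1)[of l] Bs(4)[of l] by simp
      then show ?thesis by simp
    qed (auto simp: W_def)
    have "inner y z = 0" if "z \<in> span (Bs l)" for z
    proof (rule span_induct[OF that])
      show "subspace {z. inner y z = 0}" by (auto simp: subspace_def inner_add_right)
    qed (use y(4) \<open>Bs l \<subseteq> W\<close> in \<open>auto simp: inner_commute\<close>)
    then have "inner y y = 0" using y(3) Bs(3) by blast
    with y(1) show False by simp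
  qed
  ultimately show ?thesis by linarith
qed

end

section \<open>The space of square-summable sequences\<close>

lemma summable_mult_l2:
  fixes x y :: "nat \<Rightarrow> real"
  assumes "summable (\<lambda>n. (x n)\<^sup>2)" "summable (\<lambda>n. (y n)\<^sup>2)"
  shows "summable (\<lambda>n. x n * y n)"
proof (rule summable_comparison_test'[where N = 0])
  show "summable (\<lambda>n. (x n)\<^sup>2 + (y n)\<^sup>2)" by (intro summable_add assms)
  fix n
  have "2 * \<bar>x n * y n\<bar> \<le> (x n)\<^sup>2 + (y n)\<^sup>2"
    using sum_squares_bound[of "\<bar>x n\<bar>" "\<bar>y n\<bar>"] by (simp add: abs_mult)
  moreover have "0 \<le> \<bar>x n * y n\<bar>" by simp
  ultimately show "norm (x n * y n) \<le> (x n)\<^sup>2 + (y n)\<^sup>2" unfolding real_norm_def by linarith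
qed

lemma summable_add_l2:
  fixes x y :: "nat \<Rightarrow> real"
  assumes "summable (\<lambda>n. (x n)\<^sup>2)" "summable (\<lambda>n. (y n)\<^sup>2)"
  shows "summable (\<lambda>n. (x n + y n)\<^sup>2)"
proof -
  have "summable (\<lambda>n. (x n)\<^sup>2 + (y n)\<^sup>2 + 2 * (x n * y n))"
    by (intro summable_add summable_mult summable_mult_l2 assms)
  then show ?thesis by (simp add: power2_sum mult.assoc)
qed

text \<open>Real scalars: the Hamiltonian has a real matrix on each invariant subspace, so complex
  eigenvectors split into real and imaginary parts, and the variational argument can use a real
  inner product.\<close>

typedef l2 = "{x :: nat \<Rightarrow> real. summable (\<lambda>n. (x n)\<^sup>2)}"
  morphisms coord Abs_l2
  by (rule exI[of _ "\<lambda>_. 0"]) simp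

setup_lifting type_definition_l2

lemma summable_coord: "summable (\<lambda>n. (coord x n)\<^sup>2)"
  using coord[of x] by simp

lemma summable_coord_mult: "summable (\<lambda>n. coord x n * coord y n)"
  by (intro summable_mult_l2 summable_coord)

lemma l2_eqI: "(\<And>n. coord x n = coord y n) \<Longrightarrow> x = y"
  by (metis coord_inject ext)

instantiation l2 :: real_vector
begin

lift_definition zero_l2 :: l2 is "\<lambda>_. 0" by simp
lift_definition plus_l2 :: "l2 \<Rightarrow> l2 \<Rightarrow> l2" is "\<lambda>x y n. x n + y n"
  by (rule summable_add_l2)
lift_definition uminus_l2 :: "l2 \<Rightarrow> l2" is "\<lambda>x n. - x n" by simp
lift_definition minus_l2 :: "l2 \<Rightarrow> l2 \<Rightarrow> l2" is "\<lambda>x y n. x n - y n"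
  subgoal for x y using summable_add_l2[of x "\<lambda>n. - y n"] by simp
  done
lift_definition scaleR_l2 :: "real \<Rightarrow> l2 \<Rightarrow> l2" is "\<lambda>r x n. r * x n"
  by (simp add: power_mult_distrib summable_mult)

instance
  by (standard; transfer; simp add: algebra_simps)

end

instantiation l2 :: real_inner
begin

definition inner_l2 :: "l2 \<Rightarrow> l2 \<Rightarrow> real" where
  "inner_l2 x y = (\<Sum>n. coord x n * coord y n)"
definition norm_l2 :: "l2 \<Rightarrow> real" where "norm_l2 x = sqrt (inner x x)"
definition dist_l2 :: "l2 \<Rightarrow> l2 \<Rightarrow> real" where "dist_l2 x y = norm (x - y)"
definition sgn_l2 :: "l2 \<Rightarrow> l2" where "sgn_l2 x = x /\<^sub>R norm x"
definition uniformity_l2 :: "(l2 \<times> l2) filter" where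
  "uniformity_l2 = (INF e\<in>{0<..}. principal {(x, y). dist x y < e})"
definition open_l2 :: "l2 set \<Rightarrow> bool" where
  "open_l2 U \<longleftrightarrow> (\<forall>x\<in>U. eventually (\<lambda>(x', y). x' = x \<longrightarrow> y \<in> U) uniformity)"

instance
proof
  fix x y z :: l2 and r :: real
  show "inner x y = inner y x" by (simp add: inner_l2_def mult.commute)
  show "inner (x + y) z = inner x z + inner y z"
    using suminf_add[OF summable_coord_mult[of x z] summable_coord_mult[of y z]]
    by (simp add: inner_l2_def plus_l2.rep_eq distrib_right)
  show "inner (r *\<^sub>R x) y = r * inner x y"
    using suminf_mult[OF summable_coord_mult[of x y], of r]
    by (simp add: inner_l2_def scaleR_l2.rep_eq mult.assoc)
  show "0 \<le> inner x x"
    unfolding inner_l2_def by (intro suminf_nonneg summable_coord_mult) auto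
  show "inner x x = 0 \<longleftrightarrow> x = 0"
    unfolding inner_l2_def
    by (subst suminf_eq_zero_iff[OF summable_coord_mult]) (auto intro: l2_eqI simp: zero_l2.rep_eq)
qed (rule norm_l2_def dist_l2_def sgn_l2_def uniformity_l2_def open_l2_def)+

end

lemma inner_l2_sums: "(\<lambda>n. coord x n * coord y n) sums inner x y"
  unfolding inner_l2_def by (intro summable_sums summable_coord_mult)

lemma coord_simps [simp]:
  "coord 0 n = 0" "coord (x + y) n = coord x n + coord y n" "coord (x - y) n = coord x n - coord y n"
  "coord (- x) n = - coord x n" "coord (r *\<^sub>R x) n = r * coord x n"
  by (simp_all add: zero_l2.rep_eq plus_l2.rep_eq minus_l2.rep_eq uminus_l2.rep_eq scaleR_l2.rep_eq)

lemma coord_sum: "coord (\<Sum>i\<in>A. f i) n = (\<Sum>i\<in>A. coord (f i) n)"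
  by (induct A rule: infinite_finite_induct) auto

lemma sum_coord_le: "(\<Sum>n<N. (coord x n)\<^sup>2) \<le> (norm x)\<^sup>2"
  using sum_le_suminf[OF summable_coord_mult[of x x], of "{..<N}"]
  unfolding power2_norm_eq_inner inner_l2_def by (simp add: power2_eq_square)

lemma abs_coord_le: "\<bar>coord x n\<bar> \<le> norm x"
proof -
  have "(coord x n)\<^sup>2 \<le> (\<Sum>k<Suc n. (coord x k)\<^sup>2)" by (intro member_le_sum) auto
  also have "\<dots> \<le> (norm x)\<^sup>2" by (rule sum_coord_le)
  finally show ?thesis by (simp add: abs_le_square_iff[symmetric])
qed

lemma coord_Abs_l2_bounded:
  assumes "\<And>N. (\<Sum>n<N. (x n)\<^sup>2) \<le> B"
  shows "coord (Abs_l2 x) = x" "(norm (Abs_l2 x))\<^sup>2 \<le> B"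
proof -
  have s: "summable (\<lambda>n. (x n)\<^sup>2)" using assms by (intro summableI_nonneg_bounded) auto
  then show *: "coord (Abs_l2 x) = x" by (intro Abs_l2_inverse) simp
  have "inner (Abs_l2 x) (Abs_l2 x) \<le> B"
    unfolding inner_l2_def * using s assms by (intro suminf_le_const) (auto simp: power2_eq_square)
  then show "(norm (Abs_l2 x))\<^sup>2 \<le> B" by (simp add: power2_norm_eq_inner)
qed

instance l2 :: complete_space
proof
  fix X :: "nat \<Rightarrow> l2" assume X: "Cauchy X"
  have "Cauchy (\<lambda>k. coord (X k) n)" for n
  proof (rule metric_CauchyI)
    fix e :: real assume "e > 0"
    then obtain M where M: "\<And>i j. i \<ge> M \<Longrightarrow> j \<ge> M \<Longrightarrow> dist (X i) (X j) < e"
      using X by (meson metric_CauchyD)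
    have "dist (coord (X i) n) (coord (X j) n) < e" if "i \<ge> M" "j \<ge> M" for i j
      using M[OF that] abs_coord_le[of "X i - X j" n] by (simp add: dist_norm)
    then show "\<exists>M. \<forall>m\<ge>M. \<forall>k\<ge>M. dist (coord (X m) n) (coord (X k) n) < e" by blast
  qed
  then have "\<forall>n. \<exists>l. (\<lambda>k. coord (X k) n) \<longlonglongrightarrow> l"
    by (simp add: Cauchy_convergent_iff convergent_def)
  then obtain y where y: "\<And>n. (\<lambda>k. coord (X k) n) \<longlonglongrightarrow> y n" by metis
  have part: "(\<Sum>n<N. (y n - coord (X k) n)\<^sup>2) \<le> e\<^sup>2"
    if M: "\<And>i j. i \<ge> M \<Longrightarrow> j \<ge> M \<Longrightarrow> dist (X i) (X j) < e" and "k \<ge> M" for e M k N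
  proof (rule LIMSEQ_le_const2)
    show "(\<lambda>i. \<Sum>n<N. (coord (X i) n - coord (X k) n)\<^sup>2) \<longlonglongrightarrow> (\<Sum>n<N. (y n - coord (X k) n)\<^sup>2)"
      by (intro tendsto_intros y)
    have "(\<Sum>n<N. (coord (X i) n - coord (X k) n)\<^sup>2) \<le> e\<^sup>2" if "i \<ge> M" for i
    proof -
      have "(\<Sum>n<N. (coord (X i - X k) n)\<^sup>2) \<le> (norm (X i - X k))\<^sup>2" by (rule sum_coord_le)
      also have "\<dots> \<le> e\<^sup>2"
        using M[OF that \<open>k \<ge> M\<close>] by (intro power_mono) (auto simp: dist_norm)
      finally show ?thesis by simp
    qed
    then show "\<exists>N'. \<forall>i\<ge>N'. (\<Sum>n<N. (coord (X i) n - coord (X k) n)\<^sup>2) \<le> e\<^sup>2" by blast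
  qed
  obtain M1 where M1: "\<And>i j. i \<ge> M1 \<Longrightarrow> j \<ge> M1 \<Longrightarrow> dist (X i) (X j) < 1"
    using X by (meson metric_CauchyD zero_less_one)
  \<comment> \<open>Square summability of the pointwise limit is visible only after subtracting a
    late member of the sequence, which is added back in \<open>l2\<close>.\<close>
  define z where "z = Abs_l2 (\<lambda>n. y n - coord (X M1) n) + X M1"
  have z: "coord z n = y n" for n
    using coord_Abs_l2_bounded(1)[OF part[OF M1 order_refl]] by (simp add: z_def)
  have "X \<longlonglongrightarrow> z"
  proof (rule metric_LIMSEQ_I)
    fix r :: real assume r: "r > 0"
    then obtain M where M: "\<And>i j. i \<ge> M \<Longrightarrow> j \<ge> M \<Longrightarrow> dist (X i) (X j) < r / 2"
      using X by (meson metric_CauchyD half_gt_zero)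
    have "dist (X k) z < r" if "k \<ge> M" for k
    proof -
      have "Abs_l2 (\<lambda>n. y n - coord (X k) n) = z - X k"
        by (rule l2_eqI) (simp add: coord_Abs_l2_bounded(1)[OF part[OF M that]] z)
      then have "(norm (z - X k))\<^sup>2 \<le> (r / 2)\<^sup>2"
        using coord_Abs_l2_bounded(2)[OF part[OF M that]] by simp
      then have "norm (z - X k) \<le> r / 2" by (rule power2_le_imp_le) (use r in simp)
      then show ?thesis using r by (simp add: dist_norm norm_minus_commute)
    qed
    then show "\<exists>no. \<forall>n\<ge>no. dist (X n) z < r" by blast
  qed
  then show "convergent X" by (auto simp: convergent_def)
qed

text \<open>A class that contains all squeezed states and is stable under \<open>ann\<close> and
  \<open>cre\<close>. Pairings of its members with bounded sequences converge absolutely, so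
  adjoints can be moved freely.\<close>

definition geometric_decay :: "(nat \<Rightarrow> real) \<Rightarrow> bool" where
  "geometric_decay x \<longleftrightarrow> (\<exists>C r. 0 < r \<and> r < 1 \<and> (\<forall>m. \<bar>x m\<bar> \<le> C * r ^ m))"

lemma geometric_decayI: "0 < r \<Longrightarrow> r < 1 \<Longrightarrow> (\<And>m. \<bar>x m\<bar> \<le> C * r ^ m) \<Longrightarrow> geometric_decay x"
  unfolding geometric_decay_def by blast

lemma geometric_decay_add:
  assumes "geometric_decay x" "geometric_decay y"
  shows "geometric_decay (\<lambda>m. x m + y m)"
proof -
  obtain C r where x: "0 < r" "r < 1" "\<And>m. \<bar>x m\<bar> \<le> C * r ^ m"
    using assms(1) by (auto simp: geometric_decay_def)
  obtain D q where y: "0 < q" "q < 1" "\<And>m. \<bar>y m\<bar> \<le> D * q ^ m"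
    using assms(2) by (auto simp: geometric_decay_def)
  have "0 \<le> C" using x(3)[of 0] by simp
  have "0 \<le> D" using y(3)[of 0] by simp
  show ?thesis
  proof (rule geometric_decayI[of "max r q" _ "C + D"])
    fix m
    have "\<bar>x m\<bar> \<le> C * max r q ^ m"
      by (rule order_trans[OF x(3)]) (use x(1) \<open>0 \<le> C\<close> in \<open>intro mult_left_mono power_mono; simp\<close>)
    moreover have "\<bar>y m\<bar> \<le> D * max r q ^ m"
      by (rule order_trans[OF y(3)]) (use y(1) \<open>0 \<le> D\<close> in \<open>intro mult_left_mono power_mono; simp\<close>)
    ultimately show "\<bar>x m + y m\<bar> \<le> (C + D) * max r q ^ m" by (simp add: distrib_right)
  qed (use x y in auto)
qed

lemma geometric_decay_cmult:
  assumes "geometric_decay x"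
  shows "geometric_decay (\<lambda>m. k * x m)"
proof -
  obtain C r where x: "0 < r" "r < 1" "\<And>m. \<bar>x m\<bar> \<le> C * r ^ m"
    using assms(1) by (auto simp: geometric_decay_def)
  show ?thesis
    by (rule geometric_decayI[OF x(1,2), of _ "\<bar>k\<bar> * C"])
       (use mult_left_mono[OF x(3), of "\<bar>k\<bar>"] in \<open>simp add: abs_mult mult.assoc\<close>)
qed

lemma linear_times_geometric_bounded:
  assumes "0 < r" "r < 1"
  shows "\<exists>D. \<forall>m. (real m + 1) * r ^ m \<le> D"
proof -
  have "(\<lambda>m. real m * r ^ m) \<longlonglongrightarrow> 0"
    using powser_times_n_limit_0[of r] assms by simp
  then have "Bseq (\<lambda>m. real m * r ^ m)" by (intro convergent_imp_Bseq) (auto simp: convergent_def)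
  then obtain K where K: "\<And>m. norm (real m * r ^ m) \<le> K" by (auto simp: Bseq_def)
  have "(real m + 1) * r ^ m \<le> K + 1" for m
    using K[of m] power_le_one[of r m] assms by (simp add: distrib_right)
  then show ?thesis by blast
qed

lemma geometric_decay_linear_weight:
  assumes "geometric_decay x"
  shows "geometric_decay (\<lambda>m. (real m + 1) * x m)"
proof -
  obtain C r where x: "0 < r" "r < 1" "\<And>m. \<bar>x m\<bar> \<le> C * r ^ m"
    using assms by (auto simp: geometric_decay_def)
  \<comment> \<open>The rate drops from \<open>r\<close> to \<open>sqrt r\<close>: one factor
    \<open>sqrt r ^ m\<close> absorbs the linear weight, the other remains as decay.\<close>
  obtain D where D: "\<And>m. (real m + 1) * (sqrt r) ^ m \<le> D"
    using linear_times_geometric_bounded[of "sqrt r"] x by auto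
  have C: "0 \<le> C" using x(3)[of 0] by simp
  show ?thesis
  proof (rule geometric_decayI[of "sqrt r" _ "C * D"])
    fix m
    have "\<bar>(real m + 1) * x m\<bar> = (real m + 1) * \<bar>x m\<bar>" by (simp add: abs_mult)
    also have "\<dots> \<le> (real m + 1) * (C * r ^ m)" by (intro mult_left_mono x) auto
    also have "r ^ m = sqrt r ^ m * sqrt r ^ m" using x(1) by (simp flip: power_mult_distrib)
    also have "(real m + 1) * (C * (sqrt r ^ m * sqrt r ^ m)) = C * ((real m + 1) * sqrt r ^ m) * sqrt r ^ m"
      by simp
    also have "\<dots> \<le> C * D * sqrt r ^ m"
      using C D x by (intro mult_right_mono mult_left_mono) auto
    finally show "\<bar>(real m + 1) * x m\<bar> \<le> C * D * sqrt r ^ m" .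
  qed (use x in auto)
qed

lemma geometric_decay_mono:
  assumes "geometric_decay x" "\<And>m. \<bar>y m\<bar> \<le> \<bar>x m\<bar>"
  shows "geometric_decay y"
  using assms unfolding geometric_decay_def by (meson order_trans)

lemma geometric_decay_Suc: "geometric_decay x \<Longrightarrow> geometric_decay (\<lambda>m. x (Suc m))"
proof -
  assume "geometric_decay x"
  then obtain C r where x: "0 < r" "r < 1" "\<And>m. \<bar>x m\<bar> \<le> C * r ^ m"
    by (auto simp: geometric_decay_def)
  show ?thesis
    by (rule geometric_decayI[OF x(1,2), of _ "C * r"]) (use x(3)[of "Suc _"] in \<open>simp add: mult.assoc\<close>)
qed

lemma geometric_decay_pred: "geometric_decay x \<Longrightarrow> geometric_decay (\<lambda>m. if m = 0 then 0 else x (m - 1))"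
proof -
  assume "geometric_decay x"
  then obtain C r where x: "0 < r" "r < 1" "\<And>m. \<bar>x m\<bar> \<le> C * r ^ m"
    by (auto simp: geometric_decay_def)
  have C: "0 \<le> C" using x(3)[of 0] by simp
  show ?thesis
  proof (rule geometric_decayI[OF x(1,2), of _ "C / r"])
    fix m show "\<bar>if m = 0 then 0 else x (m - 1)\<bar> \<le> C / r * r ^ m"
      using x(1) x(3)[of "m - 1"] C by (cases m) auto
  qed
qed

lemma geometric_decay_summable_mult:
  assumes "geometric_decay x" "\<And>m. norm (y m) \<le> B"
  shows "summable (\<lambda>m. x m *\<^sub>R (y m :: 'a::banach))"
proof -
  obtain C r where x: "0 < r" "r < 1" "\<And>m. \<bar>x m\<bar> \<le> C * r ^ m"
    using assms(1) by (auto simp: geometric_decay_def)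
  show ?thesis
  proof (rule summable_comparison_test'[where N = 0])
    show "summable (\<lambda>m. C * r ^ m * B)"
      using x by (intro summable_mult2 summable_mult summable_geometric) auto
    fix m show "norm (x m *\<^sub>R y m) \<le> C * r ^ m * B"
      using order_trans[OF abs_ge_zero x(3)] by (simp add: mult_mono[OF x(3) assms(2)])
  qed
qed

lemma geometric_decay_bounded: "geometric_decay x \<Longrightarrow> \<exists>B. \<forall>m. \<bar>x m\<bar> \<le> B"
proof -
  assume "geometric_decay x"
  then obtain C r where x: "0 < r" "r < 1" "\<And>m. \<bar>x m\<bar> \<le> C * r ^ m"
    by (auto simp: geometric_decay_def)
  have C: "0 \<le> C" using x(3)[of 0] by simp
  have "\<bar>x m\<bar> \<le> C" for m
    using order_trans[OF x(3)[of m] mult_left_mono[OF power_le_one[of r m] C]] x(1,2) by simp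
  then show ?thesis by blast
qed

lemma geometric_decay_l2: "geometric_decay x \<Longrightarrow> summable (\<lambda>m. (x m)\<^sup>2)"
  using geometric_decay_bounded[of x] geometric_decay_summable_mult[of x x]
  by (auto simp: power2_eq_square)

section \<open>Squeezed number states\<close>

text \<open>This is \<open>binomial(2k, k) / 4^k\<close>, the coefficient of \<open>x^k\<close> in
  \<open>(1 - x)^(-1/2)\<close>. It normalises the squeezed ground state and reappears in the
  generating function of the Legendre polynomials.\<close>

primrec central_binom :: "nat \<Rightarrow> real" where
  "central_binom 0 = 1"
| "central_binom (Suc k) = central_binom k * ((2 * real k + 1) / (2 * real k + 2))"

lemma central_binom_pos: "0 < central_binom k"
  by (induct k) (auto intro!: divide_pos_pos mult_pos_pos)

lemma central_binom_le_1: "central_binom k \<le> 1"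
proof (induct k)
  case (Suc k)
  have "central_binom k * ((2 * real k + 1) / (2 * real k + 2)) \<le> 1 * 1"
    using Suc central_binom_pos[of k] by (intro mult_mono) auto
  then show ?case by simp
qed simp

lemma central_binom_gbinomial:
  "of_real (central_binom k) = (- 1) ^ k * ((- 1 / 2 :: 'a::real_normed_field) gchoose k)"
proof (induct k)
  case (Suc k)
  define N :: 'a where "N = of_nat (Suc k)"
  have N: "N \<noteq> 0" unfolding N_def by (rule of_nat_neq_0)
  have k: "of_nat k = N - 1" by (simp add: N_def)
  have "N * ((- 1 / 2 :: 'a) gchoose Suc k) = ((- 1 / 2) gchoose k) * (- 1 / 2 - of_nat k)"
    using gbinomial_mult_1[of "- 1 / 2 :: 'a" k] unfolding N_def
    by (simp only: right_diff_distrib) (simp only: mult.commute eq_diff_eq diff_eq_eq add.commute)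
  then have *: "((- 1 / 2 :: 'a) gchoose Suc k) = ((- 1 / 2) gchoose k) * (- 1 / 2 - of_nat k) / N"
    using N by (metis nonzero_mult_div_cancel_left)
  have "(of_real (central_binom (Suc k)) :: 'a) = of_real (central_binom k) * ((2 * of_nat k + 1) / (2 * of_nat k + 2))"
    by simp
  also have "(2 * of_nat k + 1) / (2 * of_nat k + 2) = - ((- 1 / 2 - of_nat k) / N)"
    unfolding k using N by (simp add: field_simps)
  finally show ?case unfolding Suc * by simp
qed simp

lemma central_binom_series:
  fixes x :: real
  assumes "\<bar>x\<bar> < 1"
  shows "(\<lambda>k. central_binom k * x ^ k) sums (1 - x) powr (- 1 / 2)"
proof -
  have "(\<lambda>k. ((- 1 / 2) gchoose k) * (- x) ^ k) sums (1 + - x) powr (- 1 / 2)"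
    using assms by (intro gen_binomial_real) auto
  moreover have "((- 1 / 2) gchoose k) * (- x) ^ k = central_binom k * x ^ k" for k
    using central_binom_gbinomial[of k, where ?'a = real]
    by (simp add: power_minus[of x] mult_ac)
  ultimately show ?thesis by simp
qed

text \<open>\<open>bann\<close> and \<open>bcre\<close> are Bogoliubov transforms, with \<open>tanh r = \<beta>\<close>.\<close>

definition ann :: "(nat \<Rightarrow> real) \<Rightarrow> nat \<Rightarrow> real" where
  "ann x m = sqrt (real (Suc m)) * x (Suc m)"

definition cre :: "(nat \<Rightarrow> real) \<Rightarrow> nat \<Rightarrow> real" where
  "cre x m = (if m = 0 then 0 else sqrt (real m) * x (m - 1))"

definition ch :: "real \<Rightarrow> real" where "ch \<beta> = 1 / sqrt (1 - \<beta>\<^sup>2)"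
definition sh :: "real \<Rightarrow> real" where "sh \<beta> = \<beta> / sqrt (1 - \<beta>\<^sup>2)"

definition bann :: "real \<Rightarrow> (nat \<Rightarrow> real) \<Rightarrow> nat \<Rightarrow> real" where
  "bann \<beta> x m = ch \<beta> * ann x m + sh \<beta> * cre x m"

definition bcre :: "real \<Rightarrow> (nat \<Rightarrow> real) \<Rightarrow> nat \<Rightarrow> real" where
  "bcre \<beta> x m = ch \<beta> * cre x m + sh \<beta> * ann x m"

text \<open>The ground state is the normalised solution of \<open>bann \<beta> x = 0\<close>.\<close>

primrec squeezed :: "real \<Rightarrow> nat \<Rightarrow> nat \<Rightarrow> real" where
  "squeezed \<beta> 0 = (\<lambda>m. if even m then
     sqrt (sqrt (1 - \<beta>\<^sup>2)) * (- \<beta>) ^ (m div 2) * sqrt (central_binom (m div 2)) else 0)"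
| "squeezed \<beta> (Suc j) = (\<lambda>m. bcre \<beta> (squeezed \<beta> j) m / sqrt (real (Suc j)))"

lemma ann_Suc_cre: "ann (cre x) m = (real m + 1) * x m"
  by (simp add: ann_def cre_def mult.assoc[symmetric])

lemma cre_ann: "cre (ann x) m = real m * x m"
  by (cases m) (simp_all add: ann_def cre_def mult.assoc[symmetric])

lemma ann_lin: "ann (\<lambda>m. r * x m + s * y m) m = r * ann x m + s * ann y m"
  by (simp add: ann_def algebra_simps)

lemma cre_lin: "cre (\<lambda>m. r * x m + s * y m) m = r * cre x m + s * cre y m"
  by (simp add: cre_def algebra_simps)

lemma ann_cmult: "ann (\<lambda>m. r * x m) m = r * ann x m"
  by (simp add: ann_def)

lemma cre_cmult: "cre (\<lambda>m. r * x m) m = r * cre x m"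
  by (simp add: cre_def)

lemma geometric_decay_cre: "geometric_decay x \<Longrightarrow> geometric_decay (cre x)"
proof -
  assume "geometric_decay x"
  then have "geometric_decay (\<lambda>m. (real m + 1) * (if m = 0 then 0 else x (m - 1)))"
    by (intro geometric_decay_linear_weight geometric_decay_pred)
  then show ?thesis
  proof (rule geometric_decay_mono)
    fix m
    have "sqrt (real m) \<le> real m + 1"
      by (rule real_le_lsqrt) (auto simp: power2_eq_square algebra_simps)
    then show "\<bar>cre x m\<bar> \<le> \<bar>(real m + 1) * (if m = 0 then 0 else x (m - 1))\<bar>"
      by (auto simp: cre_def abs_mult intro!: mult_right_mono)
  qed
qed

lemma geometric_decay_ann: "geometric_decay x \<Longrightarrow> geometric_decay (ann x)"
proof -
  assume "geometric_decay x"
  then have "geometric_decay (\<lambda>m. (real m + 1) * x (Suc m))"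
    by (intro geometric_decay_linear_weight geometric_decay_Suc)
  then show ?thesis
  proof (rule geometric_decay_mono)
    fix m
    have "sqrt (real (Suc m)) \<le> real m + 1"
      by (rule real_le_lsqrt) (auto simp: power2_eq_square algebra_simps)
    then show "\<bar>ann x m\<bar> \<le> \<bar>(real m + 1) * x (Suc m)\<bar>"
      by (auto simp: ann_def abs_mult intro!: mult_right_mono)
  qed
qed

lemma geometric_decay_bcre: "geometric_decay x \<Longrightarrow> geometric_decay (bcre \<beta> x)"
  unfolding bcre_def[abs_def]
  by (intro geometric_decay_add geometric_decay_cmult geometric_decay_cre geometric_decay_ann)

lemma geometric_decay_divide: "geometric_decay x \<Longrightarrow> geometric_decay (\<lambda>m. x m / k)"
  using geometric_decay_cmult[of x "1 / k"] by simp

text \<open>An index shift turns one series into the other, so convergence of the left side carries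
  over. This lets \<open>y\<close> be the coordinates of an arbitrary \<open>l2\<close> vector,
  whose image under \<open>cre\<close> may leave \<open>l2\<close>.\<close>

lemma ann_cre_sums:
  assumes "(\<lambda>m. ann x m * y m) sums A"
  shows "(\<lambda>m. x m * cre y m) sums A"
proof -
  have "(\<lambda>m. x (Suc m) * cre y (Suc m)) sums A"
    using assms by (simp add: ann_def cre_def mult_ac add.commute)
  then have "(\<lambda>m. x m * cre y m) sums (A + x 0 * cre y 0)" by (rule sums_Suc)
  then show ?thesis by (simp add: cre_def)
qed

lemma cre_ann_sums:
  assumes "(\<lambda>m. cre x m * y m) sums A"
  shows "(\<lambda>m. x m * ann y m) sums A"
proof -
  have "(\<lambda>m. cre x (Suc m) * y (Suc m)) sums (A - cre x 0 * y 0)"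
    using sums_Suc_iff[of "\<lambda>m. cre x m * y m" "A - cre x 0 * y 0"] assms by simp
  then show ?thesis by (simp add: cre_def ann_def mult_ac add.commute)
qed

lemma ann_cre_adjoint:
  assumes x: "geometric_decay x" and y: "\<And>m. \<bar>y m\<bar> \<le> B"
  shows "(\<Sum>m. ann x m * y m) = (\<Sum>m. x m * cre y m)"
  using geometric_decay_summable_mult[OF geometric_decay_ann[OF x], of y B] y
  by (intro sums_unique ann_cre_sums summable_sums) simp

lemma cre_ann_adjoint:
  assumes x: "geometric_decay x" and y: "\<And>m. \<bar>y m\<bar> \<le> B"
  shows "(\<Sum>m. cre x m * y m) = (\<Sum>m. x m * ann y m)"
  using geometric_decay_summable_mult[OF geometric_decay_cre[OF x], of y B] y
  by (intro sums_unique cre_ann_sums summable_sums) simp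

section \<open>Commutation relation, ladder relations and orthonormality of squeezed states\<close>

context
  fixes \<beta> :: real
  assumes \<beta>: "\<bar>\<beta>\<bar> < 1"
begin

lemma one_minus_beta_sq_pos: "0 < 1 - \<beta>\<^sup>2"
  using \<beta> by (simp add: abs_square_less_1)

lemma sh_eq: "sh \<beta> = \<beta> * ch \<beta>"
  by (simp add: sh_def ch_def)

lemma ch_sq: "(ch \<beta>)\<^sup>2 = 1 / (1 - \<beta>\<^sup>2)"
  using one_minus_beta_sq_pos by (simp add: ch_def power_divide)

lemma ch_sq_minus_sh_sq: "(ch \<beta>)\<^sup>2 - (sh \<beta>)\<^sup>2 = 1"
proof -
  have "(ch \<beta>)\<^sup>2 - (sh \<beta>)\<^sup>2 = (ch \<beta>)\<^sup>2 * (1 - \<beta>\<^sup>2)"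
    by (simp add: sh_eq power_mult_distrib algebra_simps)
  then show ?thesis using one_minus_beta_sq_pos by (simp add: ch_sq)
qed

text \<open>The transform is canonical: the commutator reduces to
  \<open>(ch \<beta>)\<^sup>2 - (sh \<beta>)\<^sup>2 = 1\<close>.\<close>

lemma bann_bcre: "bann \<beta> (bcre \<beta> x) m = bcre \<beta> (bann \<beta> x) m + x m"
proof -
  have *: "ch \<beta> * ch \<beta> = 1 + sh \<beta> * sh \<beta>"
    using ch_sq_minus_sh_sq by (simp add: power2_eq_square)
  have "bann \<beta> (bcre \<beta> x) m - bcre \<beta> (bann \<beta> x) m = (ch \<beta> * ch \<beta> - sh \<beta> * sh \<beta>) * x m"
    unfolding bann_def[abs_def] bcre_def[abs_def] ann_lin cre_lin ann_Suc_cre cre_ann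
    by (simp add: algebra_simps)
  then show ?thesis by (simp add: *)
qed

lemma bann_squeezed_0: "bann \<beta> (squeezed \<beta> 0) m = 0"
proof (cases "odd m")
  case True
  then obtain k where m: "m = Suc (2 * k)" using oddE by fastforce
  have "sqrt (real (Suc m)) * sqrt (central_binom (Suc k)) = sqrt (real m) * sqrt (central_binom k)"
  proof -
    have "real (Suc m) * central_binom (Suc k) = real m * central_binom k"
      by (simp add: m field_simps)
    then show ?thesis by (simp only: real_sqrt_mult[symmetric])
  qed
  then have "ann (squeezed \<beta> 0) m = - \<beta> * cre (squeezed \<beta> 0) m"
    by (simp add: ann_def cre_def m del: central_binom.simps(2))
  then show ?thesis by (simp add: bann_def sh_eq)
qed (auto simp: bann_def ann_def cre_def)

lemma bcre_squeezed: "bcre \<beta> (squeezed \<beta> j) m = sqrt (real (Suc j)) * squeezed \<beta> (Suc j) m"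
  by simp

lemma bann_squeezed_Suc: "bann \<beta> (squeezed \<beta> (Suc j)) m = sqrt (real (Suc j)) * squeezed \<beta> j m"
proof (induct j arbitrary: m)
  case 0
  have "bann \<beta> (squeezed \<beta> (Suc 0)) m = bann \<beta> (bcre \<beta> (squeezed \<beta> 0)) m" by simp
  also have "\<dots> = bcre \<beta> (bann \<beta> (squeezed \<beta> 0)) m + squeezed \<beta> 0 m" by (rule bann_bcre)
  also have "bcre \<beta> (bann \<beta> (squeezed \<beta> 0)) m = 0"
    by (simp add: bcre_def cre_def ann_def bann_squeezed_0 del: squeezed.simps)
  finally show ?case by simp
next
  case (Suc j)
  have eq: "squeezed \<beta> (Suc (Suc j)) = (\<lambda>m. (1 / sqrt (real (Suc (Suc j)))) * bcre \<beta> (squeezed \<beta> (Suc j)) m)"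
    by (simp only: squeezed.simps(2)[of \<beta> "Suc j"]) simp
  have "bann \<beta> (squeezed \<beta> (Suc (Suc j))) m
      = (1 / sqrt (real (Suc (Suc j)))) * bann \<beta> (bcre \<beta> (squeezed \<beta> (Suc j))) m"
    unfolding eq by (simp only: bann_def ann_cmult cre_cmult) (simp add: algebra_simps)
  also have "bann \<beta> (bcre \<beta> (squeezed \<beta> (Suc j))) m
      = bcre \<beta> (bann \<beta> (squeezed \<beta> (Suc j))) m + squeezed \<beta> (Suc j) m" by (rule bann_bcre)
  also have "bann \<beta> (squeezed \<beta> (Suc j)) = (\<lambda>m. sqrt (real (Suc j)) * squeezed \<beta> j m)"
    using Suc by blast
  also have "bcre \<beta> (\<lambda>m. sqrt (real (Suc j)) * squeezed \<beta> j m) m = sqrt (real (Suc j)) * bcre \<beta> (squeezed \<beta> j) m"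
    by (simp only: bcre_def ann_cmult cre_cmult) (simp add: algebra_simps)
  also have "\<dots> = real (Suc j) * squeezed \<beta> (Suc j) m"
    by (simp only: bcre_squeezed mult.assoc[symmetric] real_sqrt_mult_self abs_of_nat)
  also have "(1 / sqrt (real (Suc (Suc j)))) * (real (Suc j) * squeezed \<beta> (Suc j) m + squeezed \<beta> (Suc j) m)
     = real (Suc (Suc j)) / sqrt (real (Suc (Suc j))) * squeezed \<beta> (Suc j) m"
    by (simp only: of_nat_Suc[of "Suc j"] distrib_right mult_1 times_divide_eq_left add.commute)
  also have "real (Suc (Suc j)) / sqrt (real (Suc (Suc j))) = sqrt (real (Suc (Suc j)))"
    by (rule real_div_sqrt) simp
  finally show ?case .
qed

text \<open>At \<open>j = 0\<close> the factor \<open>sqrt 0\<close> removes the meaningless term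
  with index \<open>0 - 1 = 0\<close>. Later formulas with \<open>j - 1\<close> and
  \<open>j - 2\<close> rely on the same convention.\<close>

lemma bann_squeezed: "bann \<beta> (squeezed \<beta> j) m = sqrt (real j) * squeezed \<beta> (j - 1) m"
  using bann_squeezed_0 bann_squeezed_Suc by (cases j) (auto simp: add.commute simp del: squeezed.simps)

lemma ann_squeezed:
  "ann (squeezed \<beta> j) m = ch \<beta> * (sqrt (real j) * squeezed \<beta> (j - 1) m)
     - sh \<beta> * (sqrt (real (Suc j)) * squeezed \<beta> (Suc j) m)"
proof -
  have "ch \<beta> * bann \<beta> (squeezed \<beta> j) m - sh \<beta> * bcre \<beta> (squeezed \<beta> j) m
      = ((ch \<beta>)\<^sup>2 - (sh \<beta>)\<^sup>2) * ann (squeezed \<beta> j) m"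
    by (simp add: bann_def bcre_def power2_eq_square algebra_simps)
  then show ?thesis unfolding bann_squeezed bcre_squeezed ch_sq_minus_sh_sq by simp
qed

lemma cre_squeezed:
  "cre (squeezed \<beta> j) m = ch \<beta> * (sqrt (real (Suc j)) * squeezed \<beta> (Suc j) m)
     - sh \<beta> * (sqrt (real j) * squeezed \<beta> (j - 1) m)"
proof -
  have "ch \<beta> * bcre \<beta> (squeezed \<beta> j) m - sh \<beta> * bann \<beta> (squeezed \<beta> j) m
      = ((ch \<beta>)\<^sup>2 - (sh \<beta>)\<^sup>2) * cre (squeezed \<beta> j) m"
    by (simp add: bann_def bcre_def power2_eq_square algebra_simps)
  then show ?thesis unfolding bann_squeezed bcre_squeezed ch_sq_minus_sh_sq by simp
qed

text \<open>Solving \<open>cre_squeezed\<close> for the highest level leaves terms whose level plus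
  coordinate is smaller by two. This makes an induction on that sum possible;
  \<open>squeezed_rec_coord\<close> is the mirror image, raising the coordinate.\<close>

lemma squeezed_rec_level:
  "sqrt (real (Suc j)) * squeezed \<beta> (Suc j) m
    = sqrt (1 - \<beta>\<^sup>2) * cre (squeezed \<beta> j) m + \<beta> * (sqrt (real j) * squeezed \<beta> (j - 1) m)"
proof -
  have c: "ch \<beta> * sqrt (1 - \<beta>\<^sup>2) = 1" using one_minus_beta_sq_pos by (simp add: ch_def)
  have "sqrt (1 - \<beta>\<^sup>2) * (ch \<beta> * A - \<beta> * ch \<beta> * B) = (ch \<beta> * sqrt (1 - \<beta>\<^sup>2)) * (A - \<beta> * B)" for A B
    by (simp add: algebra_simps)
  then show ?thesis unfolding cre_squeezed sh_eq c by simp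
qed

lemma squeezed_rec_coord:
  "sqrt (real (Suc m)) * squeezed \<beta> j (Suc m)
    = sqrt (1 - \<beta>\<^sup>2) * (sqrt (real j) * squeezed \<beta> (j - 1) m) - \<beta> * cre (squeezed \<beta> j) m"
proof -
  have c: "ch \<beta> * sqrt (1 - \<beta>\<^sup>2) = 1" using one_minus_beta_sq_pos by (simp add: ch_def)
  have "sqrt (1 - \<beta>\<^sup>2) * bann \<beta> (squeezed \<beta> j) m
    = (ch \<beta> * sqrt (1 - \<beta>\<^sup>2)) * (ann (squeezed \<beta> j) m + \<beta> * cre (squeezed \<beta> j) m)"
    by (simp add: bann_def sh_eq algebra_simps)
  then show ?thesis unfolding c bann_squeezed by (simp add: ann_def)
qed

lemma geometric_decay_squeezed: "geometric_decay (squeezed \<beta> j)"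
proof (induct j)
  case 0
  \<comment> \<open>One factor \<open>\<beta>\<close> comes with every two coordinates, hence the
    square root. The maximum with 1/2 keeps \<open>r\<close> positive when
    \<open>\<beta> = 0\<close>.\<close>
  define r where "r = sqrt (max \<bar>\<beta>\<bar> (1/2))"
  have r: "0 < r" "r < 1" "r\<^sup>2 = max \<bar>\<beta>\<bar> (1/2)" using \<beta> by (auto simp: r_def)
  show ?case
  proof (rule geometric_decayI[OF r(1,2), of _ "sqrt (sqrt (1 - \<beta>\<^sup>2))"])
    fix m
    show "\<bar>squeezed \<beta> 0 m\<bar> \<le> sqrt (sqrt (1 - \<beta>\<^sup>2)) * r ^ m"
    proof (cases "even m")
      case True
      then obtain k where m: "m = 2 * k" by blast
      have "\<bar>\<beta>\<bar> ^ k * sqrt (central_binom k) \<le> (r\<^sup>2) ^ k * 1"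
        unfolding r(3) using central_binom_le_1[of k] central_binom_pos[of k]
        by (intro mult_mono power_mono) auto
      also have "(r\<^sup>2) ^ k = r ^ m" by (simp add: m power_mult)
      finally show ?thesis using one_minus_beta_sq_pos central_binom_pos[of k]
        by (simp add: m abs_mult power_abs mult.assoc mult_left_mono)
    qed (use r one_minus_beta_sq_pos in simp)
  qed
next
  case (Suc j)
  then show ?case unfolding squeezed.simps(2) by (intro geometric_decay_divide geometric_decay_bcre)
qed

lemma squeezed_bounded: "\<exists>B. \<forall>m. \<bar>squeezed \<beta> j m\<bar> \<le> B"
  by (intro geometric_decay_bounded geometric_decay_squeezed)

text \<open>The even coordinates give the binomial series at \<open>\<beta>\<^sup>2\<close>, which
  the prefactor of \<open>squeezed \<beta> 0\<close> is chosen to cancel.\<close>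

lemma squeezed_norm_0: "(\<lambda>m. squeezed \<beta> 0 m * squeezed \<beta> 0 m) sums 1"
proof -
  have b: "\<bar>\<beta>\<^sup>2\<bar> < 1" using \<beta> by (simp add: abs_square_less_1)
  have "(\<lambda>k. sqrt (1 - \<beta>\<^sup>2) * (central_binom k * (\<beta>\<^sup>2) ^ k)) sums (sqrt (1 - \<beta>\<^sup>2) * (1 - \<beta>\<^sup>2) powr (- 1 / 2))"
    by (intro sums_mult central_binom_series b)
  also have "sqrt (1 - \<beta>\<^sup>2) * (1 - \<beta>\<^sup>2) powr (- 1 / 2) = 1"
    using one_minus_beta_sq_pos by (simp add: powr_minus powr_half_sqrt)
  also have "(\<lambda>k. sqrt (1 - \<beta>\<^sup>2) * (central_binom k * (\<beta>\<^sup>2) ^ k)) = (\<lambda>k. (\<lambda>m. squeezed \<beta> 0 m * squeezed \<beta> 0 m) (2 * k))"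
  proof
    fix k
    have "squeezed \<beta> 0 (2 * k) * squeezed \<beta> 0 (2 * k) = (sqrt (sqrt (1 - \<beta>\<^sup>2)))\<^sup>2 * ((- \<beta>) ^ k)\<^sup>2 * (sqrt (central_binom k))\<^sup>2"
      by (simp add: power2_eq_square mult_ac)
    also have "\<dots> = sqrt (1 - \<beta>\<^sup>2) * (central_binom k * (\<beta>\<^sup>2) ^ k)"
      using one_minus_beta_sq_pos central_binom_pos[of k] by (simp add: power_mult[symmetric] mult.commute)
    finally show "sqrt (1 - \<beta>\<^sup>2) * (central_binom k * (\<beta>\<^sup>2) ^ k)
       = (\<lambda>m. squeezed \<beta> 0 m * squeezed \<beta> 0 m) (2 * k)" by simp
  qed
  finally show ?thesis
    by (subst (asm) sums_mono_reindex) (auto simp: strict_mono_def elim!: evenE)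
qed

lemma squeezed_orthonormal:
  "(\<Sum>m. squeezed \<beta> i m * squeezed \<beta> j m) = (if i = j then 1 else 0)"
proof -
  have adj: "(\<Sum>m. bcre \<beta> x m * y m) = (\<Sum>m. x m * bann \<beta> y m)"
    if x: "geometric_decay x" and y: "geometric_decay y" for x y
  proof -
    obtain B where B: "\<And>m. \<bar>y m\<bar> \<le> B" using geometric_decay_bounded[OF y] by blast
    note s = geometric_decay_summable_mult[where ?'a = real, unfolded real_norm_def real_scaleR_def]
    obtain B1 where B1: "\<And>m. \<bar>ann y m\<bar> \<le> B1"
      using geometric_decay_bounded[OF geometric_decay_ann[OF y]] by blast
    obtain B2 where B2: "\<And>m. \<bar>cre y m\<bar> \<le> B2"
      using geometric_decay_bounded[OF geometric_decay_cre[OF y]] by blast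
    have "(\<lambda>m. ch \<beta> * (cre x m * y m) + sh \<beta> * (ann x m * y m)) sums
       (ch \<beta> * (\<Sum>m. cre x m * y m) + sh \<beta> * (\<Sum>m. ann x m * y m))"
      by (intro sums_add sums_mult summable_sums s[OF _ B] geometric_decay_cre geometric_decay_ann x)
    moreover have "(\<lambda>m. ch \<beta> * (x m * ann y m) + sh \<beta> * (x m * cre y m)) sums
       (ch \<beta> * (\<Sum>m. x m * ann y m) + sh \<beta> * (\<Sum>m. x m * cre y m))"
      by (intro sums_add sums_mult summable_sums s[OF x B1] s[OF x B2])
    ultimately show ?thesis
      using ann_cre_adjoint[OF x, of y B, OF B] cre_ann_adjoint[OF x, of y B, OF B]
      by (simp add: bann_def bcre_def sums_iff algebra_simps)
  qed
  note D = geometric_decay_squeezed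
  \<comment> \<open>With the difference \<open>d\<close> of the levels fixed, one induction step
    moves a creation operator to the other factor, where it acts as \<open>bann\<close> and lowers
    both levels.\<close>
  have main: "(\<Sum>m. squeezed \<beta> i m * squeezed \<beta> (i + d) m) = (if d = 0 then 1 else 0)" for i d
  proof (induct i)
    case 0
    show ?case
    proof (cases d)
      case 0
      then show ?thesis using squeezed_norm_0 by (simp add: sums_iff)
    next
      case (Suc k)
      have "sqrt (real (Suc k)) * (\<Sum>m. squeezed \<beta> (Suc k) m * squeezed \<beta> 0 m)
        = (\<Sum>m. sqrt (real (Suc k)) * (squeezed \<beta> (Suc k) m * squeezed \<beta> 0 m))"
        using geometric_decay_summable_mult[OF D[of "Suc k"], of "squeezed \<beta> 0"] squeezed_bounded[of 0]
        by (intro suminf_mult[symmetric]) auto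
      also have "\<dots> = (\<Sum>m. bcre \<beta> (squeezed \<beta> k) m * squeezed \<beta> 0 m)"
        by (simp only: bcre_squeezed mult.assoc)
      also have "\<dots> = 0" unfolding adj[OF D D] bann_squeezed_0 by simp
      finally have "(\<Sum>m. squeezed \<beta> (Suc k) m * squeezed \<beta> 0 m) = 0" by (simp del: squeezed.simps)
      then show ?thesis using Suc by (simp add: mult.commute del: squeezed.simps)
    qed
  next
    case (Suc i)
    have s: "summable (\<lambda>m. squeezed \<beta> i m * squeezed \<beta> j m)" for i j
      using geometric_decay_summable_mult[OF D[of i], of "squeezed \<beta> j"] squeezed_bounded[of j] by auto
    have "sqrt (real (Suc i)) * (\<Sum>m. squeezed \<beta> (Suc i) m * squeezed \<beta> (Suc (i + d)) m)
        = (\<Sum>m. sqrt (real (Suc i)) * (squeezed \<beta> (Suc i) m * squeezed \<beta> (Suc (i + d)) m))"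
      by (intro suminf_mult[symmetric] s)
    also have "\<dots> = (\<Sum>m. bcre \<beta> (squeezed \<beta> i) m * squeezed \<beta> (Suc (i + d)) m)"
      by (simp only: bcre_squeezed mult.assoc)
    also have "\<dots> = (\<Sum>m. sqrt (real (Suc (i + d))) * (squeezed \<beta> i m * squeezed \<beta> (i + d) m))"
      unfolding adj[OF D D] bann_squeezed_Suc by (simp only: mult_ac)
    also have "\<dots> = sqrt (real (Suc (i + d))) * (\<Sum>m. squeezed \<beta> i m * squeezed \<beta> (i + d) m)"
      by (intro suminf_mult s)
    also have "\<dots> = sqrt (real (Suc i)) * (if d = 0 then 1 else 0)"
      unfolding Suc by simp
    finally show ?case by (simp del: squeezed.simps)
  qed
  show ?thesis
  proof (cases "i \<le> j")
    case True
    then show ?thesis using main[of i "j - i"] by auto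
  next
    case False
    then show ?thesis using main[of j "i - j"] by (auto simp: mult.commute)
  qed
qed

end

text \<open>The two recurrences are exchanged by transposition together with \<open>\<beta> \<mapsto> - \<beta>\<close>; this is
  what makes the squeezed states complete.\<close>

lemma squeezed_transpose:
  assumes "\<bar>\<beta>\<bar> < 1"
  shows "squeezed \<beta> j m = squeezed (- \<beta>) m j"
proof (induct "j + m" arbitrary: j m rule: less_induct)
  case less
  have \<beta>': "\<bar>- \<beta>\<bar> < 1" using assms by simp
  show ?case
  proof (cases j)
    case j: (Suc j')
    have "sqrt (real (Suc j')) * squeezed \<beta> (Suc j') m
      = sqrt (1 - \<beta>\<^sup>2) * cre (squeezed \<beta> j') m + \<beta> * (sqrt (real j') * squeezed \<beta> (j' - 1) m)"
      by (rule squeezed_rec_level[OF assms])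
    also have "cre (squeezed \<beta> j') m = sqrt (real m) * squeezed (- \<beta>) (m - 1) j'"
      using less[of j' "m - 1"] by (auto simp: cre_def j simp del: squeezed.simps)
    also have "sqrt (real j') * squeezed \<beta> (j' - 1) m = cre (squeezed (- \<beta>) m) j'"
      using less[of "j' - 1" m] by (auto simp: cre_def j simp del: squeezed.simps)
    also have "sqrt (1 - \<beta>\<^sup>2) * (sqrt (real m) * squeezed (- \<beta>) (m - 1) j') + \<beta> * cre (squeezed (- \<beta>) m) j'
       = sqrt (real (Suc j')) * squeezed (- \<beta>) m (Suc j')"
      using squeezed_rec_coord[OF \<beta>', of j' m] by (simp del: squeezed.simps)
    finally show ?thesis using j by (simp del: squeezed.simps)
  next
    case j: 0
    show ?thesis
    proof (cases m)
      case m: (Suc m')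
      have "sqrt (real (Suc m')) * squeezed \<beta> 0 (Suc m') = - \<beta> * cre (squeezed \<beta> 0) m'"
        using squeezed_rec_coord[OF assms, of m' 0] by (simp del: squeezed.simps)
      also have "cre (squeezed \<beta> 0) m' = sqrt (real m') * squeezed (- \<beta>) (m' - 1) 0"
        using less[of 0 "m' - 1"] by (auto simp: cre_def j m simp del: squeezed.simps)
      also have "- \<beta> * (sqrt (real m') * squeezed (- \<beta>) (m' - 1) 0) = sqrt (real (Suc m')) * squeezed (- \<beta>) (Suc m') 0"
        using squeezed_rec_level[OF \<beta>', of m' 0] by (simp add: cre_def del: squeezed.simps)
      finally show ?thesis using j m by (simp del: squeezed.simps)
    qed (use j in simp)
  qed
qed

section \<open>Completeness and the unperturbed Hamiltonian\<close>

definition unit_vec :: "nat \<Rightarrow> l2" where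
  "unit_vec m = Abs_l2 (\<lambda>n. if n = m then 1 else 0)"

lemma coord_unit_vec: "coord (unit_vec m) n = (if n = m then 1 else 0)"
proof -
  have "(\<lambda>n. (if n = m then 1 else 0 :: real)\<^sup>2) = (\<lambda>n. if n = m then 1 else 0)" by auto
  then have "summable (\<lambda>n. (if n = m then 1 else 0 :: real)\<^sup>2)" by simp
  then show ?thesis unfolding unit_vec_def by (subst Abs_l2_inverse) auto
qed

lemma inner_unit_vec: "inner x (unit_vec m) = coord x m"
proof -
  have "(\<lambda>n. coord x n * coord (unit_vec m) n) = (\<lambda>n. if n = m then coord x n else 0)"
    by (auto simp: coord_unit_vec)
  then show ?thesis
    using sums_single[of m "coord x"] inner_l2_sums[of x "unit_vec m"] by (simp add: sums_iff)
qed

definition sqv :: "real \<Rightarrow> nat \<Rightarrow> l2" where "sqv \<beta> j = Abs_l2 (squeezed \<beta> j)"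

lemma coord_sqv: "\<bar>\<beta>\<bar> < 1 \<Longrightarrow> coord (sqv \<beta> j) = squeezed \<beta> j"
  unfolding sqv_def by (intro Abs_l2_inverse) (simp add: geometric_decay_l2 geometric_decay_squeezed)

lemma sqv_orthonormal: "\<bar>\<beta>\<bar> < 1 \<Longrightarrow> inner (sqv \<beta> i) (sqv \<beta> j) = (if i = j then 1 else 0)"
  unfolding inner_l2_def by (simp add: coord_sqv squeezed_orthonormal)

definition head_residual :: "(nat \<Rightarrow> 'a::real_inner) \<Rightarrow> nat \<Rightarrow> 'a \<Rightarrow> 'a" where
  "head_residual \<phi> N x = x - (\<Sum>j<N. inner (\<phi> j) x *\<^sub>R \<phi> j)"

lemma orthonormal_residual:
  fixes \<phi> :: "nat \<Rightarrow> 'a::real_inner"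
  assumes "\<And>i j. inner (\<phi> i) (\<phi> j) = (if i = j then 1 else 0)"
  shows "(norm (head_residual \<phi> N x))\<^sup>2 = inner x x - (\<Sum>j<N. (inner (\<phi> j) x)\<^sup>2)"
proof -
  define p where "p = (\<Sum>j<N. inner (\<phi> j) x *\<^sub>R \<phi> j)"
  have xp: "inner x p = (\<Sum>j<N. (inner (\<phi> j) x)\<^sup>2)"
    by (simp add: p_def inner_sum_right power2_eq_square inner_commute)
  have "inner (\<phi> j) p = inner (\<phi> j) x" if "j < N" for j
    using that by (simp add: p_def inner_sum_right assms if_distrib cong: if_cong)
  then have "inner p p = (\<Sum>j<N. (inner (\<phi> j) x)\<^sup>2)"
    by (subst (1) p_def) (simp add: inner_sum_left power2_eq_square)
  then show ?thesis
    unfolding head_residual_def p_def[symmetric] power2_norm_eq_inner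
    by (simp add: inner_diff_left inner_diff_right xp inner_commute[of p x])
qed

lemma head_residual_add: "head_residual \<phi> N (x + y) = head_residual \<phi> N x + head_residual \<phi> N y"
  by (simp add: head_residual_def inner_add_right scaleR_add_left sum.distrib algebra_simps)

lemma head_residual_scale: "head_residual \<phi> N (r *\<^sub>R x) = r *\<^sub>R head_residual \<phi> N x"
  by (simp add: head_residual_def scaleR_sum_right algebra_simps)

lemma head_residual_sum: "head_residual \<phi> N (\<Sum>i\<in>A. f i) = (\<Sum>i\<in>A. head_residual \<phi> N (f i))"
proof (induct A rule: infinite_finite_induct)
  case (insert a A)
  then show ?case by (simp add: head_residual_add)
qed (simp_all add: head_residual_def)

lemma l2_dense:
  assumes "e > 0"
  shows "\<exists>M. norm (x - (\<Sum>m<M. coord x m *\<^sub>R unit_vec m)) < e"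
proof -
  have "(\<lambda>M. \<Sum>m<M. coord x m * coord x m) \<longlonglongrightarrow> inner x x"
    using inner_l2_sums[of x x] by (simp add: sums_def)
  then obtain M where M: "\<bar>(\<Sum>m<M. coord x m * coord x m) - inner x x\<bar> < e\<^sup>2"
    using LIMSEQ_D[of _ "inner x x" "e\<^sup>2"] assms by fastforce
  have "(norm (head_residual unit_vec M x))\<^sup>2 = inner x x - (\<Sum>m<M. (inner (unit_vec m) x)\<^sup>2)"
    by (rule orthonormal_residual) (auto simp: inner_unit_vec coord_unit_vec)
  also have "\<dots> < e\<^sup>2"
    using M by (simp add: inner_commute[of "unit_vec _" x] inner_unit_vec power2_eq_square)
  finally have "norm (head_residual unit_vec M x) < e"
    by (rule power2_less_imp_less) (use assms in simp)
  then show ?thesis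
    by (auto simp: head_residual_def inner_commute[of "unit_vec _" x] inner_unit_vec)
qed

text \<open>By \<open>squeezed_transpose\<close>, a row of the coefficient matrix for
  \<open>\<beta>\<close> is a squeezed state for \<open>- \<beta>\<close> and so has norm 1. That is
  Parseval's identity for unit vectors. Finite combinations of them are dense and residuals never
  exceed the norm, so it extends to all vectors.\<close>

lemma sqv_parseval:
  assumes \<beta>: "\<bar>\<beta>\<bar> < 1"
  shows "(\<lambda>j. (inner (sqv \<beta> j) x)\<^sup>2) sums inner x x"
proof -
  note orth = orthonormal_residual[OF sqv_orthonormal[OF \<beta>]]
  have unit: "(\<lambda>N. head_residual (sqv \<beta>) N (unit_vec m)) \<longlonglongrightarrow> 0" for m
  proof -
    have \<beta>': "\<bar>- \<beta>\<bar> < 1" using \<beta> by simp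
    have "(\<lambda>j. (inner (sqv \<beta> j) (unit_vec m))\<^sup>2) = (\<lambda>j. coord (sqv (- \<beta>) m) j * coord (sqv (- \<beta>) m) j)"
      by (simp add: inner_unit_vec coord_sqv[OF \<beta>] coord_sqv[OF \<beta>'] squeezed_transpose[OF \<beta>] power2_eq_square)
    then have "(\<lambda>j. (inner (sqv \<beta> j) (unit_vec m))\<^sup>2) sums 1"
      using inner_l2_sums[of "sqv (- \<beta>) m" "sqv (- \<beta>) m"] sqv_orthonormal[OF \<beta>', of m m] by simp
    then have "(\<lambda>N. 1 - (\<Sum>j<N. (inner (sqv \<beta> j) (unit_vec m))\<^sup>2)) \<longlonglongrightarrow> 1 - 1"
      unfolding sums_def by (intro tendsto_diff tendsto_const)
    then have "(\<lambda>N. (norm (head_residual (sqv \<beta>) N (unit_vec m)))\<^sup>2) \<longlonglongrightarrow> 0"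
      by (simp add: orth inner_unit_vec coord_unit_vec)
    then have "(\<lambda>N. sqrt ((norm (head_residual (sqv \<beta>) N (unit_vec m)))\<^sup>2)) \<longlonglongrightarrow> sqrt 0"
      by (rule tendsto_real_sqrt)
    then show ?thesis by (simp add: tendsto_norm_zero_iff)
  qed
  have "(\<lambda>N. head_residual (sqv \<beta>) N x) \<longlonglongrightarrow> 0"
  proof (rule LIMSEQ_I)
    fix e :: real assume e: "e > 0"
    obtain M where M: "norm (x - (\<Sum>m<M. coord x m *\<^sub>R unit_vec m)) < e / 2"
      using l2_dense[of "e / 2" x] e by auto
    define y where "y = (\<Sum>m<M. coord x m *\<^sub>R unit_vec m)"
    have "(\<lambda>N. head_residual (sqv \<beta>) N y) \<longlonglongrightarrow> (\<Sum>m<M. coord x m *\<^sub>R 0)"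
      unfolding y_def head_residual_sum head_residual_scale by (intro tendsto_intros unit)
    then have "(\<lambda>N. head_residual (sqv \<beta>) N y) \<longlonglongrightarrow> 0" by simp
    from LIMSEQ_D[OF this, of "e / 2"] e
    obtain N0 where N0: "\<And>N. N \<ge> N0 \<Longrightarrow> norm (head_residual (sqv \<beta>) N y) < e / 2" by auto
    have "norm (head_residual (sqv \<beta>) N x - 0) < e" if "N \<ge> N0" for N
    proof -
      have "(norm (head_residual (sqv \<beta>) N (x - y)))\<^sup>2 \<le> inner (x - y) (x - y)"
        unfolding orth by (simp add: sum_nonneg)
      then have "(norm (head_residual (sqv \<beta>) N (x - y)))\<^sup>2 \<le> (norm (x - y))\<^sup>2"
        by (simp only: power2_norm_eq_inner)
      then have "norm (head_residual (sqv \<beta>) N (x - y)) \<le> norm (x - y)"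
        by (rule power2_le_imp_le) simp
      moreover have "head_residual (sqv \<beta>) N x = head_residual (sqv \<beta>) N (x - y) + head_residual (sqv \<beta>) N y"
        by (simp flip: head_residual_add)
      ultimately show ?thesis
        using norm_triangle_ineq[of "head_residual (sqv \<beta>) N (x - y)" "head_residual (sqv \<beta>) N y"] M N0[OF that]
        by (simp add: y_def)
    qed
    then show "\<exists>N0. \<forall>N\<ge>N0. norm (head_residual (sqv \<beta>) N x - 0) < e" by blast
  qed
  then have "(\<lambda>N. inner x x - (norm (head_residual (sqv \<beta>) N x))\<^sup>2) \<longlonglongrightarrow> inner x x - (norm (0::l2))\<^sup>2"
    by (intro tendsto_intros)
  then show ?thesis by (simp add: orth sums_def)
qed

text \<open>The diagonal of the perturbation for \<open>\<Delta> = 2\<close>. A shift by two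
  reverses its sign, so it anticommutes with \<open>a^2\<close> and its adjoint.\<close>

definition pattern :: "nat \<Rightarrow> real" where "pattern m = (- 1) ^ (m div 2)"

lemma pattern_sq: "pattern m * pattern m = 1"
  by (simp add: pattern_def flip: power_mult_distrib)

lemma pattern_mult: "pattern m * a * (pattern m * b) = a * b"
  using pattern_sq[of m] by (metis mult.assoc mult.commute mult_1)

lemma pattern_Suc_Suc: "pattern (Suc (Suc m)) = - pattern m"
  by (simp add: pattern_def)

lemma abs_pattern: "\<bar>pattern m\<bar> = 1"
  by (simp add: pattern_def)

lift_definition pattern_op :: "l2 \<Rightarrow> l2" is "\<lambda>x m. pattern m * x m"
  by (simp add: power2_eq_square pattern_mult)

lemma coord_pattern_op: "coord (pattern_op x) m = pattern m * coord x m"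
  by (rule arg_cong[OF pattern_op.rep_eq, of "\<lambda>f. f m"])

lemma linear_pattern_op: "linear pattern_op"
  by (rule linearI) (auto intro!: l2_eqI simp: coord_pattern_op algebra_simps)

lemma pattern_op_sym: "inner x (pattern_op y) = inner (pattern_op x) y"
  by (simp add: inner_l2_def coord_pattern_op mult_ac)

lemma norm_pattern_op: "norm (pattern_op x) = norm x"
proof -
  have "inner (pattern_op x) (pattern_op x) = inner x x"
    by (simp add: inner_l2_def coord_pattern_op pattern_mult)
  then show ?thesis by (simp add: norm_eq_sqrt_inner)
qed

section \<open>The unperturbed Hamiltonian in the squeezed basis\<close>

context
  fixes \<beta> :: real
  assumes \<beta>: "\<bar>\<beta>\<bar> < 1"
begin

text \<open>Substituting \<open>a = ch b - sh b^+\<close> into the number operator gives a band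
  matrix with steps of two. For \<open>j < 2\<close> the square roots cancel the truncated index
  \<open>j - 2\<close>.\<close>

lemma number_squeezed:
  "real m * squeezed \<beta> j m = ((ch \<beta>)\<^sup>2 * real j + (sh \<beta>)\<^sup>2 * (real j + 1)) * squeezed \<beta> j m
     - ch \<beta> * sh \<beta> * (sqrt (real j) * sqrt (real (j - 1)) * squeezed \<beta> (j - 2) m
       + sqrt (real (Suc j)) * sqrt (real (Suc (Suc j))) * squeezed \<beta> (Suc (Suc j)) m)"
  (is "_ = ?R")
proof -
  have e: "ann (squeezed \<beta> j) = (\<lambda>m. (ch \<beta> * sqrt (real j)) * squeezed \<beta> (j - 1) m
      + (- sh \<beta> * sqrt (real (Suc j))) * squeezed \<beta> (Suc j) m)"
    by (rule ext) (simp add: ann_squeezed[OF \<beta>] algebra_simps del: squeezed.simps)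
  have "real m * squeezed \<beta> j m = cre (ann (squeezed \<beta> j)) m" by (simp only: cre_ann)
  also have "\<dots> = (ch \<beta> * sqrt (real j)) * cre (squeezed \<beta> (j - 1)) m
      + (- sh \<beta> * sqrt (real (Suc j))) * cre (squeezed \<beta> (Suc j)) m"
    unfolding e cre_lin ..
  also have "(- sh \<beta> * sqrt (real (Suc j))) * cre (squeezed \<beta> (Suc j)) m =
      (sh \<beta>)\<^sup>2 * (sqrt (real (Suc j)) * sqrt (real (Suc j))) * squeezed \<beta> j m
      - ch \<beta> * sh \<beta> * (sqrt (real (Suc j)) * sqrt (real (Suc (Suc j))) * squeezed \<beta> (Suc (Suc j)) m)"
    by (simp only: cre_squeezed[OF \<beta>] diff_Suc_1) (simp add: algebra_simps power2_eq_square del: squeezed.simps)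
  also have "sqrt (real (Suc j)) * sqrt (real (Suc j)) = real j + 1" by simp
  also have "(ch \<beta> * sqrt (real j)) * cre (squeezed \<beta> (j - 1)) m =
      (ch \<beta>)\<^sup>2 * real j * squeezed \<beta> j m - ch \<beta> * sh \<beta> * (sqrt (real j) * sqrt (real (j - 1)) * squeezed \<beta> (j - 2) m)"
  proof (cases j)
    case (Suc i)
    have "(ch \<beta> * sqrt (real (Suc i))) * cre (squeezed \<beta> i) m =
      (ch \<beta>)\<^sup>2 * (sqrt (real (Suc i)) * sqrt (real (Suc i))) * squeezed \<beta> (Suc i) m
       - ch \<beta> * sh \<beta> * (sqrt (real (Suc i)) * sqrt (real i) * squeezed \<beta> (i - 1) m)"
      by (simp only: cre_squeezed[OF \<beta>] power2_eq_square) algebra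
    also have "sqrt (real (Suc i)) * sqrt (real (Suc i)) = real (Suc i)" by simp
    finally show ?thesis using Suc by (simp del: squeezed.simps of_nat_Suc)
  qed simp
  finally show ?thesis by (simp add: algebra_simps del: squeezed.simps)
qed

lemma ann_ann_plus_cre_cre_squeezed:
  "ann (ann (squeezed \<beta> j)) m + cre (cre (squeezed \<beta> j)) m =
     ((ch \<beta>)\<^sup>2 + (sh \<beta>)\<^sup>2) * (sqrt (real j) * sqrt (real (j - 1)) * squeezed \<beta> (j - 2) m
       + sqrt (real (Suc j)) * sqrt (real (Suc (Suc j))) * squeezed \<beta> (Suc (Suc j)) m)
     - 2 * ch \<beta> * sh \<beta> * (2 * real j + 1) * squeezed \<beta> j m"
proof -
  define A where "A i = sqrt (real i) * squeezed \<beta> (i - 1) m" for i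
  define B where "B i = sqrt (real (Suc i)) * squeezed \<beta> (Suc i) m" for i
  have ann: "ann (squeezed \<beta> i) = (\<lambda>m. (ch \<beta> * sqrt (real i)) * squeezed \<beta> (i - 1) m
      + (- sh \<beta> * sqrt (real (Suc i))) * squeezed \<beta> (Suc i) m)" for i
    by (rule ext) (simp add: ann_squeezed[OF \<beta>] algebra_simps del: squeezed.simps)
  have cre: "cre (squeezed \<beta> i) = (\<lambda>m. (ch \<beta> * sqrt (real (Suc i))) * squeezed \<beta> (Suc i) m
      + (- sh \<beta> * sqrt (real i)) * squeezed \<beta> (i - 1) m)" for i
    by (rule ext) (simp add: cre_squeezed[OF \<beta>] algebra_simps del: squeezed.simps)
  have AA: "sqrt (real j) * B (j - 1) = real j * squeezed \<beta> j m"
    by (cases j) (simp_all add: B_def mult.assoc[symmetric] del: squeezed.simps of_nat_Suc)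
  have BB: "sqrt (real (Suc j)) * A (Suc j) = (real j + 1) * squeezed \<beta> j m"
    by (simp add: A_def mult.assoc[symmetric] del: squeezed.simps)
  have A1: "sqrt (real j) * A (j - 1) = sqrt (real j) * sqrt (real (j - 1)) * squeezed \<beta> (j - 2) m"
    by (simp add: A_def numeral_2_eq_2)
  have B1: "sqrt (real (Suc j)) * B (Suc j) = sqrt (real (Suc j)) * sqrt (real (Suc (Suc j))) * squeezed \<beta> (Suc (Suc j)) m"
    by (simp add: B_def del: squeezed.simps)
  have alg: "c * p * (c * a1 - s * b1) - s * q * (c * a2 - s * b2)
      + (c * q * (c * b2 - s * a2) - s * p * (c * b1 - s * a1))
      = (c * c + s * s) * (p * a1 + q * b2) - 2 * c * s * (p * b1 + q * a2)" for c s p q a1 a2 b1 b2 :: real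
    by (simp add: algebra_simps)
  have "ann (ann (squeezed \<beta> j)) m = ch \<beta> * sqrt (real j) * (ch \<beta> * A (j - 1) - sh \<beta> * B (j - 1))
      - sh \<beta> * sqrt (real (Suc j)) * (ch \<beta> * A (Suc j) - sh \<beta> * B (Suc j))"
    by (subst ann, subst ann_lin, simp only: ann_squeezed[OF \<beta>] A_def B_def minus_mult_left[symmetric] add_uminus_conv_diff)
  moreover have "cre (cre (squeezed \<beta> j)) m = ch \<beta> * sqrt (real (Suc j)) * (ch \<beta> * B (Suc j) - sh \<beta> * A (Suc j))
      - sh \<beta> * sqrt (real j) * (ch \<beta> * B (j - 1) - sh \<beta> * A (j - 1))"
    by (subst cre, subst cre_lin, simp only: cre_squeezed[OF \<beta>] A_def B_def minus_mult_left[symmetric] add_uminus_conv_diff)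
  ultimately have "ann (ann (squeezed \<beta> j)) m + cre (cre (squeezed \<beta> j)) m =
     ((ch \<beta>)\<^sup>2 + (sh \<beta>)\<^sup>2) * (sqrt (real j) * A (j - 1) + sqrt (real (Suc j)) * B (Suc j))
     - 2 * ch \<beta> * sh \<beta> * (sqrt (real j) * B (j - 1) + sqrt (real (Suc j)) * A (Suc j))"
    by (simp only: power2_eq_square alg)
  then show ?thesis unfolding AA BB A1 B1 by (simp add: algebra_simps del: squeezed.simps)
qed

text \<open>With \<open>\<beta> = tanh r\<close>, \<open>freq\<close> is \<open>1 / cosh 2r\<close>
  and \<open>coup\<close>, below, is \<open>(tanh 2r) / 2\<close>. They become the level spacing and
  the coupling constant \<open>g\<close>; using \<open>\<beta>\<close> as parameter keeps both
  rational.\<close>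

definition freq :: real where "freq = (1 - \<beta>\<^sup>2) / (1 + \<beta>\<^sup>2)"
definition coup :: real where "coup = \<beta> / (1 + \<beta>\<^sup>2)"
definition level :: "nat \<Rightarrow> real" where "level j = freq * real j + (freq - 1) / 2"

lemma freq_pos: "0 < freq"
  using one_minus_beta_sq_pos[OF \<beta>] by (simp add: freq_def add_pos_nonneg)

lemma denom_pos: "0 < 1 + \<beta>\<^sup>2" by (simp add: add_pos_nonneg)

lemma ch_sq_plus_sh_sq: "(ch \<beta>)\<^sup>2 + (sh \<beta>)\<^sup>2 = 1 / freq"
proof -
  have "(ch \<beta>)\<^sup>2 + (sh \<beta>)\<^sup>2 = (1 + \<beta>\<^sup>2) * (ch \<beta>)\<^sup>2"
    by (simp add: sh_eq[OF \<beta>] power_mult_distrib algebra_simps)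
  then show ?thesis by (simp add: ch_sq[OF \<beta>] freq_def)
qed

lemma ch_sh: "ch \<beta> * sh \<beta> = coup / freq"
proof -
  have "ch \<beta> * sh \<beta> = \<beta> * (ch \<beta>)\<^sup>2" by (simp add: sh_eq[OF \<beta>] power2_eq_square)
  then show ?thesis using denom_pos one_minus_beta_sq_pos[OF \<beta>]
    by (simp add: ch_sq[OF \<beta>] freq_def coup_def)
qed

lemma sh_sq: "(sh \<beta>)\<^sup>2 = (1 / freq - 1) / 2"
  using ch_sq_plus_sh_sq ch_sq_minus_sh_sq[OF \<beta>] by simp

lemma freq_coup: "freq\<^sup>2 + 4 * coup\<^sup>2 = 1"
  using denom_pos by (simp add: freq_def coup_def power_divide add_divide_distrib[symmetric])
    (simp add: field_simps power2_eq_square)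

text \<open>The coefficient of the off-diagonal terms is
  \<open>coup * cosh 2r - (sinh 2r) / 2\<close>, and \<open>coup\<close> is exactly the value that
  makes it vanish.\<close>

lemma squeezed_eigen:
  "real m * squeezed \<beta> j m + coup * (ann (ann (squeezed \<beta> j)) m + cre (cre (squeezed \<beta> j)) m)
     = level j * squeezed \<beta> j m"
proof -
  define X where "X = sqrt (real j) * sqrt (real (j - 1)) * squeezed \<beta> (j - 2) m
       + sqrt (real (Suc j)) * sqrt (real (Suc (Suc j))) * squeezed \<beta> (Suc (Suc j)) m"
  have ch: "(ch \<beta>)\<^sup>2 = 1 + (sh \<beta>)\<^sup>2" using ch_sq_minus_sh_sq[OF \<beta>] by simp
  have f: "freq \<noteq> 0" using freq_pos by simp
  have c: "coup * coup = (1 - freq * freq) / 4" using freq_coup by (simp add: power2_eq_square)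
  have "real m * squeezed \<beta> j m + coup * (ann (ann (squeezed \<beta> j)) m + cre (cre (squeezed \<beta> j)) m)
    = (((ch \<beta>)\<^sup>2 * real j + (sh \<beta>)\<^sup>2 * (real j + 1)) - coup * (2 * (ch \<beta> * sh \<beta>) * (2 * real j + 1))) * squeezed \<beta> j m
      + (coup * ((ch \<beta>)\<^sup>2 + (sh \<beta>)\<^sup>2) - ch \<beta> * sh \<beta>) * X"
    unfolding number_squeezed ann_ann_plus_cre_cre_squeezed X_def[symmetric] by (simp add: algebra_simps del: squeezed.simps)
  also have "coup * ((ch \<beta>)\<^sup>2 + (sh \<beta>)\<^sup>2) - ch \<beta> * sh \<beta> = 0"
    unfolding ch_sq_plus_sh_sq ch_sh by simp
  also have "((ch \<beta>)\<^sup>2 * real j + (sh \<beta>)\<^sup>2 * (real j + 1)) - coup * (2 * (ch \<beta> * sh \<beta>) * (2 * real j + 1)) = level j"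
  proof -
    have E: "((ch \<beta>)\<^sup>2 * real j + (sh \<beta>)\<^sup>2 * (real j + 1)) - coup * (2 * (ch \<beta> * sh \<beta>) * (2 * real j + 1))
      = real j + (F - 1) / 2 * (2 * real j + 1) - (coup * coup) * (2 * F * (2 * real j + 1))"
      if F: "F = 1 / freq" for F
    proof -
      have u1: "ch \<beta> * sh \<beta> = coup * F" and u2: "(sh \<beta>)\<^sup>2 = (F - 1) / 2" by (simp_all add: F ch_sh sh_sq)
      show ?thesis unfolding ch u1 u2 by (simp add: field_simps)
    qed
    show ?thesis unfolding E[OF refl] c level_def using f by (simp add: field_simps)
  qed
  finally show ?thesis by simp
qed

end

section \<open>Matrix elements of the perturbation\<close>

definition overlap :: "real \<Rightarrow> nat \<Rightarrow> nat \<Rightarrow> real" where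
  "overlap \<beta> m n = inner (sqv \<beta> m) (pattern_op (sqv \<beta> n))"

lemma overlap_sums:
  assumes "\<bar>\<beta>\<bar> < 1"
  shows "(\<lambda>k. squeezed \<beta> m k * (pattern k * squeezed \<beta> n k)) sums overlap \<beta> m n"
  unfolding overlap_def using inner_l2_sums[of "sqv \<beta> m" "pattern_op (sqv \<beta> n)"]
  by (simp add: coord_pattern_op coord_sqv[OF assms])

text \<open>\<open>pattern_op\<close> is an isometry, so every column of its matrix in the squeezed
  basis has norm 1.\<close>

lemma overlap_bessel:
  assumes \<beta>: "\<bar>\<beta>\<bar> < 1" and "finite F"
  shows "(\<Sum>m\<in>F. (overlap \<beta> m n)\<^sup>2) \<le> 1"
proof -
  have "(norm (pattern_op (sqv \<beta> n)))\<^sup>2 = 1"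
    by (simp add: norm_pattern_op power2_norm_eq_inner sqv_orthonormal[OF \<beta>])
  then have "(\<lambda>m. (overlap \<beta> m n)\<^sup>2) sums 1"
    using sqv_parseval[OF \<beta>, of "pattern_op (sqv \<beta> n)"] by (simp add: overlap_def power2_norm_eq_inner)
  then have "summable (\<lambda>m. (overlap \<beta> m n)\<^sup>2)" "(\<Sum>m. (overlap \<beta> m n)\<^sup>2) = 1"
    by (simp_all add: sums_iff)
  then show ?thesis using sum_le_suminf[OF _ assms(2)] by (metis zero_le_power2)
qed

section \<open>Recurrences for the overlaps\<close>

context
  fixes \<beta> :: real
  assumes \<beta>: "\<bar>\<beta>\<bar> < 1"
begin

lemma pattern_anticommute:
  "ann (ann (\<lambda>k. pattern k * x k)) k = - (pattern k * ann (ann x) k)"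
  "cre (cre (\<lambda>k. pattern k * x k)) k = - (pattern k * cre (cre x) k)"
  subgoal by (simp add: ann_def pattern_Suc_Suc)
  subgoal
  proof (cases k)
    case (Suc k')
    then show ?thesis by (cases k') (simp_all add: cre_def pattern_Suc_Suc)
  qed (simp add: cre_def)
  done

lemma geometric_decay_pattern: "geometric_decay x \<Longrightarrow> geometric_decay (\<lambda>k. pattern k * x k)"
  by (erule geometric_decay_mono) (simp add: abs_mult abs_pattern)

text \<open>\<open>\<langle>\<phi>\<^sub>m, J (H\<^sub>0 \<phi>\<^sub>n)\<rangle>\<close> evaluated in two ways, using \<open>J H\<^sub>0 J = 2 N - H\<^sub>0\<close>.\<close>

lemma overlap_number:
  "(\<lambda>k. 2 * (real k * squeezed \<beta> m k) * (pattern k * squeezed \<beta> n k))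
     sums ((level \<beta> m + level \<beta> n) * overlap \<beta> m n)"
proof -
  define x where "x = squeezed \<beta> m"
  define u where "u k = pattern k * squeezed \<beta> n k" for k
  have x: "geometric_decay x" and u: "geometric_decay u"
    unfolding x_def u_def[abs_def] by (intro geometric_decay_pattern geometric_decay_squeezed \<beta>)+
  define Z where "Z y k = ann (ann y) k + cre (cre y) k" for y k
  note s = geometric_decay_summable_mult[where ?'a = real, unfolded real_norm_def real_scaleR_def]
  obtain B where B: "\<And>y k. y \<in> {x, u, ann x, ann u, cre x, cre u, ann (ann x), ann (ann u), cre (cre x), cre (cre u)} \<Longrightarrow> \<bar>y k\<bar> \<le> B"
  proof -
    have bdd: "\<exists>B. \<forall>y\<in>S. \<forall>k. \<bar>y k\<bar> \<le> B" if "finite S" "\<forall>y\<in>S. geometric_decay y" for S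
      using that
    proof (induct S)
      case (insert y S)
      then obtain B where B: "\<forall>y\<in>S. \<forall>k. \<bar>y k\<bar> \<le> B" by auto
      obtain C where C: "\<forall>k. \<bar>y k\<bar> \<le> C" using geometric_decay_bounded[of y] insert by auto
      show ?case using B C by (intro exI[of _ "max B C"]) (auto simp: le_max_iff_disj)
    qed simp
    have "\<exists>B. \<forall>y\<in>{x, u, ann x, ann u, cre x, cre u, ann (ann x), ann (ann u), cre (cre x), cre (cre u)}. \<forall>k. \<bar>y k\<bar> \<le> B"
      by (rule bdd) (use x u in \<open>auto intro: geometric_decay_ann geometric_decay_cre\<close>)
    then show ?thesis using that by blast
  qed
  have sum1: "summable (\<lambda>k. ann (ann x) k * u k)" "summable (\<lambda>k. cre (cre x) k * u k)"
      "summable (\<lambda>k. x k * ann (ann u) k)" "summable (\<lambda>k. x k * cre (cre u) k)"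
    by (rule s[where B = B]; intro geometric_decay_ann geometric_decay_cre x B; simp)+
  have adj: "(\<Sum>k. Z x k * u k) = (\<Sum>k. x k * Z u k)"
  proof -
    have "(\<Sum>k. ann (ann x) k * u k) = (\<Sum>k. x k * cre (cre u) k)"
      by (subst ann_cre_adjoint[where B = B], intro geometric_decay_ann x, rule B, simp,
          subst ann_cre_adjoint[where B = B], rule x, rule B, simp, rule refl)
    moreover have "(\<Sum>k. cre (cre x) k * u k) = (\<Sum>k. x k * ann (ann u) k)"
      by (subst cre_ann_adjoint[where B = B], intro geometric_decay_cre x, rule B, simp,
          subst cre_ann_adjoint[where B = B], rule x, rule B, simp, rule refl)
    ultimately show ?thesis
      using sum1 by (simp add: Z_def distrib_left distrib_right suminf_add[symmetric])
  qed
  have sZ: "summable (\<lambda>k. Z x k * u k)" "summable (\<lambda>k. x k * Z u k)"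
    unfolding Z_def distrib_left distrib_right by (intro summable_add sum1)+
  have ov: "(\<lambda>k. x k * u k) sums overlap \<beta> m n"
    unfolding x_def u_def by (rule overlap_sums[OF \<beta>])
  have e1: "real k * x k = level \<beta> m * x k - coup \<beta> * Z x k" for k
    using squeezed_eigen[OF \<beta>, of k m] by (simp add: x_def Z_def del: squeezed.simps)
  \<comment> \<open>Anticommutation reverses the sign of the coupling relative to \<open>e1\<close>.
    When the two are added, the coupling terms cancel by \<open>adj\<close>.\<close>
  have e2: "real k * u k = level \<beta> n * u k + coup \<beta> * Z u k" for k
  proof -
    have "pattern k * (real k * squeezed \<beta> n k + coup \<beta> * (ann (ann (squeezed \<beta> n)) k + cre (cre (squeezed \<beta> n)) k))
        = pattern k * (level \<beta> n * squeezed \<beta> n k)"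
      by (simp only: squeezed_eigen[OF \<beta>])
    then show ?thesis
      unfolding Z_def u_def[abs_def] pattern_anticommute by (simp add: algebra_simps del: squeezed.simps)
  qed
  have a: "(\<lambda>k. level \<beta> m * (x k * u k) - coup \<beta> * (Z x k * u k))
      sums (level \<beta> m * overlap \<beta> m n - coup \<beta> * (\<Sum>k. Z x k * u k))"
    by (intro sums_diff sums_mult ov summable_sums sZ)
  have b: "(\<lambda>k. level \<beta> n * (x k * u k) + coup \<beta> * (x k * Z u k))
      sums (level \<beta> n * overlap \<beta> m n + coup \<beta> * (\<Sum>k. x k * Z u k))"
    by (intro sums_add sums_mult ov summable_sums sZ)
  have "(\<lambda>k. (level \<beta> m * (x k * u k) - coup \<beta> * (Z x k * u k)) + (level \<beta> n * (x k * u k) + coup \<beta> * (x k * Z u k)))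
      sums ((level \<beta> m + level \<beta> n) * overlap \<beta> m n)"
  proof -
    have "(level \<beta> m * overlap \<beta> m n - coup \<beta> * (\<Sum>k. Z x k * u k))
      + (level \<beta> n * overlap \<beta> m n + coup \<beta> * (\<Sum>k. x k * Z u k)) = (level \<beta> m + level \<beta> n) * overlap \<beta> m n"
      unfolding adj by (simp add: distrib_right)
    then show ?thesis using sums_add[OF a b] by (simp only:)
  qed
  moreover have "(level \<beta> m * (x k * u k) - coup \<beta> * (Z x k * u k)) + (level \<beta> n * (x k * u k) + coup \<beta> * (x k * Z u k))
     = 2 * (real k * x k) * u k" for k
  proof -
    have "(level \<beta> m * x k - coup \<beta> * Z x k) * u k + x k * (level \<beta> n * u k + coup \<beta> * Z u k) = 2 * (real k * x k) * u k"
      unfolding e1[symmetric] e2[symmetric] by simp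
    then show ?thesis by (simp add: algebra_simps)
  qed
  ultimately show ?thesis by (simp add: x_def u_def del: squeezed.simps)
qed

text \<open>Evaluates the number operator between \<open>\<phi> m\<close> and
  \<open>J \<phi> n\<close> twice: through its band matrix and through
  \<open>overlap_number\<close>. The column index \<open>n\<close> enters only as a parameter of the
  coefficients.\<close>

lemma overlap_recurrence:
  "2 * coup \<beta> * (sqrt (real (Suc m)) * sqrt (real (Suc (Suc m))) * overlap \<beta> (Suc (Suc m)) n
     + sqrt (real m) * sqrt (real (m - 1)) * overlap \<beta> (m - 2) n)
   = ((2 - (freq \<beta>)\<^sup>2) * (real m + 1/2) - (freq \<beta>)\<^sup>2 * (real n + 1/2)) * overlap \<beta> m n"
proof -
  define P where "P = sqrt (real m) * sqrt (real (m - 1)) * overlap \<beta> (m - 2) n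
     + sqrt (real (Suc m)) * sqrt (real (Suc (Suc m))) * overlap \<beta> (Suc (Suc m)) n"
  define c where "c = (ch \<beta>)\<^sup>2 * real m + (sh \<beta>)\<^sup>2 * (real m + 1)"
  have f: "freq \<beta> \<noteq> 0" using freq_pos[OF \<beta>] by simp
  have "(\<lambda>k. 2 * (c * (squeezed \<beta> m k * (pattern k * squeezed \<beta> n k))
      - ch \<beta> * sh \<beta> * (sqrt (real m) * sqrt (real (m - 1)) * (squeezed \<beta> (m - 2) k * (pattern k * squeezed \<beta> n k))
      + sqrt (real (Suc m)) * sqrt (real (Suc (Suc m))) * (squeezed \<beta> (Suc (Suc m)) k * (pattern k * squeezed \<beta> n k)))))
      sums (2 * (c * overlap \<beta> m n - ch \<beta> * sh \<beta> * P))"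
    unfolding P_def by (intro sums_mult sums_diff sums_add overlap_sums \<beta>)
  moreover have "2 * (c * (squeezed \<beta> m k * (pattern k * squeezed \<beta> n k))
      - ch \<beta> * sh \<beta> * (sqrt (real m) * sqrt (real (m - 1)) * (squeezed \<beta> (m - 2) k * (pattern k * squeezed \<beta> n k))
      + sqrt (real (Suc m)) * sqrt (real (Suc (Suc m))) * (squeezed \<beta> (Suc (Suc m)) k * (pattern k * squeezed \<beta> n k))))
      = 2 * (real k * squeezed \<beta> m k) * (pattern k * squeezed \<beta> n k)" for k
    unfolding number_squeezed[OF \<beta>] c_def[symmetric] by (simp add: algebra_simps del: squeezed.simps)
  ultimately have "(\<lambda>k. 2 * (real k * squeezed \<beta> m k) * (pattern k * squeezed \<beta> n k))
      sums (2 * (c * overlap \<beta> m n - ch \<beta> * sh \<beta> * P))" by simp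
  from sums_unique2[OF this overlap_number]
  have eq: "2 * (c * overlap \<beta> m n - ch \<beta> * sh \<beta> * P) = (level \<beta> m + level \<beta> n) * overlap \<beta> m n" .
  have c: "freq \<beta> * c = real m + (1 - freq \<beta>) / 2"
  proof -
    have "c = ((ch \<beta>)\<^sup>2 + (sh \<beta>)\<^sup>2) * real m + (sh \<beta>)\<^sup>2"
      by (simp add: c_def algebra_simps)
    then have "c = (1 / freq \<beta>) * real m + (sh \<beta>)\<^sup>2"
      by (simp only: ch_sq_plus_sh_sq[OF \<beta>])
    then have "c = (1 / freq \<beta>) * real m + (1 / freq \<beta> - 1) / 2"
      by (simp only: sh_sq[OF \<beta>])
    then show ?thesis using f by (simp add: field_simps)
  qed
  have "2 * coup \<beta> * P = 2 * (freq \<beta> * c * overlap \<beta> m n) - freq \<beta> * (2 * (c * overlap \<beta> m n - ch \<beta> * sh \<beta> * P))"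
    unfolding ch_sh[OF \<beta>] using f by (simp add: field_simps)
  also have "\<dots> = 2 * ((real m + (1 - freq \<beta>) / 2) * overlap \<beta> m n) - freq \<beta> * ((level \<beta> m + level \<beta> n) * overlap \<beta> m n)"
    unfolding eq c ..
  also have "\<dots> = ((2 - (freq \<beta>)\<^sup>2) * (real m + 1/2) - (freq \<beta>)\<^sup>2 * (real n + 1/2)) * overlap \<beta> m n"
    unfolding level_def[OF \<beta>] by (simp add: field_simps power2_eq_square)
  finally show ?thesis unfolding P_def by (simp add: add.commute)
qed

text \<open>Matrix elements of \<open>i^N\<close> with \<open>N\<close> the number operator. Unlike
  \<open>pattern_op\<close> it has a commutation rule with a single \<open>ann\<close> or
  \<open>cre\<close>, so these entries obey first-order relations; the real overlaps are their real
  plus imaginary parts.\<close>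

definition coverlap :: "nat \<Rightarrow> nat \<Rightarrow> complex" where
  "coverlap m n = (\<Sum>k. (squeezed \<beta> m k * squeezed \<beta> n k) *\<^sub>R \<i> ^ k)"

lemma geometric_decay_mult:
  assumes "geometric_decay x" "geometric_decay y"
  shows "geometric_decay (\<lambda>k. x k * y k)"
proof -
  obtain B where B: "\<And>k. \<bar>y k\<bar> \<le> B" using geometric_decay_bounded[OF assms(2)] by blast
  have "0 \<le> B" using B[of 0] by simp
  show ?thesis
  proof (rule geometric_decay_mono[OF geometric_decay_cmult[OF assms(1), of B]])
    fix k show "\<bar>x k * y k\<bar> \<le> \<bar>B * x k\<bar>"
      using mult_left_mono[OF B[of k], of "\<bar>x k\<bar>"] \<open>0 \<le> B\<close> by (simp add: abs_mult mult.commute)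
  qed
qed

lemma summable_ipow: "geometric_decay x \<Longrightarrow> summable (\<lambda>k. x k *\<^sub>R \<i> ^ k)"
  by (rule geometric_decay_summable_mult[where B = 1]) (simp_all add: norm_power)

lemma coverlap_sums: "(\<lambda>k. (squeezed \<beta> m k * squeezed \<beta> n k) *\<^sub>R \<i> ^ k) sums coverlap m n"
  unfolding coverlap_def
  by (intro summable_sums summable_ipow geometric_decay_mult geometric_decay_squeezed \<beta>)

lemma coverlap_commute: "coverlap m n = coverlap n m"
  by (simp add: coverlap_def mult.commute)

lemma ipow_ann_cre:
  assumes x: "geometric_decay x" and y: "geometric_decay y"
  shows "(\<Sum>k. (x k * ann y k) *\<^sub>R \<i> ^ k) = - \<i> * (\<Sum>k. (cre x k * y k) *\<^sub>R \<i> ^ k)"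
proof -
  have s: "summable (\<lambda>k. (cre x k * y k) *\<^sub>R \<i> ^ k)"
    by (intro summable_ipow geometric_decay_mult geometric_decay_cre x y)
  have "(\<Sum>k. (cre x k * y k) *\<^sub>R \<i> ^ k) = (\<Sum>k. (cre x (Suc k) * y (Suc k)) *\<^sub>R \<i> ^ Suc k)"
    using suminf_split_head[OF s] by (simp add: cre_def)
  also have "\<dots> = (\<Sum>k. \<i> * ((x k * ann y k) *\<^sub>R \<i> ^ k))"
    by (intro arg_cong[where f = suminf] ext) (simp add: cre_def ann_def scaleR_conv_of_real)
  also have "\<dots> = \<i> * (\<Sum>k. (x k * ann y k) *\<^sub>R \<i> ^ k)"
    by (intro suminf_mult summable_ipow geometric_decay_mult geometric_decay_ann x y)
  finally show ?thesis by simp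
qed

lemma coverlap_lin:
  "(\<lambda>k. ((r * squeezed \<beta> m k + s * squeezed \<beta> m' k) * squeezed \<beta> n k) *\<^sub>R \<i> ^ k)
     sums (of_real r * coverlap m n + of_real s * coverlap m' n)"
proof -
  have "(\<lambda>k. of_real r * ((squeezed \<beta> m k * squeezed \<beta> n k) *\<^sub>R \<i> ^ k)
     + of_real s * ((squeezed \<beta> m' k * squeezed \<beta> n k) *\<^sub>R \<i> ^ k))
     sums (of_real r * coverlap m n + of_real s * coverlap m' n)"
    by (intro sums_add sums_mult coverlap_sums)
  then show ?thesis by (simp add: scaleR_conv_of_real algebra_simps del: squeezed.simps)
qed

text \<open>\<open>ipow_ann_cre\<close> moves one annihilation operator across \<open>i^N\<close> at
  the cost of a factor \<open>- i\<close>; both sides are then expanded by the ladder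
  relations.\<close>

lemma coverlap_intertwine:
  "of_real (ch \<beta> * sqrt (real n)) * coverlap m (n - 1) - of_real (sh \<beta> * sqrt (real (Suc n))) * coverlap m (Suc n)
   = - \<i> * (of_real (ch \<beta> * sqrt (real (Suc m))) * coverlap (Suc m) n - of_real (sh \<beta> * sqrt (real m)) * coverlap (m - 1) n)"
proof -
  have "(\<lambda>k. (squeezed \<beta> m k * ann (squeezed \<beta> n) k) *\<^sub>R \<i> ^ k)
     = (\<lambda>k. ((ch \<beta> * sqrt (real n) * squeezed \<beta> (n - 1) k + (- (sh \<beta> * sqrt (real (Suc n)))) * squeezed \<beta> (Suc n) k) * squeezed \<beta> m k) *\<^sub>R \<i> ^ k)"
    by (rule ext) (simp add: ann_squeezed[OF \<beta>] mult_ac del: squeezed.simps)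
  then have a: "(\<Sum>k. (squeezed \<beta> m k * ann (squeezed \<beta> n) k) *\<^sub>R \<i> ^ k)
     = of_real (ch \<beta> * sqrt (real n)) * coverlap (n - 1) m + of_real (- (sh \<beta> * sqrt (real (Suc n)))) * coverlap (Suc n) m"
    by (simp only: coverlap_lin[THEN sums_unique, symmetric])
  have "(\<lambda>k. (cre (squeezed \<beta> m) k * squeezed \<beta> n k) *\<^sub>R \<i> ^ k)
     = (\<lambda>k. ((ch \<beta> * sqrt (real (Suc m)) * squeezed \<beta> (Suc m) k + (- (sh \<beta> * sqrt (real m))) * squeezed \<beta> (m - 1) k) * squeezed \<beta> n k) *\<^sub>R \<i> ^ k)"
    by (rule ext) (simp add: cre_squeezed[OF \<beta>] mult_ac del: squeezed.simps)
  then have b: "(\<Sum>k. (cre (squeezed \<beta> m) k * squeezed \<beta> n k) *\<^sub>R \<i> ^ k)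
     = of_real (ch \<beta> * sqrt (real (Suc m))) * coverlap (Suc m) n + of_real (- (sh \<beta> * sqrt (real m))) * coverlap (m - 1) n"
    by (simp only: coverlap_lin[THEN sums_unique, symmetric])
  show ?thesis
    using ipow_ann_cre[OF geometric_decay_squeezed[OF \<beta>] geometric_decay_squeezed[OF \<beta>], of m n]
    unfolding a b by (simp add: coverlap_commute[of m])
qed

text \<open>The relation for \<open>(m, n)\<close> and, by symmetry, the one for
  \<open>(n, m)\<close> are linear equations in the two raised entries \<open>P\<close> and
  \<open>Q\<close>. Eliminating \<open>Q\<close> leaves a formula for \<open>P\<close>
  alone.\<close>

lemma coverlap_recurrence:
  "of_real (sqrt (real (Suc n))) * coverlap m (Suc n)
   = \<i> * of_real (freq \<beta> * sqrt (real m)) * coverlap (m - 1) n + of_real (2 * coup \<beta> * sqrt (real n)) * coverlap m (n - 1)"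
proof -
  define P where "P = of_real (sqrt (real (Suc n))) * coverlap m (Suc n)"
  define Q where "Q = of_real (sqrt (real (Suc m))) * coverlap (Suc m) n"
  define a where "a = of_real (sqrt (real n)) * coverlap m (n - 1)"
  define b where "b = of_real (sqrt (real m)) * coverlap (m - 1) n"
  define C where "C = complex_of_real (ch \<beta>)"
  define S where "S = complex_of_real (sh \<beta>)"
  define F where "F = complex_of_real (freq \<beta>)"
  have f: "freq \<beta> \<noteq> 0" using freq_pos[OF \<beta>] by simp
  have 1: "C * a - S * P = - \<i> * (C * Q - S * b)"
    using coverlap_intertwine[of n m] by (simp add: C_def S_def P_def Q_def a_def b_def mult.assoc)
  have 2: "C * b - S * Q = - \<i> * (C * P - S * a)"
    using coverlap_intertwine[of m n]
    by (simp add: C_def S_def P_def Q_def a_def b_def mult.assoc coverlap_commute[of _ m] coverlap_commute[of n])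
  have CS: "C * C - S * S = 1" and CS': "F * (C * C + S * S) = 1" and CS'': "F * (C * S) = of_real (coup \<beta>)"
  proof -
    have "(ch \<beta>)\<^sup>2 - (sh \<beta>)\<^sup>2 = 1" "freq \<beta> * ((ch \<beta>)\<^sup>2 + (sh \<beta>)\<^sup>2) = 1" "freq \<beta> * (ch \<beta> * sh \<beta>) = coup \<beta>"
      using ch_sq_minus_sh_sq[OF \<beta>] f by (simp_all add: ch_sq_plus_sh_sq[OF \<beta>] ch_sh[OF \<beta>])
    then have "complex_of_real ((ch \<beta>)\<^sup>2 - (sh \<beta>)\<^sup>2) = of_real 1" "complex_of_real (freq \<beta> * ((ch \<beta>)\<^sup>2 + (sh \<beta>)\<^sup>2)) = of_real 1"
      "complex_of_real (freq \<beta> * (ch \<beta> * sh \<beta>)) = of_real (coup \<beta>)" by simp_all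
    then show "C * C - S * S = 1" "F * (C * C + S * S) = 1" "F * (C * S) = of_real (coup \<beta>)"
      by (simp_all add: C_def S_def F_def power2_eq_square)
  qed
  have CQ: "C * Q = S * b + \<i> * (C * a - S * P)"
    unfolding 1 by (simp add: algebra_simps)
  have "C * (C * b - S * Q) = C * (- \<i> * (C * P - S * a))" unfolding 2 ..
  moreover have "C * (C * b - S * Q) = C * C * b - S * (S * b + \<i> * (C * a - S * P))"
    unfolding CQ[symmetric] by (simp add: algebra_simps)
  ultimately have "C * C * b - S * (S * b + \<i> * (C * a - S * P)) = C * (- \<i> * (C * P - S * a))" by simp
  then have "(C * C - S * S) * b + \<i> * ((C * C + S * S) * P) - 2 * (\<i> * ((C * S) * a)) = 0"
    by (simp add: algebra_simps)
  then have 3: "b + \<i> * ((C * C + S * S) * P) - 2 * (\<i> * ((C * S) * a)) = 0" unfolding CS by simp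
  have "\<i> * (b + \<i> * Y - 2 * (\<i> * X)) = \<i> * b + 2 * X - Y" for X Y
    by (simp add: complex_eq_iff)
  from this[of "(C * C + S * S) * P" "(C * S) * a"]
  have "\<i> * b + 2 * (C * S) * a = (C * C + S * S) * P" unfolding 3 by (simp add: mult.assoc)
  then have "F * ((C * C + S * S) * P) = F * (\<i> * b + 2 * (C * S) * a)" by simp
  then have "(F * (C * C + S * S)) * P = \<i> * F * b + 2 * (F * (C * S)) * a"
    by (simp only: distrib_left mult_ac)
  then have "P = \<i> * F * b + 2 * of_real (coup \<beta>) * a" unfolding CS' CS'' by simp
  then show ?thesis by (simp add: P_def F_def a_def b_def mult_ac)
qed

end

section \<open>Size of the matrix elements\<close>

lemma squeezed_parity: "odd (m + j) \<Longrightarrow> squeezed \<beta> j m = 0"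
proof (induct j arbitrary: m)
  case (Suc j)
  have "ann (squeezed \<beta> j) m = 0" using Suc by (simp add: ann_def del: squeezed.simps)
  moreover have "cre (squeezed \<beta> j) m = 0"
    using Suc by (cases m) (simp_all add: cre_def del: squeezed.simps)
  ultimately show ?case by (simp add: bcre_def)
qed auto

lemma overlap_parity:
  assumes "\<bar>\<beta>\<bar> < 1" "odd (m + n)"
  shows "overlap \<beta> m n = 0"
proof -
  have "squeezed \<beta> m k * (pattern k * squeezed \<beta> n k) = 0" for k
    using squeezed_parity[of k m \<beta>] squeezed_parity[of k n \<beta>] assms(2) by (cases "odd (k + m)") auto
  then have "(\<lambda>k. squeezed \<beta> m k * (pattern k * squeezed \<beta> n k)) = (\<lambda>_. 0)" by blast
  then show ?thesis using overlap_sums[OF assms(1), of m n] sums_unique2[OF _ sums_zero] by metis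
qed

text \<open>Discrete Gronwall in both directions. A relative change \<open>C / N\<close> per step
  costs at most \<open>exp C\<close> upwards; downwards \<open>q \<le> 1 / 2\<close> gives
  \<open>1 / (1 - q) \<le> 1 + 2 * q\<close>, hence \<open>exp (2 * C)\<close>. Any two values in
  the window are therefore comparable up to \<open>exp (3 * C)\<close>.\<close>

lemma slowly_varying_le_average:
  fixes f :: "nat \<Rightarrow> real"
  assumes f: "\<And>i. i \<le> N \<Longrightarrow> 0 \<le> f i" and C: "0 \<le> C" "2 * C \<le> real N" and N: "N > 0"
    and step: "\<And>i. i < N \<Longrightarrow> \<bar>f (Suc i) - f i\<bar> \<le> C / real N * f i"
    and j: "j \<le> N"
  shows "real N * f j \<le> exp (3 * C) * (\<Sum>i<N. f i)"
proof -
  define q where "q = C / real N"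
  have q: "0 \<le> q" "q \<le> 1 / 2" using C N by (auto simp: q_def field_simps)
  have up: "f i \<le> exp (q * real i) * f 0" if "i \<le> N" for i
    using that
  proof (induct i)
    case (Suc i)
    have "f (Suc i) \<le> (1 + q) * f i" using step[of i] Suc by (auto simp: q_def algebra_simps abs_le_iff)
    also have "\<dots> \<le> exp q * (exp (q * real i) * f 0)"
      using Suc f q by (intro mult_mono exp_ge_add_one_self) auto
    also have "\<dots> = exp (q * real (Suc i)) * f 0" by (simp add: exp_add algebra_simps)
    finally show ?case .
  qed simp
  have down: "f 0 \<le> exp (2 * q * real i) * f i" if "i \<le> N" for i
    using that
  proof (induct i)
    case (Suc i)
    have "f i \<le> exp (2 * q) * f (Suc i)"
    proof -
      have "(1 - q) * f i \<le> f (Suc i)" using step[of i] Suc by (auto simp: q_def algebra_simps abs_le_iff)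
      have "1 \<le> (1 + 2 * q) * (1 - q)"
        using mult_nonneg_nonneg[of q "1 - 2 * q"] q by (simp add: algebra_simps)
      then have "f i \<le> (1 + 2 * q) * ((1 - q) * f i)"
        using mult_right_mono[of 1 "(1 + 2 * q) * (1 - q)" "f i"] f[of i] Suc by (simp add: mult.assoc)
      also have "\<dots> \<le> (1 + 2 * q) * f (Suc i)"
        using \<open>(1 - q) * f i \<le> f (Suc i)\<close> q by (intro mult_left_mono) auto
      also have "\<dots> \<le> exp (2 * q) * f (Suc i)"
        using f[of "Suc i"] Suc exp_ge_add_one_self[of "2 * q"] by (intro mult_right_mono) auto
      finally show ?thesis .
    qed
    then have "exp (2 * q * real i) * f i \<le> exp (2 * q * real i) * (exp (2 * q) * f (Suc i))" by simp
    also have "\<dots> = exp (2 * q * real (Suc i)) * f (Suc i)" by (simp add: exp_add algebra_simps)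
    finally show ?case using Suc by simp
  qed simp
  have qN: "q * real i \<le> C" if "i \<le> N" for i
  proof -
    have "q * real i \<le> q * real N" using q that by (intro mult_left_mono) auto
    then show ?thesis using N by (simp add: q_def)
  qed
  have ij: "f j \<le> exp (3 * C) * f i" if "i \<le> N" for i
  proof -
    have "f j \<le> exp (q * real j) * (exp (2 * q * real i) * f i)"
      by (rule order_trans[OF up[OF j]]) (intro mult_left_mono down that, simp)
    also have "\<dots> = exp (q * real j + 2 * (q * real i)) * f i" by (simp add: exp_add mult.assoc)
    also have "\<dots> \<le> exp (3 * C) * f i"
      using qN[OF that] qN[OF j] f[OF that] by (intro mult_right_mono) auto
    finally show ?thesis .
  qed
  have "real N * f j = (\<Sum>i<N. f j)" by simp
  also have "\<dots> \<le> (\<Sum>i<N. exp (3 * C) * f i)" by (intro sum_mono ij) auto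
  also have "\<dots> = exp (3 * C) * (\<Sum>i<N. f i)" by (simp add: sum_distrib_left)
  finally show ?thesis .
qed

context
  fixes \<beta> :: real
  assumes beta: "0 < \<beta>" "\<beta> < 1"
begin

lemma abs_beta: "\<bar>\<beta>\<bar> < 1" using beta by simp

lemma coup_pos: "0 < coup \<beta>"
  unfolding coup_def[OF abs_beta] using beta by (simp add: add_pos_nonneg)

lemma coup_less: "coup \<beta> < 1 / 2"
proof -
  have "0 < (1 - \<beta>)\<^sup>2" using beta by simp
  then have "2 * \<beta> < 1 + \<beta>\<^sup>2" by (simp add: power2_eq_square algebra_simps)
  then show ?thesis unfolding coup_def[OF abs_beta] by (simp add: field_simps add_pos_nonneg)
qed

text \<open>In the oscillatory region \<open>|m - n| \<le> c n\<close> the quadratic form \<open>E\<close> in two consecutive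
  entries of a column is positive definite and changes by a factor \<open>1 + O(1/n)\<close> per step, hence is
  comparable to its mean, which Bessel's inequality bounds.\<close>

lemma overlap_near:
  "\<exists>C c n0. C > 0 \<and> c > 0 \<and> c \<le> 1 \<and> (\<forall>n m. n \<ge> n0 \<longrightarrow> \<bar>real m - real n\<bar> \<le> c * real n \<longrightarrow>
     (overlap \<beta> m n)\<^sup>2 \<le> C / real n)"
proof -
  define g where "g = coup \<beta>"
  have g: "0 < g" "g < 1/2" using coup_pos coup_less by (auto simp: g_def)
  \<comment> \<open>At \<open>k = n\<close> the gap \<open>a k - \<bar>b k\<bar> / 2\<close> below
    is about \<open>2 * g * (1 - 2 * g) * n\<close>, that is \<open>4 * c * n\<close>. A window of
    radius \<open>c * n\<close> loses only part of it and leaves \<open>c * n\<close>.\<close>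
  define c where "c = g * (1 - 2 * g) / 2"
  have c: "0 < c" "c < 1/4" and c2: "2 * c = g * (1 - 2 * g)"
  proof -
    have "g * (1 - 2 * g) < (1/2) * 1" using g by (intro mult_strict_mono) auto
    then show "0 < c" "c < 1/4" "2 * c = g * (1 - 2 * g)" using g by (auto simp: c_def)
  qed
  define w2 where "w2 = (freq \<beta>)\<^sup>2"
  have w2: "w2 = 1 - 4 * g\<^sup>2" "0 \<le> w2" using freq_coup[OF abs_beta] by (auto simp: w2_def g_def)
  \<comment> \<open>With \<open>s\<close> the sum of the two squares, \<open>E\<close> below changes
    by at most \<open>40 * n * s\<close> per step and is at least \<open>g * c * n^2 * s\<close>.
    Over at most \<open>c * n\<close> steps the total relative change is at most
    \<open>40 / g\<close>.\<close>
  define D where "D = 40 / g"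
  have D: "D > 0" using g by (simp add: D_def)
  define n0 where "n0 = nat \<lceil>8 * D / c\<rceil> + nat \<lceil>8 / c\<rceil> + 20"
  define B where "B = 32 * exp (3 * D) / (g * c\<^sup>2)"
  have B: "B > 0" using g c by (simp add: B_def)
  have main: "(overlap \<beta> m n)\<^sup>2 \<le> B / real n"
    if n: "n \<ge> n0" and mn: "\<bar>real m - real n\<bar> \<le> c / 2 * real n" and even: "even (m + n)" for m n
  proof -
    have n_ge: "8 * D / c \<le> real n" "8 / c \<le> real n" "20 \<le> real n"
      using n unfolding n0_def by linarith+
    then have cn: "8 * D \<le> c * real n" "8 \<le> c * real n" using c by (simp_all add: field_simps)
    have npos: "0 < real n" using n_ge by simp
    define G where "G k = overlap \<beta> k n" for k
    define a where "a k = 2 * g * (sqrt (real (Suc k)) * sqrt (real (Suc (Suc k))))" for k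
    define b where "b k = (2 - w2) * (real k + 1/2) - w2 * (real n + 1/2)" for k
    \<comment> \<open>For constant coefficients this is the invariant of
      \<open>a * z + a * x = b * y\<close> on consecutive values \<open>x, y, z\<close>. It is
      positive definite exactly when \<open>\<bar>b\<bar> < 2 * a\<close>, the oscillatory
      case.\<close>
    define E where "E k = (a k)\<^sup>2 * ((G k)\<^sup>2 + (G (Suc (Suc k)))\<^sup>2) - b k * a k * G k * G (Suc (Suc k))" for k
    have rec: "a k * G (Suc (Suc k)) + 2 * g * (sqrt (real k) * sqrt (real (k - 1))) * G (k - 2) = b k * G k" for k
      using overlap_recurrence[OF abs_beta, of k n]
      by (simp add: a_def G_def b_def w2_def g_def distrib_left mult.assoc)
    have a_sq: "(a k)\<^sup>2 = 4 * g\<^sup>2 * ((real k + 1) * (real k + 2))" for k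
      by (simp add: a_def power_mult_distrib add.commute)
    have a_ge: "2 * g * (real k + 1) \<le> a k" for k
    proof -
      have "sqrt (real (Suc k)) * sqrt (real (Suc k)) \<le> sqrt (real (Suc k)) * sqrt (real (Suc (Suc k)))"
        by (intro mult_left_mono) auto
      then show ?thesis using g by (simp add: a_def add.commute)
    qed
    have a_le: "a k \<le> real k + 2" for k
    proof -
      have "sqrt (real (Suc k)) * sqrt (real (Suc (Suc k))) \<le> sqrt (real (Suc (Suc k))) * sqrt (real (Suc (Suc k)))"
        by (intro mult_right_mono) auto
      then have "a k \<le> 2 * g * (real k + 2)" using g by (simp add: a_def add.commute)
      also have "\<dots> \<le> 1 * (real k + 2)" using g by (intro mult_right_mono) auto
      finally show ?thesis by simp
    qed
    have a_pos: "0 < a k" for k using g by (simp add: a_def)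
    have gap: "c * real n \<le> a k - \<bar>b k\<bar> / 2" and a_n: "g * real n \<le> a k"
      if k: "\<bar>real k - real n\<bar> \<le> c * real n" for k
    proof -
      have kn: "(1 - c) * real n \<le> real k" using k by (simp add: abs_le_iff algebra_simps)
      have "b k = (2 - w2) * (real k - real n) + 8 * g\<^sup>2 * (real n + 1/2)"
        unfolding b_def w2 by (simp add: algebra_simps)
      moreover have "\<bar>(2 - w2) * (real k - real n)\<bar> \<le> 2 * (c * real n)"
        unfolding abs_mult using k w2 g by (intro mult_mono) (auto simp: power2_eq_square mult_le_one)
      moreover have "0 \<le> 8 * g\<^sup>2 * (real n + 1/2)" by simp
      ultimately have bk: "\<bar>b k\<bar> \<le> 2 * (c * real n) + 8 * g\<^sup>2 * (real n + 1/2)" by linarith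
      have "2 * g * ((1 - c) * real n) \<le> 2 * g * (real k + 1)" using kn g by (intro mult_left_mono) auto
      then have ak: "2 * g * real n - 2 * g * (c * real n) \<le> a k" using a_ge[of k] by (simp add: algebra_simps)
      have gc: "2 * g * (c * real n) \<le> 1 * (c * real n)" using g c by (intro mult_right_mono) auto
      have "2 * (g * real n) - 4 * (g\<^sup>2 * real n) = 2 * (2 * c) * real n"
        unfolding c2 by (simp add: power2_eq_square algebra_simps)
      then have "2 * (g * real n) - 4 * (g\<^sup>2 * real n) = 4 * (c * real n)" by simp
      moreover have "\<bar>b k\<bar> \<le> 2 * (c * real n) + 8 * (g\<^sup>2 * real n) + 4 * g\<^sup>2"
        using bk by (simp add: distrib_left)
      moreover have "2 * (g * real n) - 2 * (g * (c * real n)) \<le> a k" "2 * (g * (c * real n)) \<le> c * real n"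
        using ak gc by simp_all
      moreover have "g\<^sup>2 \<le> 1 / 4" using g power_mono[of g "1/2" 2] by (simp add: power2_eq_square)
      ultimately show "c * real n \<le> a k - \<bar>b k\<bar> / 2" using cn by linarith
      have "g * real n = 2 * g * (real n / 2)" by simp
      also have "\<dots> \<le> 2 * g * ((1 - c) * real n)" using g c npos by (intro mult_left_mono) auto
      also have "\<dots> \<le> a k" using ak by (simp add: algebra_simps)
      finally show "g * real n \<le> a k" .
    qed
    have quad: "\<bar>2 * x * y\<bar> \<le> x\<^sup>2 + y\<^sup>2" for x y :: real
      using sum_squares_bound[of x y] sum_squares_bound[of "- x" y] by (auto simp: abs_le_iff)
    have E_low: "g * c * (real n)\<^sup>2 * ((G k)\<^sup>2 + (G (Suc (Suc k)))\<^sup>2) \<le> E k"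
      and E_up: "E k \<le> 2 * (real k + 2)\<^sup>2 * ((G k)\<^sup>2 + (G (Suc (Suc k)))\<^sup>2)"
      if k: "\<bar>real k - real n\<bar> \<le> c * real n" for k
    proof -
      define s where "s = (G k)\<^sup>2 + (G (Suc (Suc k)))\<^sup>2"
      have s: "0 \<le> s" by (simp add: s_def)
      have x: "\<bar>b k * a k * G k * G (Suc (Suc k))\<bar> \<le> \<bar>b k\<bar> * a k * (s / 2)"
      proof -
        have "\<bar>b k * a k * G k * G (Suc (Suc k))\<bar> = \<bar>b k\<bar> * a k * \<bar>G k * G (Suc (Suc k))\<bar>"
          using a_pos[of k] by (simp add: abs_mult)
        also have "\<dots> \<le> \<bar>b k\<bar> * a k * (s / 2)"
          using quad[of "G k" "G (Suc (Suc k))"] a_pos[of k] by (intro mult_left_mono) (auto simp: s_def abs_mult)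
        finally show ?thesis .
      qed
      have "g * c * (real n)\<^sup>2 * s = (g * real n) * (c * real n) * s" by (simp add: power2_eq_square)
      also have "\<dots> \<le> a k * (a k - \<bar>b k\<bar> / 2) * s"
        using gap[OF k] a_n[OF k] g c npos s a_pos[of k] by (intro mult_right_mono mult_mono) auto
      also have "\<dots> = (a k)\<^sup>2 * s - \<bar>b k\<bar> * a k * (s / 2)" by (simp add: power2_eq_square algebra_simps)
      also have "\<dots> \<le> E k" using x by (simp add: E_def s_def[symmetric] abs_le_iff)
      finally show "g * c * (real n)\<^sup>2 * ((G k)\<^sup>2 + (G (Suc (Suc k)))\<^sup>2) \<le> E k" by (simp add: s_def)
      have "E k \<le> (a k)\<^sup>2 * s + \<bar>b k\<bar> * a k * (s / 2)" using x by (simp add: E_def s_def[symmetric] abs_le_iff)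
      also have "\<dots> = a k * (a k + \<bar>b k\<bar> / 2) * s" by (simp add: power2_eq_square algebra_simps)
      also have "\<dots> \<le> a k * (2 * a k) * s"
      proof -
        have "0 \<le> c * real n" using c npos by simp
        then have "a k + \<bar>b k\<bar> / 2 \<le> 2 * a k" using gap[OF k] by linarith
        then show ?thesis using a_pos[of k] s by (intro mult_right_mono mult_left_mono) auto
      qed
      also have "\<dots> = 2 * (a k)\<^sup>2 * s" by (simp add: power2_eq_square)
      also have "\<dots> \<le> 2 * (real k + 2)\<^sup>2 * s"
        using a_le[of k] a_pos[of k] s by (intro mult_right_mono mult_left_mono power_mono) auto
      finally show "E k \<le> 2 * (real k + 2)\<^sup>2 * ((G k)\<^sup>2 + (G (Suc (Suc k)))\<^sup>2)" by (simp add: s_def)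
    qed
    have E_step: "\<bar>E (Suc (Suc k)) - E k\<bar> \<le> (6 * real k + 14) * ((G k)\<^sup>2 + (G (Suc (Suc k)))\<^sup>2)" for k
    proof -
      define k' where "k' = Suc (Suc k)"
      define x where "x = G k"
      define y where "y = G k'"
      define z where "z = G (Suc (Suc k'))"
      have r: "a k' * z + a k * x = b k' * y"
        using rec[of k'] by (simp add: k'_def a_def x_def y_def z_def mult_ac)
      have bb: "b k' = b k + 2 * (2 - w2)" by (simp add: b_def k'_def field_simps)
      have "E k' = (a k')\<^sup>2 * y\<^sup>2 + a k' * z * (a k' * z - b k' * y)"
        by (simp add: E_def y_def z_def power2_eq_square algebra_simps)
      \<comment> \<open>By the recurrence \<open>a k' * z\<close> and \<open>a k * x\<close> add up
        to \<open>b k' * y\<close>, and the expression is symmetric in them. Exchanging them removes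
        \<open>z\<close> and leaves only differences of coefficients.\<close>
      also have "\<dots> = (a k')\<^sup>2 * y\<^sup>2 + (a k * x) * (a k * x - b k' * y)"
      proof -
        have z: "a k' * z = b k' * y - a k * x" using r by simp
        show ?thesis unfolding z by (simp add: algebra_simps)
      qed
      finally have "E k' - E k = ((a k')\<^sup>2 - (a k)\<^sup>2) * y\<^sup>2 - 2 * (2 - w2) * a k * x * y"
        unfolding bb by (simp add: E_def x_def y_def k'_def power2_eq_square algebra_simps)
      also have "(a k')\<^sup>2 - (a k)\<^sup>2 = 4 * g\<^sup>2 * (4 * real k + 10)"
        unfolding a_sq k'_def by (simp add: algebra_simps)
      finally have "\<bar>E k' - E k\<bar> \<le> 4 * g\<^sup>2 * (4 * real k + 10) * y\<^sup>2 + \<bar>2 * (2 - w2) * a k * x * y\<bar>"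
        using abs_triangle_ineq4[of "4 * g\<^sup>2 * (4 * real k + 10) * y\<^sup>2" "2 * (2 - w2) * a k * x * y"]
        by (simp add: abs_mult)
      also have "4 * g\<^sup>2 * (4 * real k + 10) * y\<^sup>2 \<le> 1 * (4 * real k + 10) * (x\<^sup>2 + y\<^sup>2)"
      proof (intro mult_mono)
        show "4 * g\<^sup>2 \<le> 1" using w2 by simp
      qed auto
      also have "\<bar>2 * (2 - w2) * a k * x * y\<bar> \<le> (2 * (real k + 2)) * (x\<^sup>2 + y\<^sup>2)"
      proof -
        have "\<bar>2 * (2 - w2) * a k * x * y\<bar> = ((2 - w2) * a k) * \<bar>2 * x * y\<bar>"
          using w2 a_pos[of k] g by (simp add: abs_mult)
        also have "\<dots> \<le> (2 * (real k + 2)) * (x\<^sup>2 + y\<^sup>2)"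
          using w2 a_pos[of k] a_le[of k] by (intro mult_mono quad) auto
        finally show ?thesis .
      qed
      finally show ?thesis by (simp add: k'_def x_def y_def algebra_simps)
    qed
    \<comment> \<open>The window runs from \<open>n - 2 * h\<close> to \<open>n + 2 * h\<close> in
      \<open>N = 2 * h\<close> steps of two. Its radius lies between \<open>c * n / 2\<close>, where
      \<open>m\<close> may be, and \<open>c * n\<close>, where \<open>E\<close> is
      controlled.\<close>
    define h where "h = nat \<lfloor>c * real n / 2\<rfloor>"
    have h: "2 * real h \<le> c * real n" "c * real n / 2 \<le> 2 * real h"
    proof -
      have "real h = of_int \<lfloor>c * real n / 2\<rfloor>" using c npos by (simp add: h_def)
      then show "2 * real h \<le> c * real n" "c * real n / 2 \<le> 2 * real h" using cn by linarith+
    qed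
    define N where "N = 2 * h"
    have hn: "2 * h \<le> n"
    proof -
      have "c * real n \<le> 1 * real n" using c npos by (intro mult_right_mono) auto
      then show ?thesis using h by linarith
    qed
    define p where "p = n - 2 * h"
    have p: "real p = real n - 2 * real h" using hn by (simp add: p_def)
    have range: "\<bar>real (p + 2 * i) - real n\<bar> \<le> c * real n" if "i \<le> N" for i
    proof -
      have "real i \<le> 2 * real h" using that by (simp add: N_def)
      then have "\<bar>real (p + 2 * i) - real n\<bar> \<le> 2 * real h" by (simp add: p abs_le_iff)
      then show ?thesis using h by linarith
    qed
    obtain i where i: "i \<le> N" "m = p + 2 * i"
    proof -
      have "\<bar>real m - real n\<bar> \<le> 2 * real h" using mn h by (simp add: mult.commute)
      then have le: "p \<le> m" "m \<le> p + 2 * N" using hn by (auto simp: p_def N_def abs_le_iff)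
      have "even (m - p)" using even le hn by (simp add: p_def)
      then obtain i where "m - p = 2 * i" by blast
      then show ?thesis using that[of i] le by auto
    qed
    define f where "f i = E (p + 2 * i)" for i
    have Npos: "N > 0" and DN: "2 * D \<le> real N"
      using h cn D by (auto simp: N_def)
    have nn: "real (p + 2 * i) + 2 \<le> 2 * real n" if "i \<le> N" for i
    proof -
      have "c * real n \<le> 1/2 * real n" using c npos by (intro mult_right_mono) auto
      moreover have "real (p + 2 * i) - real n \<le> c * real n"
        using range[OF that] by (simp only: abs_le_iff)
      ultimately show ?thesis using n_ge by linarith
    qed
    have "real N * f i \<le> exp (3 * D) * (\<Sum>i<N. f i)"
    proof (rule slowly_varying_le_average)
      fix i assume i: "i \<le> N"
      have "0 \<le> g * c * (real n)\<^sup>2 * ((G (p + 2 * i))\<^sup>2 + (G (Suc (Suc (p + 2 * i))))\<^sup>2)"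
        using g c by simp
      then show "0 \<le> f i" using E_low[OF range[OF i]] by (simp add: f_def)
    next
      fix i assume "i < N"
      then have i: "i \<le> N" by simp
      define s where "s = (G (p + 2 * i))\<^sup>2 + (G (Suc (Suc (p + 2 * i))))\<^sup>2"
      have "f (Suc i) = E (Suc (Suc (p + 2 * i)))" by (simp add: f_def)
      then have "\<bar>f (Suc i) - f i\<bar> \<le> (6 * real (p + 2 * i) + 14) * s"
        using E_step[of "p + 2 * i"] by (simp add: f_def s_def)
      also have "\<dots> \<le> (40 * real n) * s"
        using nn[OF i] n_ge by (intro mult_right_mono) (auto simp: s_def)
      also have "\<dots> = 40 / (g * c * real n) * (g * c * (real n)\<^sup>2 * s)"
        using g c npos by (simp add: field_simps power2_eq_square)
      also have "\<dots> \<le> 40 / (g * c * real n) * f i"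
        using E_low[OF range[OF i]] g c by (intro mult_left_mono) (auto simp: f_def s_def)
      also have "\<dots> \<le> D / real N * f i"
      proof (rule mult_right_mono)
        have "0 \<le> g * c * (real n)\<^sup>2 * s" using g c by (simp add: s_def)
        then show "0 \<le> f i" using E_low[OF range[OF i]] by (simp add: f_def s_def)
        have "real N \<le> c * real n" using h by (simp add: N_def)
        then show "40 / (g * c * real n) \<le> D / real N"
          using g c npos Npos by (simp add: D_def field_simps)
      qed
      finally show "\<bar>f (Suc i) - f i\<bar> \<le> D / real N * f i" .
    qed (use D DN Npos i in auto)
    also have "(\<Sum>i<N. f i) \<le> 16 * (real n)\<^sup>2"
    proof -
      have "(\<Sum>i<N. f i) \<le> (\<Sum>i<N. 8 * (real n)\<^sup>2 * ((G (p + 2 * i))\<^sup>2 + (G (p + 2 * i + 2))\<^sup>2))"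
      proof (rule sum_mono)
        fix i assume "i \<in> {..<N}"
        then have i: "i \<le> N" by simp
        have "f i \<le> 2 * (real (p + 2 * i) + 2)\<^sup>2 * ((G (p + 2 * i))\<^sup>2 + (G (Suc (Suc (p + 2 * i))))\<^sup>2)"
          unfolding f_def by (rule E_up[OF range[OF i]])
        also have "\<dots> \<le> 2 * (2 * real n)\<^sup>2 * ((G (p + 2 * i))\<^sup>2 + (G (Suc (Suc (p + 2 * i))))\<^sup>2)"
          using nn[OF i] by (intro mult_right_mono mult_left_mono power_mono) auto
        finally show "f i \<le> 8 * (real n)\<^sup>2 * ((G (p + 2 * i))\<^sup>2 + (G (p + 2 * i + 2))\<^sup>2)"
          by (simp add: power_mult_distrib)
      qed
      also have "\<dots> = 8 * (real n)\<^sup>2 * ((\<Sum>i<N. (G (p + 2 * i))\<^sup>2) + (\<Sum>i<N. (G (p + 2 * i + 2))\<^sup>2))"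
        unfolding sum_distrib_left[symmetric] sum.distrib ..
      also have "\<dots> \<le> 8 * (real n)\<^sup>2 * (1 + 1)"
      proof (intro mult_left_mono add_mono)
        \<comment> \<open>Distinct entries of one column, so Bessel applies; the offsets 0 and 2
          give the two values that enter \<open>E\<close>.\<close>
        have "(\<Sum>i<N. (G (p + d + 2 * i))\<^sup>2) \<le> 1" for d
        proof -
          have "(\<Sum>i<N. (G (p + d + 2 * i))\<^sup>2) = (\<Sum>k\<in>(\<lambda>i. p + d + 2 * i) ` {..<N}. (G k)\<^sup>2)"
            by (subst sum.reindex) (auto simp: inj_on_def)
          also have "\<dots> \<le> 1" unfolding G_def by (intro overlap_bessel abs_beta) auto
          finally show ?thesis .
        qed
        from this[of 0] this[of 2] show "(\<Sum>i<N. (G (p + 2 * i))\<^sup>2) \<le> 1" "(\<Sum>i<N. (G (p + 2 * i + 2))\<^sup>2) \<le> 1"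
          by (simp_all add: add_ac)
      qed auto
      finally show ?thesis by simp
    qed
    finally have fin: "real N * f i \<le> exp (3 * D) * (16 * (real n)\<^sup>2)" by simp
    have "c * real n / 2 * (g * c * (real n)\<^sup>2 * (G m)\<^sup>2) \<le> real N * f i"
    proof (rule mult_mono)
      have "g * c * (real n)\<^sup>2 * (G m)\<^sup>2 \<le> g * c * (real n)\<^sup>2 * ((G m)\<^sup>2 + (G (Suc (Suc m)))\<^sup>2)"
        using g c by (intro mult_left_mono) auto
      also have "\<dots> \<le> f i" using E_low[OF range[OF i(1)]] i(2) by (simp add: f_def)
      finally show "g * c * (real n)\<^sup>2 * (G m)\<^sup>2 \<le> f i" .
    qed (use h g c in \<open>auto simp: N_def\<close>)
    then have "c * real n / 2 * (g * c * (real n)\<^sup>2 * (G m)\<^sup>2) \<le> exp (3 * D) * (16 * (real n)\<^sup>2)"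
      using fin by linarith
    then have "(real n)\<^sup>2 * (g * c\<^sup>2 * real n * (G m)\<^sup>2) \<le> (real n)\<^sup>2 * (32 * exp (3 * D))"
      by (simp add: power2_eq_square mult_ac)
    then have "g * c\<^sup>2 * real n * (G m)\<^sup>2 \<le> 32 * exp (3 * D)"
      using npos by (simp add: mult_le_cancel_left)
    then show ?thesis using g c npos by (simp add: B_def G_def field_simps)
  qed
  have "(overlap \<beta> m n)\<^sup>2 \<le> B / real n"
    if "n \<ge> n0" "\<bar>real m - real n\<bar> \<le> c / 2 * real n" for m n
    using main[OF that] overlap_parity[OF abs_beta, of m n] B by (cases "even (m + n)") auto
  then show ?thesis using B c by (intro exI[of _ B] exI[of _ "c / 2"] exI[of _ n0]) auto
qed

section \<open>Second-order sums along a row, and small entries near the diagonal\<close>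

lemma harm_le_ln: "n \<ge> 1 \<Longrightarrow> harm n \<le> 1 + ln (real n)"
  using decseqD[OF decseq_harm_diff_ln, of 0 "n - 1"] by (cases n) (simp_all add: harm_expand)

lemma sum_inverse_distance:
  "(\<Sum>m\<in>{..2 * n} - {n}. 1 / \<bar>real m - real n\<bar>) = 2 * harm n"
proof -
  have s: "{..2 * n} - {n} = (\<lambda>k. n - k) ` {1..n} \<union> (\<lambda>k. n + k) ` {1..n}"
  proof (intro equalityI subsetI)
    fix m assume "m \<in> {..2 * n} - {n}"
    then have "m < n \<and> m = n - (n - m) \<or> n < m \<and> m \<le> 2 * n \<and> m = n + (m - n)" by auto
    then show "m \<in> (\<lambda>k. n - k) ` {1..n} \<union> (\<lambda>k. n + k) ` {1..n}"
    proof
      assume "m < n \<and> m = n - (n - m)"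
      then show ?thesis by (intro UnI1 image_eqI[of _ _ "n - m"]) auto
    next
      assume "n < m \<and> m \<le> 2 * n \<and> m = n + (m - n)"
      then show ?thesis by (intro UnI2 image_eqI[of _ _ "m - n"]) auto
    qed
  qed auto
  have "(\<Sum>m\<in>(\<lambda>k. n - k) ` {1..n}. 1 / \<bar>real m - real n\<bar>) = harm n"
    unfolding harm_def
    by (subst sum.reindex) (auto simp: inj_on_def of_nat_diff inverse_eq_divide intro!: sum.cong)
  moreover have "(\<Sum>m\<in>(\<lambda>k. n + k) ` {1..n}. 1 / \<bar>real m - real n\<bar>) = harm n"
    unfolding harm_def
    by (subst sum.reindex) (auto simp: inj_on_def inverse_eq_divide intro!: sum.cong)
  moreover have "(\<lambda>k. n - k) ` {1..n} \<inter> (\<lambda>k. n + k) ` {1..n} = {}" by auto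
  ultimately show ?thesis unfolding s by (subst sum.union_disjoint) auto
qed

text \<open>For \<open>\<bar>m - n\<bar> \<le> c * n\<close> the squares are at most
  \<open>C / n\<close> and the reciprocal distances add up to a harmonic sum, which is the source of
  the logarithm. Further out the denominators exceed \<open>c * n\<close>, and Bessel bounds the
  squares.\<close>

lemma overlap_row:
  "\<exists>C n0. C \<ge> 0 \<and> (\<forall>n\<ge>n0. \<forall>F. finite F \<longrightarrow> n \<notin> F \<longrightarrow>
     (\<Sum>m\<in>F. (overlap \<beta> m n)\<^sup>2 / \<bar>real m - real n\<bar>) \<le> C * (ln (real n) / real n))"
proof -
  obtain C c n0 where C: "C > 0" and c: "c > 0" "c \<le> 1"
    and near: "\<And>n m. n \<ge> n0 \<Longrightarrow> \<bar>real m - real n\<bar> \<le> c * real n \<Longrightarrow> (overlap \<beta> m n)\<^sup>2 \<le> C / real n"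
    using overlap_near by blast
  have "(\<Sum>m\<in>F. (overlap \<beta> m n)\<^sup>2 / \<bar>real m - real n\<bar>) \<le> (4 * C + 1 / c) * (ln (real n) / real n)"
    if n: "n \<ge> n0 + 3" and F: "finite F" "n \<notin> F" for n F
  proof -
    have npos: "0 < real n" using n by simp
    have ln1: "1 \<le> ln (real n)"
    proof -
      have "exp 1 \<le> real n" using exp_le n by linarith
      then show ?thesis using npos by (simp add: ln_ge_iff)
    qed
    define A where "A = {m \<in> F. \<bar>real m - real n\<bar> \<le> c * real n}"
    define B where "B = {m \<in> F. \<not> \<bar>real m - real n\<bar> \<le> c * real n}"
    have AB: "F = A \<union> B" "A \<inter> B = {}" "finite A" "finite B" using F by (auto simp: A_def B_def)
    have "(\<Sum>m\<in>A. (overlap \<beta> m n)\<^sup>2 / \<bar>real m - real n\<bar>) \<le> (\<Sum>m\<in>A. C / real n * (1 / \<bar>real m - real n\<bar>))"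
    proof (rule sum_mono)
      fix m assume "m \<in> A"
      then have "(overlap \<beta> m n)\<^sup>2 \<le> C / real n" using n by (intro near) (auto simp: A_def)
      then have "(overlap \<beta> m n)\<^sup>2 * (1 / \<bar>real m - real n\<bar>) \<le> C / real n * (1 / \<bar>real m - real n\<bar>)"
        by (intro mult_right_mono) auto
      then show "(overlap \<beta> m n)\<^sup>2 / \<bar>real m - real n\<bar> \<le> C / real n * (1 / \<bar>real m - real n\<bar>)"
        by (simp only: times_divide_eq_right mult_1_right)
    qed
    also have "\<dots> = C / real n * (\<Sum>m\<in>A. 1 / \<bar>real m - real n\<bar>)" by (simp add: sum_distrib_left)
    also have "\<dots> \<le> C / real n * (\<Sum>m\<in>{..2 * n} - {n}. 1 / \<bar>real m - real n\<bar>)"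
    proof (intro mult_left_mono sum_mono2)
      show "A \<subseteq> {..2 * n} - {n}"
      proof
        fix m assume "m \<in> A"
        then have m: "m \<noteq> n" "\<bar>real m - real n\<bar> \<le> c * real n" using F by (auto simp: A_def)
        have "c * real n \<le> 1 * real n" using c npos by (intro mult_right_mono) auto
        then show "m \<in> {..2 * n} - {n}" using m by (simp add: abs_le_iff)
      qed
    qed (use C in auto)
    also have "\<dots> \<le> C / real n * (2 * (2 * ln (real n)))"
      unfolding sum_inverse_distance using harm_le_ln[of n] ln1 n C
      by (intro mult_left_mono) auto
    finally have a: "(\<Sum>m\<in>A. (overlap \<beta> m n)\<^sup>2 / \<bar>real m - real n\<bar>) \<le> 4 * C * (ln (real n) / real n)"
      by (simp add: mult_ac)
    have "(\<Sum>m\<in>B. (overlap \<beta> m n)\<^sup>2 / \<bar>real m - real n\<bar>) \<le> (\<Sum>m\<in>B. (overlap \<beta> m n)\<^sup>2 * (1 / (c * real n)))"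
    proof (rule sum_mono)
      fix m assume "m \<in> B"
      then have *: "c * real n < \<bar>real m - real n\<bar>" by (simp add: B_def)
      have "0 < c * real n" using c npos by simp
      then have "1 / \<bar>real m - real n\<bar> \<le> 1 / (c * real n)"
        using * by (intro divide_left_mono mult_pos_pos[of "\<bar>real m - real n\<bar>"]) linarith+
      then show "(overlap \<beta> m n)\<^sup>2 / \<bar>real m - real n\<bar> \<le> (overlap \<beta> m n)\<^sup>2 * (1 / (c * real n))"
        using mult_left_mono[of "1 / \<bar>real m - real n\<bar>" "1 / (c * real n)" "(overlap \<beta> m n)\<^sup>2"] by simp
    qed
    also have "\<dots> = (\<Sum>m\<in>B. (overlap \<beta> m n)\<^sup>2) * (1 / (c * real n))" by (rule sum_distrib_right[symmetric])
    also have "\<dots> \<le> 1 * (1 / (c * real n))"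
      using c npos by (intro mult_right_mono overlap_bessel abs_beta AB) auto
    also have "\<dots> \<le> 1 / c * (ln (real n) / real n)"
      using ln1 c npos by (simp add: field_simps)
    finally have b: "(\<Sum>m\<in>B. (overlap \<beta> m n)\<^sup>2 / \<bar>real m - real n\<bar>) \<le> 1 / c * (ln (real n) / real n)" .
    have "(\<Sum>m\<in>F. (overlap \<beta> m n)\<^sup>2 / \<bar>real m - real n\<bar>)
      = (\<Sum>m\<in>A. (overlap \<beta> m n)\<^sup>2 / \<bar>real m - real n\<bar>) + (\<Sum>m\<in>B. (overlap \<beta> m n)\<^sup>2 / \<bar>real m - real n\<bar>)"
      unfolding AB(1) by (rule sum.union_disjoint) (use AB in auto)
    then show ?thesis unfolding distrib_right using a b by linarith
  qed
  moreover have "0 \<le> 4 * C + 1 / c" using C c by simp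
  ultimately show ?thesis by blast
qed

lemma overlap_near_diagonal_small:
  assumes "\<epsilon> > 0"
  shows "\<exists>n1. \<forall>n\<ge>n1. \<forall>i j. i \<le> n + K \<longrightarrow> n \<le> i + K \<longrightarrow> j \<le> n + K \<longrightarrow> n \<le> j + K \<longrightarrow> \<bar>overlap \<beta> i j\<bar> \<le> \<epsilon>"
proof -
  obtain C c n0 where C: "C > 0" and c: "c > 0" "c \<le> 1"
    and near: "\<And>n m. n \<ge> n0 \<Longrightarrow> \<bar>real m - real n\<bar> \<le> c * real n \<Longrightarrow> (overlap \<beta> m n)\<^sup>2 \<le> C / real n"
    using overlap_near by blast
  \<comment> \<open>\<open>overlap_near\<close> is applied in column \<open>j\<close>, which may lie
    \<open>K\<close> below \<open>n\<close>. Past \<open>M\<close> both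
    \<open>2 * K \<le> c * j\<close> and \<open>C / j \<le> \<epsilon>\<^sup>2\<close> hold.\<close>
  define M where "M = n0 + nat \<lceil>2 * real K / c\<rceil> + nat \<lceil>C / \<epsilon>\<^sup>2\<rceil> + 1"
  have "\<bar>overlap \<beta> i j\<bar> \<le> \<epsilon>" if n: "n \<ge> M + K" and ij: "i \<le> n + K" "n \<le> i + K" "j \<le> n + K" "n \<le> j + K" for n i j
  proof -
    have j: "j \<ge> n0" "real j \<ge> 2 * real K / c" "real j \<ge> C / \<epsilon>\<^sup>2" "real j > 0"
      using n ij unfolding M_def by linarith+
    have "\<bar>real i - real j\<bar> \<le> 2 * real K" using ij by (simp add: abs_le_iff)
    also have "\<dots> \<le> c * real j" using j(2) c by (simp add: field_simps)
    finally have "(overlap \<beta> i j)\<^sup>2 \<le> C / real j" by (intro near j)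
    also have "\<dots> \<le> \<epsilon>\<^sup>2" using j(3,4) assms by (simp add: field_simps)
    finally show ?thesis using assms by (metis abs_le_square_iff abs_of_pos)
  qed
  then show ?thesis by blast
qed

end

section \<open>Asymptotics of Legendre polynomials\<close>

fun legendre :: "real \<Rightarrow> nat \<Rightarrow> real" where
  "legendre x 0 = 1"
| "legendre x (Suc 0) = x"
| "legendre x (Suc (Suc n)) =
     ((2 * real n + 3) * x * legendre x (Suc n) - (real n + 1) * legendre x n) / (real n + 2)"

text \<open>The series is \<open>(1 - p X)^(-1/2)\<close>, characterised here by its differential
  equation over formal power series.\<close>

lemma central_binom_ode:
  "(1 - fps_const p * fps_X) * fps_deriv (Abs_fps (\<lambda>k. of_real (central_binom k) * p ^ k))
   = fps_const (p / 2) * Abs_fps (\<lambda>k. of_real (central_binom k) * (p::complex) ^ k)"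
proof (rule fps_ext)
  fix k
  have "2 * (of_nat (Suc k) * complex_of_real (central_binom (Suc k))) = (2 * of_nat k + 1) * of_real (central_binom k)"
  proof -
    have "2 * (real (Suc k) * central_binom (Suc k)) = (2 * real k + 1) * central_binom k"
      by (simp add: field_simps)
    then have "complex_of_real (2 * (real (Suc k) * central_binom (Suc k))) = of_real ((2 * real k + 1) * central_binom k)"
      by (rule arg_cong)
    then show ?thesis by (simp del: of_nat_Suc central_binom.simps)
  qed
  then have e: "of_nat (Suc k) * complex_of_real (central_binom (Suc k)) = (of_nat k + 1 / 2) * of_real (central_binom k)"
    by (simp add: field_simps del: of_nat_Suc central_binom.simps)
  show "fps_nth ((1 - fps_const p * fps_X) * fps_deriv (Abs_fps (\<lambda>k. of_real (central_binom k) * p ^ k))) k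
     = fps_nth (fps_const (p / 2) * Abs_fps (\<lambda>k. of_real (central_binom k) * p ^ k)) k"
  proof (cases k)
    case 0
    then show ?thesis by (simp add: left_diff_distrib mult.assoc)
  next
    case (Suc j)
    have "fps_nth ((1 - fps_const p * fps_X) * fps_deriv (Abs_fps (\<lambda>k. of_real (central_binom k) * p ^ k))) k
      = of_nat (Suc k) * complex_of_real (central_binom (Suc k)) * p ^ Suc k
        - p * (of_nat k * (of_real (central_binom k) * p ^ k))"
      unfolding Suc by (simp add: left_diff_distrib mult.assoc del: of_nat_Suc central_binom.simps)
    also have "\<dots> = p / 2 * (of_real (central_binom k) * p ^ k)"
      unfolding e by (simp add: algebra_simps)
    finally show ?thesis by simp
  qed
qed

text \<open>The generating function \<open>(1 - 2 x t + t^2)^(-1/2)\<close> with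
  \<open>x = cos \<theta>\<close> factors into \<open>(1 - p t)^(-1/2)\<close> and
  \<open>(1 - q t)^(-1/2)\<close> with \<open>p, q = cis (\<plusminus>\<theta>)\<close>. The product
  satisfies a differential equation whose coefficients are the three-term recurrence defining
  \<open>legendre\<close>.\<close>

lemma legendre_convolution:
  "of_real (legendre (cos \<theta>) n) = (\<Sum>k\<le>n. of_real (central_binom k) * cis \<theta> ^ k *
     (of_real (central_binom (n - k)) * cis (- \<theta>) ^ (n - k)))"
proof -
  define A where "A p = Abs_fps (\<lambda>k. of_real (central_binom k) * (p::complex) ^ k)" for p
  define p where "p = cis \<theta>"
  define q where "q = cis (- \<theta>)"
  define x where "x = complex_of_real (cos \<theta>)"
  define F where "F = A p * A q"
  have pq: "p * q = 1" by (simp add: p_def q_def cis_mult)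
  have pq': "p + q = 2 * x" by (simp add: p_def q_def x_def complex_eq_iff)
  have ode: "(1 - fps_const p * fps_X) * fps_deriv (A p) = fps_const (p / 2) * A p" for p
    unfolding A_def by (rule central_binom_ode)
  have "(1 - fps_const p * fps_X) * (1 - fps_const q * fps_X) * fps_deriv F
      = (1 - fps_const q * fps_X) * ((1 - fps_const p * fps_X) * fps_deriv (A p)) * A q
      + (1 - fps_const p * fps_X) * ((1 - fps_const q * fps_X) * fps_deriv (A q)) * A p"
    by (simp add: F_def algebra_simps del: fps_const_mult)
  also have "\<dots> = (fps_const (p / 2) + fps_const (q / 2) - fps_const (p * q) * fps_X) * F"
  proof -
    have "fps_const (p * q) = fps_const q * fps_const (p / 2) + fps_const p * fps_const (q / 2)"
      by simp
    then show ?thesis unfolding ode F_def by (simp only: algebra_simps) (simp only: mult_ac add_ac mult_1)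
  qed
  also have "(1 - fps_const p * fps_X) * (1 - fps_const q * fps_X)
      = 1 - fps_const (p + q) * fps_X + fps_const (p * q) * fps_X * fps_X"
    by (simp add: algebra_simps flip: fps_const_mult fps_const_add)
  also have "fps_const (p / 2) + fps_const (q / 2) = fps_const x"
    using pq' by (simp add: field_simps)
  finally have eq: "(1 - fps_const (2 * x) * fps_X + fps_X * fps_X) * fps_deriv F = (fps_const x - fps_X) * F"
    by (simp add: pq pq')
  have coef: "of_nat (n + 2) * fps_nth F (n + 2) = (2 * of_nat n + 3) * x * fps_nth F (n + 1) - (of_nat n + 1) * fps_nth F n" for n
  proof -
    have "fps_nth ((1 - fps_const (2 * x) * fps_X + fps_X * fps_X) * fps_deriv F) (n + 1)
      = of_nat (n + 2) * fps_nth F (n + 2) - 2 * x * (of_nat (n + 1) * fps_nth F (n + 1)) + of_nat n * fps_nth F n"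
      by (cases n) (simp_all add: distrib_right left_diff_distrib mult.assoc)
    moreover have "fps_nth ((fps_const x - fps_X) * F) (n + 1) = x * fps_nth F (n + 1) - fps_nth F n"
      by (simp add: left_diff_distrib)
    ultimately have "of_nat (n + 2) * fps_nth F (n + 2) - 2 * x * (of_nat (n + 1) * fps_nth F (n + 1)) + of_nat n * fps_nth F n
       = x * fps_nth F (n + 1) - fps_nth F n" unfolding eq by simp
    then show ?thesis by (simp add: algebra_simps)
  qed
  have "fps_nth F n = of_real (legendre (cos \<theta>) n)"
  proof (induct n rule: less_induct)
    case (less n)
    consider "n = 0" | "n = 1" | m where "n = m + 2"
      by (metis One_nat_def add_2_eq_Suc' not0_implies_Suc)
    then show ?case
    proof cases
      case 1
      then show ?thesis by (simp add: F_def A_def)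
    next
      case 2
      then have "fps_nth F n = (p + q) / 2" by (simp add: F_def A_def fps_mult_nth add_divide_distrib)
      then show ?thesis using 2 by (simp add: pq' x_def)
    next
      case 3
      have nz: "(of_nat m + 2 :: complex) \<noteq> 0"
        using of_nat_neq_0[of "Suc m", where ?'a = complex] by (simp add: add.commute)
      have "(of_nat m + 2) * fps_nth F n = (of_nat m + 2) * of_real (legendre (cos \<theta>) n)"
        using coef[of m] less[of "m + 1"] less[of m] nz
        by (simp add: 3 x_def) (simp add: field_simps)
      then show ?thesis using nz by simp
    qed
  qed
  then show ?thesis
    by (simp add: F_def A_def fps_mult_nth p_def q_def atLeast0AtMost)
qed

section \<open>Size and monotonicity of central binomial coefficients\<close>

lemma central_binom_ratio_le_1: "(2 * real k + 1) * (2 * real k + 3) / (2 * real k + 2)\<^sup>2 \<le> 1"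
  by (subst divide_le_eq_1_pos) (simp, simp add: power2_eq_square algebra_simps)

lemma central_binom_sq_le: "(central_binom k)\<^sup>2 * (2 * real k + 1) \<le> 1"
proof (induct k)
  case (Suc k)
  have "(central_binom (Suc k))\<^sup>2 * (2 * real (Suc k) + 1)
      = (central_binom k)\<^sup>2 * (2 * real k + 1) * ((2 * real k + 1) * (2 * real k + 3) / (2 * real k + 2)\<^sup>2)"
    by (simp add: power_mult_distrib power_divide) (simp add: power2_eq_square algebra_simps)
  also have "\<dots> \<le> 1 * 1"
    by (intro mult_mono Suc central_binom_ratio_le_1) auto
  finally show ?case by simp
qed simp

lemma central_binom_le: "central_binom k \<le> 1 / sqrt (2 * real k + 1)"
proof -
  have "central_binom k \<le> sqrt (1 / (2 * real k + 1))"
    using central_binom_sq_le[of k] by (intro real_le_rsqrt) (simp add: field_simps)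
  then show ?thesis by (simp add: real_sqrt_divide)
qed

lemma sum_central_binom: "(\<Sum>k\<le>m. central_binom k) = (2 * real m + 1) * central_binom m"
  by (induct m) (simp_all add: field_simps)

lemma central_binom_Suc_diff: "central_binom k - central_binom (Suc k) = central_binom k / (2 * real k + 2)"
  by (simp add: field_simps)

lemma central_binom_antimono: "i \<le> j \<Longrightarrow> central_binom j \<le> central_binom i"
proof (rule lift_Suc_antimono_le)
  fix k
  have "0 \<le> central_binom k / (2 * real k + 2)" using central_binom_pos[of k] by simp
  then show "central_binom (Suc k) \<le> central_binom k" using central_binom_Suc_diff[of k] by linarith
qed

text \<open>\<open>(central_binom k)\<^sup>2 * (2 * k + 1)\<close> decreases and
  \<open>(central_binom k)\<^sup>2 * (2 * k)\<close> increases, both to \<open>2 / pi\<close> by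
  Wallis' product; each bound is one of these monotone limits.\<close>

lemma central_binom_wallis:
  assumes n: "n \<ge> 1"
  shows "1 / sqrt (pi * (real n + 1 / 2)) \<le> central_binom n" "central_binom n \<le> 1 / sqrt (pi * real n)"
proof -
  define u where "u k = (central_binom k)\<^sup>2 * (2 * real k + 1)" for k
  define v where "v k = (central_binom k)\<^sup>2 * (2 * real k)" for k
  have pos: "0 < central_binom k" for k by (rule central_binom_pos)
  have u_wallis: "u n = 1 / (\<Prod>k=1..n. (4 * real k^2) / (4 * real k^2 - 1))" for n
  proof (induct n)
    case (Suc n)
    have "u (Suc n) = u n * ((2 * real n + 1) * (2 * real n + 3) / (2 * real n + 2)\<^sup>2)"
      by (simp add: u_def power_mult_distrib power_divide) (simp add: power2_eq_square algebra_simps)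
    also have "(2 * real n + 1) * (2 * real n + 3) / (2 * real n + 2)\<^sup>2
       = 1 / (4 * real (Suc n)^2 / (4 * real (Suc n)^2 - 1))"
      by (simp add: power2_eq_square algebra_simps)
    finally show ?case unfolding Suc by simp
  qed (simp add: u_def)
  have "(\<lambda>n. 1 / (\<Prod>k=1..n. (4 * real k^2) / (4 * real k^2 - 1))) \<longlonglongrightarrow> 1 / (pi / 2)"
    by (intro tendsto_divide tendsto_const wallis) simp
  then have u_lim: "u \<longlonglongrightarrow> 2 / pi" by (simp add: u_wallis[abs_def])
  have u_dec: "decseq u"
  proof (rule decseq_SucI)
    fix k
    have "u (Suc k) = u k * ((2 * real k + 1) * (2 * real k + 3) / (2 * real k + 2)\<^sup>2)"
      by (simp add: u_def power_mult_distrib power_divide) (simp add: power2_eq_square algebra_simps)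
    also have "\<dots> \<le> u k * 1"
      by (intro mult_left_mono central_binom_ratio_le_1) (simp add: u_def)
    finally show "u (Suc k) \<le> u k" by simp
  qed
  have v_inc: "incseq v"
  proof (rule incseq_SucI)
    fix k
    have "v (Suc k) = (central_binom k)\<^sup>2 * ((2 * real k + 1)\<^sup>2 / (2 * real k + 2))"
    proof -
      have "(a * (x / q))\<^sup>2 * q = a\<^sup>2 * (x\<^sup>2 / q)" if "q \<noteq> 0" for a x q :: real
        using that by (simp add: power_mult_distrib power_divide power2_eq_square)
      from this[of "2 * real k + 2" "central_binom k" "2 * real k + 1"]
      show ?thesis by (simp add: v_def add.commute)
    qed
    moreover have "2 * real k \<le> (2 * real k + 1)\<^sup>2 / (2 * real k + 2)"
      by (simp add: le_divide_eq power2_eq_square algebra_simps)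
    then have "v k \<le> (central_binom k)\<^sup>2 * ((2 * real k + 1)\<^sup>2 / (2 * real k + 2))"
      unfolding v_def by (rule mult_left_mono) simp
    ultimately show "v k \<le> v (Suc k)" by simp
  qed
  have v_lim: "v \<longlonglongrightarrow> 2 / pi"
  proof -
    have "(\<lambda>k. u k * (2 * real k / (2 * real k + 1))) \<longlonglongrightarrow> 2 / pi * 1"
    proof (intro tendsto_mult u_lim)
      have "(\<lambda>k. 1 - inverse (real (Suc (2 * k)))) \<longlonglongrightarrow> 1 - 0"
        using LIMSEQ_subseq_LIMSEQ[OF LIMSEQ_inverse_real_of_nat, of "\<lambda>k. 2 * k"]
        by (intro tendsto_diff tendsto_const) (simp add: strict_mono_def o_def)
      moreover have "1 - inverse (real (Suc (2 * k))) = 2 * real k / (2 * real k + 1)" for k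
        by (simp add: field_simps)
      ultimately show "(\<lambda>k. 2 * real k / (2 * real k + 1)) \<longlonglongrightarrow> 1" by simp
    qed
    moreover have "u k * (2 * real k / (2 * real k + 1)) = v k" for k
      by (simp add: u_def v_def)
    ultimately show ?thesis by simp
  qed
  have "2 / pi \<le> u n" by (rule decseq_ge[OF u_dec u_lim])
  then have "2 \<le> u n * pi" by (simp add: pos_divide_le_eq[OF pi_gt_zero])
  then have "1 \<le> (central_binom n)\<^sup>2 * (pi * (real n + 1 / 2))"
    by (simp add: u_def algebra_simps)
  moreover have "0 < pi * (real n + 1 / 2)" by simp
  ultimately have "1 / (pi * (real n + 1 / 2)) \<le> (central_binom n)\<^sup>2"
    by (simp only: pos_divide_le_eq)
  then have "sqrt (1 / (pi * (real n + 1 / 2))) \<le> central_binom n"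
    using pos[of n] by (intro real_le_lsqrt) auto
  then show "1 / sqrt (pi * (real n + 1 / 2)) \<le> central_binom n" by (simp add: real_sqrt_divide)
  have "v n \<le> 2 / pi" by (rule incseq_le[OF v_inc v_lim])
  then have "(central_binom n)\<^sup>2 \<le> 1 / (pi * real n)"
    using pi_gt_zero n by (simp add: v_def field_simps)
  then have "central_binom n \<le> sqrt (1 / (pi * real n))" by (intro real_le_rsqrt)
  then show "central_binom n \<le> 1 / sqrt (pi * real n)" by (simp add: real_sqrt_divide)
qed

section \<open>Abel summation and the binomial series on the unit circle\<close>

lemma abel_summation_bound:
  fixes w :: complex and d :: "nat \<Rightarrow> real"
  assumes w: "norm w \<le> 1" "w \<noteq> 1"
  shows "norm (\<Sum>k<m. of_real (d k) * w ^ k)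
     \<le> 2 / norm (1 - w) * (\<bar>d m\<bar> + (\<Sum>k<m. \<bar>d k - d (Suc k)\<bar>))"
proof -
  define W where "W k = (\<Sum>j<k. w ^ j)" for k
  have W: "norm (W k) \<le> 2 / norm (1 - w)" for k
  proof -
    have "W k = (1 - w ^ k) / (1 - w)" unfolding W_def by (rule sum_gp_strict[THEN trans]) (use w in simp)
    moreover have "norm (1 - w ^ k) \<le> 2"
      using norm_triangle_ineq4[of 1 "w ^ k"] power_le_one[of "norm w" k] w by (simp add: norm_power)
    ultimately show ?thesis by (simp add: norm_divide divide_right_mono)
  qed
  have "(\<Sum>k<m. of_real (d k) * w ^ k) = of_real (d m) * W m + (\<Sum>k<m. of_real (d k - d (Suc k)) * W (Suc k))"
    by (induct m) (simp_all add: W_def algebra_simps)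
  also have "norm \<dots> \<le> \<bar>d m\<bar> * norm (W m) + (\<Sum>k<m. \<bar>d k - d (Suc k)\<bar> * norm (W (Suc k)))"
    by (rule order_trans[OF norm_triangle_ineq])
       (intro add_mono order_trans[OF norm_sum] sum_mono, simp_all only: norm_mult norm_of_real order_refl)
  also have "\<dots> \<le> \<bar>d m\<bar> * (2 / norm (1 - w)) + (\<Sum>k<m. \<bar>d k - d (Suc k)\<bar> * (2 / norm (1 - w)))"
    by (intro add_mono sum_mono mult_left_mono W) auto
  finally show ?thesis by (simp add: distrib_left sum_distrib_left mult_ac)
qed

lemma abs_sum_diff_antimono:
  fixes d :: "nat \<Rightarrow> real"
  assumes "\<And>k. d (Suc k) \<le> d k"
  shows "(\<Sum>k<m. \<bar>d k - d (Suc k)\<bar>) = d 0 - d m"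
  by (simp add: abs_of_nonneg assms sum_lessThan_telescope')

lemma cis_double_neq_1:
  assumes "0 < \<theta>" "\<theta> < pi / 2"
  shows "0 < sin (2 * \<theta>)"
  using assms by (intro sin_gt_zero) auto

text \<open>Partial sums of the binomial series on its circle of convergence, reached as limits from the
  interior; Abel summation makes the tail estimate uniform in the radius.\<close>

lemma binomial_series_circle:
  assumes \<theta>: "0 < \<theta>" "\<theta> < pi / 2"
  shows "norm ((\<Sum>k<N. of_real (central_binom k) * cis (2 * \<theta>) ^ k) - (1 - cis (2 * \<theta>)) powr (- 1 / 2))
     \<le> 8 / sin (2 * \<theta>) * central_binom N"
proof -
  define w where "w = cis (2 * \<theta>)"
  define \<delta> where "\<delta> = sin (2 * \<theta>)"
  have \<delta>: "0 < \<delta>" unfolding \<delta>_def by (rule cis_double_neq_1[OF \<theta>])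
  have tail: "norm ((\<Sum>k<N. of_real (central_binom k) * (of_real r * w) ^ k) - (1 - of_real r * w) powr (- 1 / 2))
     \<le> 8 / \<delta> * central_binom N" if r: "1/2 \<le> r" "r < 1" for r
  proof -
    define x where "x = of_real r * w"
    have nx: "norm x < 1" using r by (simp add: x_def w_def norm_mult)
    \<comment> \<open>The imaginary part keeps \<open>x\<close> away from 1 for all radii at once:
      \<open>r \<ge> 1 / 2\<close> gives distance at least \<open>\<delta> / 2\<close>.\<close>
    have "r * \<delta> = \<bar>Im (1 - x)\<bar>" using r \<delta> by (simp add: x_def w_def \<delta>_def)
    also have "\<dots> \<le> norm (1 - x)" by (rule abs_Im_le_cmod)
    finally have "r * \<delta> \<le> norm (1 - x)" .
    moreover have "1 / 2 * \<delta> \<le> r * \<delta>" using r \<delta> by (intro mult_right_mono) auto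
    ultimately have d: "\<delta> / 2 \<le> norm (1 - x)" by linarith
    have "x \<noteq> 1" using d \<delta> by auto
    have "(\<lambda>k. ((- 1 / 2) gchoose k) * (- x) ^ k) sums (1 + - x) powr (- 1 / 2)"
      using nx by (intro gen_binomial_complex) auto
    moreover have "((- 1 / 2) gchoose k) * (- x) ^ k = of_real (central_binom k) * x ^ k" for k
      using central_binom_gbinomial[of k, where ?'a = complex]
      by (simp add: power_minus[of x] mult_ac del: central_binom.simps)
    ultimately have ser: "(\<lambda>k. of_real (central_binom k) * x ^ k) sums (1 - x) powr (- 1 / 2)" by simp
    have part: "norm (\<Sum>k<m. of_real (central_binom (k + N)) * x ^ k) \<le> 4 / \<delta> * central_binom N" for m
    proof -
      have "norm (\<Sum>k<m. of_real (central_binom (k + N)) * x ^ k)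
        \<le> 2 / norm (1 - x) * (\<bar>central_binom (m + N)\<bar> + (\<Sum>k<m. \<bar>central_binom (k + N) - central_binom (Suc k + N)\<bar>))"
        by (rule abel_summation_bound) (use nx \<open>x \<noteq> 1\<close> in auto)
      also have "(\<Sum>k<m. \<bar>central_binom (k + N) - central_binom (Suc k + N)\<bar>) = central_binom (0 + N) - central_binom (m + N)"
        by (rule abs_sum_diff_antimono) (rule central_binom_antimono, simp)
      also have "2 / norm (1 - x) * (\<bar>central_binom (m + N)\<bar> + (central_binom (0 + N) - central_binom (m + N)))
         = 2 / norm (1 - x) * central_binom N"
        using central_binom_pos[of "m + N"] by simp
      also have "\<dots> \<le> 2 / (\<delta> / 2) * central_binom N"
      proof -
        have "0 < norm (1 - x)" using d \<delta> by linarith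
        then show ?thesis
          using d \<delta> central_binom_pos[of N] by (intro mult_right_mono divide_left_mono mult_pos_pos) auto
      qed
      finally show ?thesis by simp
    qed
    have "(\<lambda>k. of_real (central_binom (k + N)) * x ^ (k + N)) sums
        ((1 - x) powr (- 1 / 2) - (\<Sum>k<N. of_real (central_binom k) * x ^ k))"
      using sums_iff_shift[of "\<lambda>k. of_real (central_binom k) * x ^ k" N] ser by (simp add: algebra_simps)
    then have "(\<lambda>m. norm (\<Sum>k<m. of_real (central_binom (k + N)) * x ^ (k + N))) \<longlonglongrightarrow>
        norm ((1 - x) powr (- 1 / 2) - (\<Sum>k<N. of_real (central_binom k) * x ^ k))"
      unfolding sums_def by (intro tendsto_norm)
    then have "norm ((1 - x) powr (- 1 / 2) - (\<Sum>k<N. of_real (central_binom k) * x ^ k)) \<le> 4 / \<delta> * central_binom N"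
    proof (rule LIMSEQ_le_const2, intro exI allI impI)
      fix m :: nat
      have "norm (\<Sum>k<m. of_real (central_binom (k + N)) * x ^ (k + N))
        = norm (x ^ N) * norm (\<Sum>k<m. of_real (central_binom (k + N)) * x ^ k)"
        unfolding norm_mult[symmetric] sum_distrib_left by (simp add: power_add mult_ac)
      also have "\<dots> \<le> 1 * (4 / \<delta> * central_binom N)"
        using nx by (intro mult_mono part) (auto simp: norm_power power_le_one)
      finally show "norm (\<Sum>k<m. of_real (central_binom (k + N)) * x ^ (k + N)) \<le> 4 / \<delta> * central_binom N" by simp
    qed
    also have "\<dots> \<le> 8 / \<delta> * central_binom N"
      using \<delta> central_binom_pos[of N] by (intro mult_right_mono divide_right_mono) auto
    finally show ?thesis by (simp add: x_def norm_minus_commute)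
  qed
  define r where "r j = 1 - 1 / real (j + 2)" for j
  have r: "1/2 \<le> r j" "r j < 1" for j by (auto simp: r_def field_simps)
  have r_lim: "(\<lambda>j. r j) \<longlonglongrightarrow> 1"
  proof -
    have "(\<lambda>j. 1 - 1 / real (j + 2)) \<longlonglongrightarrow> 1 - 0"
      by (intro tendsto_diff tendsto_const LIMSEQ_ignore_initial_segment[OF lim_1_over_n])
    then show ?thesis by (simp add: r_def[abs_def])
  qed
  have rw: "(\<lambda>j. of_real (r j) * w) \<longlonglongrightarrow> w"
    using tendsto_mult[OF tendsto_of_real[OF r_lim] tendsto_const[of w]] by simp
  \<comment> \<open>The limit of the radii needs continuity of the principal branch at
    \<open>1 - w\<close>; its imaginary part is nonzero, so it avoids the cut.\<close>
  have not_neg: "1 - w \<notin> \<real>\<^sub>\<le>\<^sub>0"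
    using \<delta> by (auto simp: w_def \<delta>_def complex_nonpos_Reals_iff)
  have "(\<lambda>j. norm ((\<Sum>k<N. of_real (central_binom k) * (of_real (r j) * w) ^ k) - (1 - of_real (r j) * w) powr (- 1 / 2)))
     \<longlonglongrightarrow> norm ((\<Sum>k<N. of_real (central_binom k) * w ^ k) - (1 - w) powr (- 1 / 2))"
    by (intro tendsto_intros rw disjI1[OF not_neg])
  then show ?thesis
    unfolding w_def[symmetric] \<delta>_def[symmetric]
    by (rule LIMSEQ_le_const2) (intro exI allI impI tail r)
qed

text \<open>\<open>1 - cis (2 * \<theta>)\<close> has modulus \<open>2 * sin \<theta>\<close> and
  argument \<open>\<theta> - pi / 2\<close>. This argument is in the principal range, so the power
  can be read off.\<close>

lemma one_minus_cis_powr: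
  assumes "0 < \<theta>" "\<theta> < pi / 2"
  shows "(1 - cis (2 * \<theta>)) powr (- 1 / 2) = of_real (1 / sqrt (2 * sin \<theta>)) * cis (pi / 4 - \<theta> / 2)"
proof -
  have s: "0 < sin \<theta>" using assms by (intro sin_gt_zero) auto
  define z where "z = Complex (ln (2 * sin \<theta>)) (\<theta> - pi / 2)"
  have expz: "exp z = 1 - cis (2 * \<theta>)"
    using s by (simp add: z_def exp_eq_polar complex_eq_iff cos_diff sin_diff cos_double sin_double
      sin_squared_eq power2_eq_square[symmetric] mult.assoc)
  have "Ln (1 - cis (2 * \<theta>)) = z"
    by (rule Ln_unique[OF expz]) (use assms in \<open>simp_all add: z_def\<close>)
  moreover have "1 - cis (2 * \<theta>) \<noteq> 0" using expz exp_not_eq_zero by metis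
  ultimately have "(1 - cis (2 * \<theta>)) powr (- 1 / 2) = exp (- z / 2)"
    by (simp add: powr_def)
  also have "\<dots> = of_real (exp (- ln (2 * sin \<theta>) / 2)) * cis (pi / 4 - \<theta> / 2)"
    by (simp add: exp_eq_polar z_def diff_divide_distrib)
  also have "exp (- ln (2 * sin \<theta>) / 2) = 1 / sqrt (2 * sin \<theta>)"
  proof -
    have "exp (ln (2 * sin \<theta>) / 2) = sqrt (2 * sin \<theta>)"
      using s by (simp flip: powr_half_sqrt add: powr_def)
    then show ?thesis by (simp add: exp_minus inverse_eq_divide)
  qed
  finally show ?thesis .
qed

text \<open>For \<open>k\<close> up to about \<open>n / 2\<close> the factor
  \<open>central_binom (n - k)\<close> is nearly constant and is frozen at
  \<open>central_binom n\<close>. The coefficients \<open>d\<close> of the error start at 0 and have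
  total variation \<open>O(1/n)\<close>, so Abel summation costs \<open>O(1/n)\<close>. What remains
  is a truncated binomial series with error \<open>O(1 / sqrt n)\<close>, multiplied by a factor of
  the same size.\<close>

lemma legendre_half_sum:
  assumes \<theta>: "0 < \<theta>" "\<theta> < pi / 2" and n: "n \<ge> 2" and r: "r \<le> n" "real n / 2 \<le> real r" "real r \<le> real n / 2 + 1"
  shows "norm ((\<Sum>k<r. of_real (central_binom k * central_binom (n - k)) * cis (2 * \<theta>) ^ k)
      - of_real (central_binom n) * (1 - cis (2 * \<theta>)) powr (- 1 / 2)) \<le> (40 / sin (2 * \<theta>)) / real n"
proof -
  define w where "w = cis (2 * \<theta>)"
  define \<delta> where "\<delta> = sin (2 * \<theta>)"
  define L where "L = (1 - w) powr (- 1 / 2)"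
  have \<delta>: "0 < \<delta>" unfolding \<delta>_def by (rule cis_double_neq_1[OF \<theta>])
  define a where "a = central_binom"
  have a0: "0 \<le> a k" for k using central_binom_pos[of k] by (simp add: a_def)
  define d where "d k = a k * (a (n - k) - a n)" for k
  \<comment> \<open>Bounds one decrement \<open>a j / (2 * j + 2)\<close> when
    \<open>2 * j + 2 \<ge> n\<close>: there \<open>a j \<le> 2 / sqrt n\<close>.\<close>
  define \<eta> where "\<eta> = 2 / (real n * sqrt (real n))"
  have npos: "0 < real n" using n by simp
  have sn: "sqrt (real n) * sqrt (real n) = real n" "0 < sqrt (real n)" using npos by simp_all
  have a_small: "a j \<le> 1 / sqrt (real n)" if "real n \<le> 2 * real j + 1" for j
  proof -
    have "a j \<le> 1 / sqrt (2 * real j + 1)" unfolding a_def by (rule central_binom_le)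
    also have "\<dots> \<le> 1 / sqrt (real n)" using that npos by (intro divide_left_mono) auto
    finally show ?thesis .
  qed
  have step: "\<bar>a j - a (Suc j)\<bar> \<le> \<eta>" if "real n \<le> 2 * real j + 2" for j
  proof -
    have "real n / 4 \<le> 2 * real j + 1" using that n by linarith
    then have "sqrt (real n) / 2 \<le> sqrt (2 * real j + 1)"
      by (intro real_le_rsqrt) (simp add: power_divide)
    then have "1 / sqrt (2 * real j + 1) \<le> 1 / (sqrt (real n) / 2)"
      using sn by (intro divide_left_mono) auto
    then have "a j \<le> 2 / sqrt (real n)" using central_binom_le[of j] by (simp add: a_def)
    then have "a j / (2 * real j + 2) \<le> (2 / sqrt (real n)) / real n"
      using that npos a0[of j] by (intro frac_le) auto
    moreover have "\<bar>a j - a (Suc j)\<bar> = a j / (2 * real j + 2)"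
      using a0[of j] unfolding a_def central_binom_Suc_diff by simp
    ultimately show ?thesis by (simp add: \<eta>_def mult.commute)
  qed
  have far: "\<bar>a (n - k) - a n\<bar> \<le> real k * \<eta>" if "k \<le> r" for k
    using that
  proof (induct k)
    case (Suc k)
    have e: "n - k = Suc (n - Suc k)" using Suc.prems r by simp
    have "\<bar>a (n - Suc k) - a (Suc (n - Suc k))\<bar> \<le> \<eta>"
      using Suc.prems r by (intro step) (simp add: of_nat_diff)
    then show ?case using Suc unfolding e[symmetric] by (simp add: distrib_right)
  qed simp
  have \<eta>: "0 \<le> \<eta>" by (simp add: \<eta>_def)
  have d_step: "\<bar>d k - d (Suc k)\<bar> \<le> 2 * \<eta> * a k" if "k < r" for k
  proof -
    have e: "n - k = Suc (n - Suc k)" using that r by simp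
    have "d (Suc k) - d k = a (Suc k) * (a (n - Suc k) - a (n - k)) - (a k - a (Suc k)) * (a (n - k) - a n)"
      by (simp add: d_def algebra_simps)
    then have "\<bar>d (Suc k) - d k\<bar> \<le> a (Suc k) * \<bar>a (n - Suc k) - a (n - k)\<bar> + \<bar>a k - a (Suc k)\<bar> * \<bar>a (n - k) - a n\<bar>"
      using abs_triangle_ineq4[of "a (Suc k) * (a (n - Suc k) - a (n - k))" "(a k - a (Suc k)) * (a (n - k) - a n)"]
        a0[of "Suc k"] by (simp add: abs_mult)
    also have "a (Suc k) * \<bar>a (n - Suc k) - a (n - k)\<bar> \<le> a k * \<eta>"
    proof (intro mult_mono a0)
      show "a (Suc k) \<le> a k" unfolding a_def by (rule central_binom_antimono) simp
      show "\<bar>a (n - Suc k) - a (n - k)\<bar> \<le> \<eta>"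
        unfolding e using that r by (intro step) (simp add: of_nat_diff)
    qed auto
    \<comment> \<open>The accumulated deviation grows like \<open>k * \<eta>\<close>, but the
      decrement carries a factor \<open>1 / (2 * k + 2)\<close>, so the product is again at most
      \<open>a k * \<eta>\<close>.\<close>
    also have "\<bar>a k - a (Suc k)\<bar> * \<bar>a (n - k) - a n\<bar> \<le> a k / (2 * real k + 2) * (real k * \<eta>)"
    proof (intro mult_mono far)
      show "\<bar>a k - a (Suc k)\<bar> \<le> a k / (2 * real k + 2)"
        using a0[of k] unfolding a_def central_binom_Suc_diff by simp
    qed (use that a0[of k] in auto)
    also have "\<dots> \<le> a k * \<eta>"
    proof -
      have "a k * \<eta> * (real k / (2 * real k + 2)) \<le> a k * \<eta> * 1"
        using a0[of k] \<eta> by (intro mult_left_mono) (auto simp: field_simps)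
      then show ?thesis by (simp add: mult_ac)
    qed
    finally show ?thesis by (simp add: abs_minus_commute)
  qed
  have var: "(\<Sum>k<r. \<bar>d k - d (Suc k)\<bar>) \<le> 8 / real n"
  proof -
    have "(\<Sum>k<r. \<bar>d k - d (Suc k)\<bar>) \<le> (\<Sum>k<r. 2 * \<eta> * a k)" by (intro sum_mono d_step) auto
    also have "\<dots> = 2 * \<eta> * (\<Sum>k<r. a k)" by (simp add: sum_distrib_left)
    also have "(\<Sum>k<r. a k) \<le> (\<Sum>k\<le>r. a k)" using a0 by (intro sum_mono2) auto
    also have "(\<Sum>k\<le>r. a k) = (2 * real r + 1) * a r" unfolding a_def by (rule sum_central_binom)
    also have "\<dots> \<le> (2 * real r + 1) * (1 / sqrt (2 * real r + 1))"
      unfolding a_def by (intro mult_left_mono central_binom_le) auto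
    also have "\<dots> = sqrt (2 * real r + 1)" by (simp add: real_div_sqrt)
    also have "\<dots> \<le> 2 * sqrt (real n)"
      using r n by (intro real_le_lsqrt) (auto simp: power_mult_distrib)
    finally have "(\<Sum>k<r. \<bar>d k - d (Suc k)\<bar>) \<le> 2 * \<eta> * (2 * sqrt (real n))"
      using \<eta> by (simp add: mult_left_mono)
    also have "\<dots> = 8 / real n" using sn npos by (simp add: \<eta>_def field_simps)
    finally show ?thesis .
  qed
  have d_r: "\<bar>d r\<bar> \<le> 8 / real n"
  proof -
    have "d 0 - d r = (\<Sum>k<r. d k - d (Suc k))" by (simp add: sum_lessThan_telescope')
    also have "\<bar>\<dots>\<bar> \<le> (\<Sum>k<r. \<bar>d k - d (Suc k)\<bar>)" by (rule sum_abs)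
    finally show ?thesis using var by (simp add: d_def)
  qed
  have w1: "\<delta> \<le> norm (1 - w)"
    using abs_Im_le_cmod[of "1 - w"] \<delta> by (simp add: w_def \<delta>_def)
  have "norm (\<Sum>k<r. of_real (d k) * w ^ k) \<le> 2 / norm (1 - w) * (\<bar>d r\<bar> + (\<Sum>k<r. \<bar>d k - d (Suc k)\<bar>))"
    by (rule abel_summation_bound) (use w1 \<delta> in \<open>auto simp: w_def\<close>)
  also have "\<dots> \<le> 2 / \<delta> * (8 / real n + 8 / real n)"
    using w1 \<delta> by (intro mult_mono add_mono var d_r divide_left_mono mult_pos_pos add_nonneg_nonneg sum_nonneg) auto
  finally have b1: "norm (\<Sum>k<r. of_real (d k) * w ^ k) \<le> 32 / \<delta> / real n" by simp
  have "norm (of_real (a n) * ((\<Sum>k<r. of_real (a k) * w ^ k) - L)) = a n * norm ((\<Sum>k<r. of_real (a k) * w ^ k) - L)"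
    using a0[of n] by (simp add: norm_mult)
  also have "\<dots> \<le> (1 / sqrt (real n)) * (8 / \<delta> * (1 / sqrt (real n)))"
  proof (intro mult_mono a_small)
    have "norm ((\<Sum>k<r. of_real (a k) * w ^ k) - L) \<le> 8 / \<delta> * a r"
      unfolding a_def L_def w_def \<delta>_def by (rule binomial_series_circle[OF \<theta>])
    also have "\<dots> \<le> 8 / \<delta> * (1 / sqrt (real n))" using \<delta> r by (intro mult_left_mono a_small) auto
    finally show "norm ((\<Sum>k<r. of_real (a k) * w ^ k) - L) \<le> 8 / \<delta> * (1 / sqrt (real n))" .
  qed auto
  also have "\<dots> = 8 / \<delta> / real n" using sn npos \<delta> by (simp add: field_simps)
  finally have b2: "norm (of_real (a n) * ((\<Sum>k<r. of_real (a k) * w ^ k) - L)) \<le> 8 / \<delta> / real n" .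
  have "(\<Sum>k<r. of_real (a k * a (n - k)) * w ^ k) - of_real (a n) * L
     = (\<Sum>k<r. of_real (d k) * w ^ k) + of_real (a n) * ((\<Sum>k<r. of_real (a k) * w ^ k) - L)"
    by (simp add: d_def sum_distrib_left right_diff_distrib left_diff_distrib sum_subtractf mult_ac)
  also have "norm \<dots> \<le> 32 / \<delta> / real n + 8 / \<delta> / real n"
    by (rule order_trans[OF norm_triangle_ineq add_mono[OF b1 b2]])
  also have "\<dots> = 40 / \<delta> / real n" by (simp add: add_divide_distrib[symmetric])
  finally show ?thesis by (simp add: a_def w_def L_def \<delta>_def)
qed

text \<open>The terms \<open>k\<close> and \<open>n - k\<close> of the convolution are complex
  conjugates, so the sum is a half sum plus the conjugate of another. Each has the same leading
  term, and adding the conjugate turns its phase into a cosine.\<close>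

theorem legendre_asymptotics:
  assumes \<theta>: "0 < \<theta>" "\<theta> < pi / 2"
  shows "\<exists>C. \<forall>n\<ge>2. \<bar>legendre (cos \<theta>) n
     - sqrt (2 / (pi * real n * sin \<theta>)) * cos ((real n + 1 / 2) * \<theta> - pi / 4)\<bar> \<le> C / real n"
proof -
  have s: "0 < sin \<theta>" using \<theta> by (intro sin_gt_zero) auto
  define w where "w = cis (2 * \<theta>)"
  define L where "L = (1 - w) powr (- 1 / 2)"
  define D where "D = 40 / sin (2 * \<theta>)"
  define \<kappa> where "\<kappa> = 1 / sqrt (2 * sin \<theta>)"
  have \<kappa>: "0 < \<kappa>" using s by (simp add: \<kappa>_def)
  have "\<bar>legendre (cos \<theta>) n - sqrt (2 / (pi * real n * sin \<theta>)) * cos ((real n + 1 / 2) * \<theta> - pi / 4)\<bar>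
      \<le> (2 * D + 2 * \<kappa>) / real n" if n: "n \<ge> 2" for n
  proof -
    define t where "t k = of_real (central_binom k) * cis \<theta> ^ k *
     (of_real (central_binom (n - k)) * cis (- \<theta>) ^ (n - k))" for k
    define P where "P r = (\<Sum>k<r. of_real (central_binom k * central_binom (n - k)) * w ^ k)" for r
    have t: "t k = cis (- real n * \<theta>) * (of_real (central_binom k * central_binom (n - k)) * w ^ k)" if "k \<le> n" for k
    proof -
      have "cis \<theta> ^ k * cis (- \<theta>) ^ (n - k) = cis (- real n * \<theta>) * w ^ k"
        using that unfolding w_def Complex.DeMoivre cis_mult
        by (intro arg_cong[where f = cis]) (simp add: of_nat_diff algebra_simps)
      then show ?thesis by (simp add: t_def mult_ac)
    qed
    have t_cnj: "t (n - k) = cnj (t k)" if "k \<le> n" for k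
      using that by (simp add: t_def cis_cnj mult_ac)
    \<comment> \<open>The halves have \<open>m\<close> and \<open>n - m + 1\<close> terms; for
      either parity of \<open>n\<close> both numbers lie between \<open>n / 2\<close> and
      \<open>n / 2 + 1\<close>.\<close>
    define m where "m = (n + 1) div 2"
    have m: "m \<le> n" "real n / 2 \<le> real m" "real m \<le> real n / 2 + 1"
      and m': "n - m + 1 \<le> n" "real n / 2 \<le> real (n - m + 1)" "real (n - m + 1) \<le> real n / 2 + 1"
      using n by (auto simp: m_def of_nat_diff)
    have head: "(\<Sum>k<r. t k) = cis (- real n * \<theta>) * P r" if "r \<le> n" for r
      unfolding P_def sum_distrib_left using that by (intro sum.cong t refl) auto
    have "(\<Sum>k\<le>n. t k) = (\<Sum>k<m. t k) + (\<Sum>k\<in>{m..n}. t k)"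
      using m(1) by (subst sum.union_disjoint[symmetric]) (auto intro!: sum.cong)
    also have "(\<Sum>k\<in>{m..n}. t k) = (\<Sum>k<n - m + 1. t (n - k))"
      by (rule sum.reindex_bij_witness[of _ "\<lambda>k. n - k" "\<lambda>k. n - k"]) (use m in auto)
    also have "\<dots> = cnj (\<Sum>k<n - m + 1. t k)"
      unfolding cnj_sum by (intro sum.cong t_cnj refl) auto
    also have "(\<Sum>k<m. t k) = cis (- real n * \<theta>) * P m" by (rule head[OF m(1)])
    also have "(\<Sum>k<n - m + 1. t k) = cis (- real n * \<theta>) * P (n - m + 1)" by (rule head[OF m'(1)])
    finally have leg: "of_real (legendre (cos \<theta>) n) = cis (- real n * \<theta>) * P m + cnj (cis (- real n * \<theta>) * P (n - m + 1))"
      unfolding legendre_convolution t_def by simp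
    define Q where "Q = of_real (central_binom n) * L"
    have PQ: "norm (P m - Q) \<le> D / real n" "norm (P (n - m + 1) - Q) \<le> D / real n"
      unfolding P_def Q_def L_def w_def D_def by (rule legendre_half_sum[OF \<theta> n m], rule legendre_half_sum[OF \<theta> n m'])
    define T where "T = cis (- real n * \<theta>) * Q + cnj (cis (- real n * \<theta>) * Q)"
    have "of_real (legendre (cos \<theta>) n) - T = cis (- real n * \<theta>) * (P m - Q) + cnj (cis (- real n * \<theta>) * (P (n - m + 1) - Q))"
      unfolding leg T_def by (simp add: algebra_simps)
    also have "norm \<dots> \<le> norm (P m - Q) + norm (P (n - m + 1) - Q)"
      by (rule order_trans[OF norm_triangle_ineq])
        (simp only: norm_mult complex_mod_cnj norm_cis mult_1 order_refl)
    also have "\<dots> \<le> 2 * D / real n" using PQ by simp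
    finally have 1: "norm (of_real (legendre (cos \<theta>) n) - T) \<le> 2 * D / real n" .
    have LL: "L = of_real \<kappa> * cis (pi / 4 - \<theta> / 2)"
      unfolding L_def w_def \<kappa>_def by (rule one_minus_cis_powr[OF \<theta>])
    define ph where "ph = cos ((real n + 1 / 2) * \<theta> - pi / 4)"
    have "cis (- real n * \<theta>) * Q = of_real (central_binom n * \<kappa>) * cis (- ((real n + 1 / 2) * \<theta> - pi / 4))"
    proof -
      have "cis (- real n * \<theta>) * cis (pi / 4 - \<theta> / 2) = cis (- ((real n + 1 / 2) * \<theta> - pi / 4))"
        by (simp add: cis_mult algebra_simps)
      then show ?thesis by (simp add: Q_def LL mult_ac)
    qed
    then have T: "T = of_real (2 * (central_binom n * \<kappa>) * ph)"
      unfolding T_def by (simp add: complex_eq_iff ph_def del: minus_diff_eq)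
    have 2: "\<bar>legendre (cos \<theta>) n - 2 * (central_binom n * \<kappa>) * ph\<bar> \<le> 2 * D / real n"
      using 1 unfolding T of_real_diff[symmetric] norm_of_real .
    have main: "sqrt (2 / (pi * real n * sin \<theta>)) = 2 * (1 / sqrt (pi * real n) * \<kappa>)"
    proof -
      have "2 * (1 / sqrt (pi * real n) * \<kappa>) = 2 / sqrt (pi * real n * (2 * sin \<theta>))"
        by (simp add: \<kappa>_def real_sqrt_mult)
      also have "\<dots> = sqrt 4 / sqrt (pi * real n * (2 * sin \<theta>))" by simp
      also have "\<dots> = sqrt (4 / (pi * real n * (2 * sin \<theta>)))" by (simp only: real_sqrt_divide)
      also have "4 / (pi * real n * (2 * sin \<theta>)) = 2 / (pi * real n * sin \<theta>)" by simp
      finally show ?thesis by simp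
    qed
    have wal: "\<bar>central_binom n - 1 / sqrt (pi * real n)\<bar> \<le> 1 / real n"
    proof -
      define x where "x = 1 / sqrt (pi * real n)"
      have n0: "0 < real n" using n by simp
      have pin: "1 \<le> pi * real n" using mult_mono[of 1 pi 1 "real n"] pi_gt3 n by simp
      have x: "0 \<le> x" "x \<le> 1" using pin by (auto simp: x_def)
      have "x * (1 - 1 / real n) \<le> 1 / sqrt (pi * (real n + 1 / 2))"
      proof (rule power2_le_imp_le)
        have "(1 - 1 / real n)\<^sup>2 \<le> 1 - 1 / real n"
          using n power_le_one[of "1 - 1 / real n" 1] mult_left_mono[of "1 - 1 / real n" 1 "1 - 1 / real n"]
          by (simp add: power2_eq_square)
        also have "\<dots> \<le> real n / (real n + 1 / 2)" using n0 by (simp add: field_simps)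
        finally have "x\<^sup>2 * (1 - 1 / real n)\<^sup>2 \<le> x\<^sup>2 * (real n / (real n + 1 / 2))"
          by (intro mult_left_mono) auto
        also have "\<dots> = (1 / sqrt (pi * (real n + 1 / 2)))\<^sup>2"
          using n0 by (simp add: x_def power_divide)
        finally show "(x * (1 - 1 / real n))\<^sup>2 \<le> (1 / sqrt (pi * (real n + 1 / 2)))\<^sup>2"
          by (simp add: power_mult_distrib)
      qed (use n0 in simp)
      moreover have "x * (1 - 1 / real n) = x - x / real n" by (simp add: algebra_simps)
      moreover have "x / real n \<le> 1 / real n" using x n0 by (intro divide_right_mono) auto
      ultimately show ?thesis
        using central_binom_wallis[of n] n unfolding x_def[symmetric] by (simp add: abs_le_iff)
    qed
    have "\<bar>2 * (central_binom n * \<kappa>) * ph - 2 * (1 / sqrt (pi * real n) * \<kappa>) * ph\<bar>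
        = 2 * \<kappa> * \<bar>central_binom n - 1 / sqrt (pi * real n)\<bar> * \<bar>ph\<bar>"
    proof -
      have "2 * (central_binom n * \<kappa>) * ph - 2 * (1 / sqrt (pi * real n) * \<kappa>) * ph
        = 2 * \<kappa> * (central_binom n - 1 / sqrt (pi * real n)) * ph" by (simp add: algebra_simps)
      then show ?thesis using \<kappa> by (simp add: abs_mult)
    qed
    also have "\<dots> \<le> 2 * \<kappa> * (1 / real n) * 1"
      using \<kappa> wal by (intro mult_mono) (auto simp: ph_def)
    finally have 3: "\<bar>2 * (central_binom n * \<kappa>) * ph - 2 * (1 / sqrt (pi * real n) * \<kappa>) * ph\<bar> \<le> 2 * \<kappa> / real n" by simp
    show ?thesis
      unfolding main ph_def[symmetric] using 2 3 by (simp add: add_divide_distrib abs_le_iff)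
  qed
  then show ?thesis by blast
qed

section \<open>Diagonal matrix elements and eigenvectors in coordinates\<close>

lemma ipow_Suc_Suc: "\<i> ^ Suc (Suc k) = - (\<i> ^ k)"
  by simp

lemma pattern_ipow: "pattern k = Re (\<i> ^ k) + Im (\<i> ^ k)"
proof (induct k rule: less_induct)
  case (less k)
  consider "k = 0" | "k = 1" | j where "k = Suc (Suc j)" by (metis One_nat_def not0_implies_Suc)
  then show ?case
  proof cases
    case (3 j)
    then show ?thesis using less[of j] by (simp only: pattern_Suc_Suc ipow_Suc_Suc) simp
  qed (simp_all add: pattern_def)
qed

context
  fixes \<beta> :: real
  assumes \<beta>: "\<bar>\<beta>\<bar> < 1"
begin

text \<open>The binomial series of \<open>squeezed_norm_0\<close>, now at
  \<open>- \<beta>\<^sup>2\<close> because the powers of \<open>i\<close> alternate in sign on even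
  coordinates.\<close>

lemma coverlap_0_0: "coverlap \<beta> 0 0 = of_real (sqrt (freq \<beta>))"
proof -
  define f where "f m = (squeezed \<beta> 0 m * squeezed \<beta> 0 m) *\<^sub>R \<i> ^ m" for m
  note pos = one_minus_beta_sq_pos[OF \<beta>]
  have b: "\<bar>- (\<beta>\<^sup>2)\<bar> < 1" using \<beta> by (simp add: abs_square_less_1)
  have "(\<lambda>k. sqrt (1 - \<beta>\<^sup>2) * (central_binom k * (- (\<beta>\<^sup>2)) ^ k)) sums (sqrt (1 - \<beta>\<^sup>2) * (1 - - (\<beta>\<^sup>2)) powr (- 1 / 2))"
    by (intro sums_mult central_binom_series b)
  also have "sqrt (1 - \<beta>\<^sup>2) * (1 - - (\<beta>\<^sup>2)) powr (- 1 / 2) = sqrt (freq \<beta>)"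
  proof -
    have "(1 + \<beta>\<^sup>2) powr (- 1 / 2) = inverse (sqrt (1 + \<beta>\<^sup>2))"
      using denom_pos[OF \<beta>] by (simp add: powr_minus powr_half_sqrt)
    then show ?thesis
      by (simp only: freq_def[OF \<beta>] real_sqrt_divide diff_minus_eq_add) (simp only: divide_inverse)
  qed
  finally have "(\<lambda>k. complex_of_real (sqrt (1 - \<beta>\<^sup>2) * (central_binom k * (- (\<beta>\<^sup>2)) ^ k))) sums of_real (sqrt (freq \<beta>))"
    by (rule sums_of_real)
  also have "(\<lambda>k. complex_of_real (sqrt (1 - \<beta>\<^sup>2) * (central_binom k * (- (\<beta>\<^sup>2)) ^ k))) = (\<lambda>k. f (2 * k))"
  proof
    fix k
    have "squeezed \<beta> 0 (2 * k) * squeezed \<beta> 0 (2 * k) = (sqrt (sqrt (1 - \<beta>\<^sup>2)))\<^sup>2 * ((- \<beta>) ^ k)\<^sup>2 * (sqrt (central_binom k))\<^sup>2"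
      by (simp add: power2_eq_square mult_ac)
    also have "\<dots> = sqrt (1 - \<beta>\<^sup>2) * (central_binom k * (\<beta>\<^sup>2) ^ k)"
      using pos central_binom_pos[of k] by (simp add: power_mult[symmetric] mult.commute)
    finally have "f (2 * k) = of_real (sqrt (1 - \<beta>\<^sup>2) * (central_binom k * (\<beta>\<^sup>2) ^ k)) * (- 1) ^ k"
      by (simp add: f_def scaleR_conv_of_real power_mult)
    then show "complex_of_real (sqrt (1 - \<beta>\<^sup>2) * (central_binom k * (- (\<beta>\<^sup>2)) ^ k)) = f (2 * k)"
      by (simp only: power_minus[of "\<beta>\<^sup>2"]) simp
  qed
  finally have "f sums of_real (sqrt (freq \<beta>))"
    by (subst (asm) sums_mono_reindex) (auto simp: strict_mono_def f_def elim!: evenE)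
  from sums_unique2[OF coverlap_sums[OF \<beta>] this[unfolded f_def[abs_def]]] show ?thesis .
qed

text \<open>Three instances of \<open>coverlap_recurrence\<close> close up on the diagonal, and
  \<open>freq\<^sup>2 + (2 * coup)\<^sup>2 = 1\<close> reduces the result to the Legendre recurrence
  at \<open>freq\<close>. The factor \<open>i ^ n\<close> accounts for the sign of its last
  term.\<close>

lemma coverlap_diag: "coverlap \<beta> n n = \<i> ^ n * of_real (sqrt (freq \<beta>) * legendre (freq \<beta>) n)"
proof (induct n rule: less_induct)
  case (less n)
  define F where "F = complex_of_real (freq \<beta>)"
  define s where "s = complex_of_real (2 * coup \<beta>)"
  define d where "d n = coverlap \<beta> n n" for n
  have Fs: "F * F + s * s = 1"
  proof -
    have "complex_of_real ((freq \<beta>)\<^sup>2 + 4 * (coup \<beta>)\<^sup>2) = of_real 1" unfolding freq_coup[OF \<beta>] ..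
    then show ?thesis by (simp add: F_def s_def power2_eq_square)
  qed
  have sq: "complex_of_real (sqrt (real k)) * complex_of_real (sqrt (real k)) = of_nat k" for k
    by (simp flip: of_real_mult)
  have R: "of_real (sqrt (real (Suc j))) * coverlap \<beta> m (Suc j)
   = \<i> * F * of_real (sqrt (real m)) * coverlap \<beta> (m - 1) j + s * of_real (sqrt (real j)) * coverlap \<beta> m (j - 1)" for m j
    using coverlap_recurrence[OF \<beta>, of j m] by (simp add: F_def s_def mult.assoc)
  consider "n = 0" | "n = 1" | k where "n = Suc (Suc k)" by (metis One_nat_def not0_implies_Suc)
  then show ?case
  proof cases
    case 1
    then show ?thesis by (simp add: coverlap_0_0)
  next
    case 2
    have "coverlap \<beta> 1 1 = \<i> * F * coverlap \<beta> 0 0" using R[of 0 1] by simp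
    then show ?thesis using 2 by (simp add: coverlap_0_0 F_def)
  next
    case (3 k)
    \<comment> \<open>\<open>Y\<close> and \<open>X\<close> are the off-diagonal entries linking
      consecutive diagonal ones; \<open>e2\<close> expresses \<open>Y\<close> through
      \<open>X\<close>, and \<open>e3\<close> removes \<open>X\<close>.\<close>
    define Y where "Y = coverlap \<beta> (Suc (Suc k)) k"
    define X where "X = coverlap \<beta> (Suc k) (k - 1)"
    define p where "p = complex_of_real (sqrt (real (Suc (Suc k))))"
    define q where "q = complex_of_real (sqrt (real (Suc k)))"
    define r where "r = complex_of_real (sqrt (real k))"
    have e1: "p * d (Suc (Suc k)) = \<i> * F * p * d (Suc k) + s * q * Y"
      using R[of "Suc k" "Suc (Suc k)"] by (simp add: p_def q_def d_def Y_def)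
    have e2: "p * Y = \<i> * F * r * X + s * q * d k"
      using R[of "Suc k" k] coverlap_commute[OF \<beta>, of k "Suc (Suc k)"] coverlap_commute[OF \<beta>, of "k - 1" "Suc k"]
      by (simp add: p_def q_def r_def d_def Y_def X_def)
    have e3: "q * d (Suc k) = \<i> * F * q * d k + s * r * X"
      using R[of k "Suc k"] by (simp add: q_def r_def d_def X_def)
    have pp: "p * p = of_nat k + 2" and qq: "q * q = of_nat k + 1"
      unfolding p_def q_def sq by simp_all
    have "(p * p) * d (Suc (Suc k)) = \<i> * F * (p * p) * d (Suc k) + s * q * (p * Y)"
      using arg_cong[OF e1, of "\<lambda>z. p * z"] by (simp add: algebra_simps)
    also have "\<dots> = \<i> * F * (p * p) * d (Suc k) + \<i> * F * q * (s * r * X) + s * s * (q * q) * d k"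
      unfolding e2 by (simp add: algebra_simps)
    also have "s * r * X = q * d (Suc k) - \<i> * F * q * d k" unfolding e3 by simp
    also have "\<i> * F * (p * p) * d (Suc k) + \<i> * F * q * (q * d (Suc k) - \<i> * F * q * d k) + s * s * (q * q) * d k
      = \<i> * F * (p * p + q * q) * d (Suc k) + (F * F + s * s) * (q * q) * d k"
      by (simp add: algebra_simps)
    finally have rec: "(of_nat k + 2) * d (Suc (Suc k)) = \<i> * F * (2 * of_nat k + 3) * d (Suc k) + (of_nat k + 1) * d k"
      unfolding pp qq Fs by (simp add: algebra_simps)
    have nz: "(of_nat k + 2 :: complex) \<noteq> 0"
      using of_nat_neq_0[of "Suc k", where ?'a = complex] by (simp add: add.commute)
    define S where "S = complex_of_real (sqrt (freq \<beta>))"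
    define P where "P j = complex_of_real (legendre (freq \<beta>) j)" for j
    have "(real k + 2) * legendre (freq \<beta>) (Suc (Suc k))
      = (2 * real k + 3) * freq \<beta> * legendre (freq \<beta>) (Suc k) - (real k + 1) * legendre (freq \<beta>) k"
      by simp
    then have "complex_of_real ((real k + 2) * legendre (freq \<beta>) (Suc (Suc k)))
      = of_real ((2 * real k + 3) * freq \<beta> * legendre (freq \<beta>) (Suc k) - (real k + 1) * legendre (freq \<beta>) k)"
      by (rule arg_cong)
    then have L: "(of_nat k + 2) * P (Suc (Suc k)) = (2 * of_nat k + 3) * F * P (Suc k) - (of_nat k + 1) * P k"
      by (simp add: P_def F_def del: legendre.simps)
    have "d (Suc k) = \<i> ^ Suc k * (S * P (Suc k))" "d k = \<i> ^ k * (S * P k)"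
      using less[of "Suc k"] less[of k] by (simp_all add: 3 d_def S_def P_def del: legendre.simps)
    then have "(of_nat k + 2) * d (Suc (Suc k)) = - (\<i> ^ k) * S * ((2 * of_nat k + 3) * F * P (Suc k) - (of_nat k + 1) * P k)"
      unfolding rec by (simp add: algebra_simps)
    also have "\<dots> = (of_nat k + 2) * (\<i> ^ Suc (Suc k) * (S * P (Suc (Suc k))))"
      unfolding L[symmetric] by simp
    finally have "d (Suc (Suc k)) = \<i> ^ Suc (Suc k) * (S * P (Suc (Suc k)))"
      by (rule mult_left_cancel[OF nz, THEN iffD1])
    then show ?thesis by (simp add: 3 d_def S_def P_def del: legendre.simps)
  qed
qed

lemma overlap_diag: "overlap \<beta> n n = pattern n * (sqrt (freq \<beta>) * legendre (freq \<beta>) n)"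
proof -
  have "(\<lambda>k. Re ((squeezed \<beta> n k * squeezed \<beta> n k) *\<^sub>R \<i> ^ k) + Im ((squeezed \<beta> n k * squeezed \<beta> n k) *\<^sub>R \<i> ^ k))
     sums (Re (coverlap \<beta> n n) + Im (coverlap \<beta> n n))"
    by (intro sums_add sums_Re sums_Im coverlap_sums \<beta>)
  moreover have "Re ((squeezed \<beta> n k * squeezed \<beta> n k) *\<^sub>R \<i> ^ k) + Im ((squeezed \<beta> n k * squeezed \<beta> n k) *\<^sub>R \<i> ^ k)
     = squeezed \<beta> n k * (pattern k * squeezed \<beta> n k)" for k
    by (simp add: pattern_ipow algebra_simps del: squeezed.simps)
  ultimately have "(\<lambda>k. squeezed \<beta> n k * (pattern k * squeezed \<beta> n k)) sums (Re (coverlap \<beta> n n) + Im (coverlap \<beta> n n))"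
    by simp
  from sums_unique2[OF overlap_sums[OF \<beta>] this]
  show ?thesis by (simp add: coverlap_diag pattern_ipow algebra_simps del: legendre.simps)
qed

lemma oscillator: "perturbed_oscillator (sqv \<beta>) (\<lambda>x. s *\<^sub>R pattern_op x) (freq \<beta>) \<bar>s\<bar>"
  by unfold_locales (simp_all add: freq_pos[OF \<beta>] sqv_orthonormal[OF \<beta>] sqv_parseval[OF \<beta>]
      norm_pattern_op pattern_op_sym linear_add[OF linear_pattern_op] linear_scale[OF linear_pattern_op]
      scaleR_add_right)

section \<open>Weak eigenvectors in coordinates\<close>

abbreviation weak_eigenspace :: "real \<Rightarrow> real \<Rightarrow> l2 set" where
  "weak_eigenspace s l \<equiv> perturbed_oscillator.eigenspace (sqv \<beta>) (\<lambda>x. s *\<^sub>R pattern_op x) (freq \<beta>) ((freq \<beta> - 1) / 2) l"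

lemma lam_level: "perturbed_oscillator.lam (freq \<beta>) ((freq \<beta> - 1) / 2) j = level \<beta> j"
  by (simp add: perturbed_oscillator.lam_def[OF oscillator] level_def[OF \<beta>])

definition free_action :: "(nat \<Rightarrow> real) \<Rightarrow> nat \<Rightarrow> real" where
  "free_action x m = real m * x m + coup \<beta> * (ann (ann x) m + cre (cre x) m)"

text \<open>This is \<open>H_0\<close> applied to the unit vector \<open>m\<close>. Being finitely
  supported it lies in \<open>l2\<close>, and pairing with it reads off coordinate \<open>m\<close>
  of the formal action on any \<open>l2\<close> vector.\<close>

definition free_row :: "nat \<Rightarrow> l2" where
  "free_row m = real m *\<^sub>R unit_vec m + coup \<beta> *\<^sub>R ((sqrt (real m + 1) * sqrt (real (Suc m) + 1)) *\<^sub>R unit_vec (Suc (Suc m))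
     + (if m < 2 then 0 else sqrt (real m) * sqrt (real (m - 1))) *\<^sub>R unit_vec (m - 2))"

lemma inner_free_row: "inner x (free_row m) = free_action (coord x) m"
proof -
  have "cre (cre (coord x)) m = (if m < 2 then 0 else sqrt (real m) * sqrt (real (m - 1))) * coord x (m - 2)"
    by (auto simp: cre_def numeral_2_eq_2)
  then show ?thesis
    by (simp add: free_row_def free_action_def inner_add_right inner_unit_vec ann_def mult.assoc add.commute)
qed

text \<open>Left to right, Parseval expands the pairing of \<open>x\<close> with the finite vector
  \<open>free_row m\<close>. Right to left, the equations are summed against the rapidly decaying
  \<open>squeezed \<beta> j\<close>, which can take over all ladder operators from
  \<open>x\<close>.\<close>

lemma weak_eigenspace_iff:
  "x \<in> weak_eigenspace s l \<longleftrightarrow>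
     (\<forall>m. free_action (coord x) m + s * (pattern m * coord x m) = l * coord x m)"
proof
  interpret perturbed_oscillator "sqv \<beta>" "\<lambda>x. s *\<^sub>R pattern_op x" "freq \<beta>" "(freq \<beta> - 1) / 2" "\<bar>s\<bar>"
    by (rule oscillator)
  assume x: "x \<in> weak_eigenspace s l"
  show "\<forall>m. free_action (coord x) m + s * (pattern m * coord x m) = l * coord x m"
  proof
    fix m
    have row: "inner (sqv \<beta> j) (free_row m) = lam j * inner (sqv \<beta> j) (unit_vec m)" for j
      using squeezed_eigen[OF \<beta>, of m j]
      by (simp add: inner_free_row inner_unit_vec coord_sqv[OF \<beta>] lam_level free_action_def del: squeezed.simps)
    have "(\<lambda>j. inner (sqv \<beta> j) x * inner (sqv \<beta> j) (free_row m)) sums inner x (free_row m)"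
      by (rule parseval_polar)
    then have "(\<lambda>j. lam j * (inner (sqv \<beta> j) x * inner (sqv \<beta> j) (unit_vec m))) sums inner x (free_row m)"
      by (simp add: row mult_ac)
    from sums_unique2[OF this eigenvector_pairing[OF x]]
    show "free_action (coord x) m + s * (pattern m * coord x m) = l * coord x m"
      by (simp add: inner_free_row inner_unit_vec coord_pattern_op)
  qed
next
  interpret perturbed_oscillator "sqv \<beta>" "\<lambda>x. s *\<^sub>R pattern_op x" "freq \<beta>" "(freq \<beta> - 1) / 2" "\<bar>s\<bar>"
    by (rule oscillator)
  assume x: "\<forall>m. free_action (coord x) m + s * (pattern m * coord x m) = l * coord x m"
  have "lam j * inner (sqv \<beta> j) x + inner (sqv \<beta> j) (s *\<^sub>R pattern_op x) = l * inner (sqv \<beta> j) x" for j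
  proof -
    define y where "y = squeezed \<beta> j"
    define u where "u = coord x"
    have y: "geometric_decay y" unfolding y_def by (rule geometric_decay_squeezed[OF \<beta>])
    have u: "\<bar>u m\<bar> \<le> norm x" for m unfolding u_def by (rule abs_coord_le)
    note sm = geometric_decay_summable_mult[where ?'a = real, unfolded real_norm_def real_scaleR_def, OF _ u]
    have "(\<lambda>m. ann (ann y) m * u m) sums (\<Sum>m. ann (ann y) m * u m)"
      by (intro summable_sums sm geometric_decay_ann y)
    then have A: "(\<lambda>m. y m * cre (cre u) m) sums (\<Sum>m. ann (ann y) m * u m)"
      by (intro ann_cre_sums)
    have "(\<lambda>m. cre (cre y) m * u m) sums (\<Sum>m. cre (cre y) m * u m)"
      by (intro summable_sums sm geometric_decay_cre y)
    then have B: "(\<lambda>m. y m * ann (ann u) m) sums (\<Sum>m. cre (cre y) m * u m)"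
      by (intro cre_ann_sums)
    have yu: "(\<lambda>m. y m * u m) sums inner (sqv \<beta> j) x"
      using inner_l2_sums[of "sqv \<beta> j" x] by (simp add: coord_sqv[OF \<beta>] y_def u_def)
    have "(\<lambda>m. level \<beta> j * (y m * u m) - coup \<beta> * (ann (ann y) m * u m) - coup \<beta> * (cre (cre y) m * u m)
        + coup \<beta> * (y m * cre (cre u) m) + coup \<beta> * (y m * ann (ann u) m))
      sums (level \<beta> j * inner (sqv \<beta> j) x - coup \<beta> * (\<Sum>m. ann (ann y) m * u m) - coup \<beta> * (\<Sum>m. cre (cre y) m * u m)
        + coup \<beta> * (\<Sum>m. ann (ann y) m * u m) + coup \<beta> * (\<Sum>m. cre (cre y) m * u m))"
      by (intro sums_add sums_diff sums_mult yu A B summable_sums sm geometric_decay_ann geometric_decay_cre y)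
    moreover have "level \<beta> j * (y m * u m) - coup \<beta> * (ann (ann y) m * u m) - coup \<beta> * (cre (cre y) m * u m)
        + coup \<beta> * (y m * cre (cre u) m) + coup \<beta> * (y m * ann (ann u) m)
      = l * (y m * u m) - s * (y m * (pattern m * u m))" for m
    proof -
      have "level \<beta> j * y m = real m * y m + coup \<beta> * (ann (ann y) m + cre (cre y) m)"
        unfolding y_def by (rule squeezed_eigen[OF \<beta>, symmetric])
      then have "level \<beta> j * y m * u m = (real m * y m + coup \<beta> * (ann (ann y) m + cre (cre y) m)) * u m" by simp
      moreover have "y m * (real m * u m + coup \<beta> * (ann (ann u) m + cre (cre u) m)) = y m * (l * u m - s * (pattern m * u m))"
        using x by (simp add: free_action_def u_def) (metis add_diff_cancel_right')
      ultimately show ?thesis by (simp add: algebra_simps)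
    qed
    ultimately have "(\<lambda>m. l * (y m * u m) - s * (y m * (pattern m * u m))) sums (level \<beta> j * inner (sqv \<beta> j) x)"
      by simp
    moreover have "(\<lambda>m. l * (y m * u m) - s * (y m * (pattern m * u m))) sums (l * inner (sqv \<beta> j) x - s * inner (sqv \<beta> j) (pattern_op x))"
      using inner_l2_sums[of "sqv \<beta> j" "pattern_op x"]
      by (intro sums_diff sums_mult yu) (simp add: coord_sqv[OF \<beta>] coord_pattern_op y_def u_def)
    ultimately have "level \<beta> j * inner (sqv \<beta> j) x = l * inner (sqv \<beta> j) x - s * inner (sqv \<beta> j) (pattern_op x)"
      by (rule sums_unique2)
    then show ?thesis by (simp add: lam_level)
  qed
  then show "x \<in> weak_eigenspace s l" by (simp add: eigenspace_def)
qed

lemma orthonormal_sum_norm: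
  assumes "finite A" "inj_on f A"
  shows "(norm (\<Sum>j\<in>A. a j *\<^sub>R sqv \<beta> (f j)))\<^sup>2 = (\<Sum>j\<in>A. (a j)\<^sup>2)"
proof -
  have "inner (\<Sum>i\<in>A. a i *\<^sub>R sqv \<beta> (f i)) (\<Sum>j\<in>A. a j *\<^sub>R sqv \<beta> (f j))
     = (\<Sum>i\<in>A. \<Sum>j\<in>A. if i = j then (a i)\<^sup>2 else 0)"
    unfolding inner_sum_left inner_sum_right
    using assms(2) by (intro sum.cong refl) (auto simp: sqv_orthonormal[OF \<beta>] inj_on_eq_iff power2_eq_square)
  then show ?thesis using assms(1) by (simp add: power2_norm_eq_inner)
qed

text \<open>Since \<open>V\<close> is bounded, the coefficients of an eigenvector decay as on the domain of \<open>b\<^sup>+ b\<close>;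
  the number operator is tridiagonal in the squeezed basis with entries of linear growth.\<close>

lemma weak_eigenvector_number:
  assumes x: "x \<in> weak_eigenspace s l"
  shows "summable (\<lambda>m. (real m * coord x m)\<^sup>2)"
proof -
  interpret perturbed_oscillator "sqv \<beta>" "\<lambda>x. s *\<^sub>R pattern_op x" "freq \<beta>" "(freq \<beta> - 1) / 2" "\<bar>s\<bar>"
    by (rule oscillator)
  define c where "c j = inner (sqv \<beta> j) x" for j
  have f: "0 < freq \<beta>" by (rule freq_pos[OF \<beta>])
  \<comment> \<open>Rearranges the eigenvalue equation so that the coefficients of \<open>z\<close>
    are \<open>freq \<beta> * (j + 1) * c j\<close>. Since \<open>z\<close> lies in
    \<open>l2\<close>, these are square summable.\<close>
  define z where "z = l *\<^sub>R x - s *\<^sub>R pattern_op x + (1 - (freq \<beta> - 1) / 2 - (1 - freq \<beta>)) *\<^sub>R x"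
  have z: "inner (sqv \<beta> j) z = freq \<beta> * ((real j + 1) * c j)" for j
  proof -
    have "lam j * c j + s * inner (sqv \<beta> j) (pattern_op x) = l * c j"
      using x by (simp add: eigenspace_def c_def)
    then show ?thesis by (simp add: z_def inner_add_right inner_diff_right c_def lam_def algebra_simps)
  qed
  define K where "K = inner z z / (freq \<beta>)\<^sup>2"
  have K: "(\<Sum>j\<in>A. ((real j + 1) * c j)\<^sup>2) \<le> K" if "finite A" for A
  proof -
    have "(\<Sum>j\<in>A. (freq \<beta> * ((real j + 1) * c j))\<^sup>2) \<le> inner z z"
      using sum_le_suminf[OF sums_summable[OF parseval[of z]] that] sums_unique[OF parseval[of z]] by (simp add: z)
    then have "(freq \<beta>)\<^sup>2 * (\<Sum>j\<in>A. ((real j + 1) * c j)\<^sup>2) \<le> inner z z"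
      by (simp only: power_mult_distrib[of "freq \<beta>"] sum_distrib_left)
    moreover have "0 < (freq \<beta>)\<^sup>2" using f by simp
    ultimately show ?thesis unfolding K_def by (simp only: pos_le_divide_eq mult.commute)
  qed
  have K0: "0 \<le> K" using K[of "{}"] by simp
  define t where "t = \<bar>ch \<beta> * sh \<beta>\<bar>"
  define p where "p j = ((ch \<beta>)\<^sup>2 * real j + (sh \<beta>)\<^sup>2 * (real j + 1)) * c j" for j
  define q where "q j = ch \<beta> * sh \<beta> * (sqrt (real j) * sqrt (real (j - 1))) * c j" for j
  define r where "r j = ch \<beta> * sh \<beta> * (sqrt (real (Suc j)) * sqrt (real (Suc (Suc j)))) * c j" for j
  define A where "A = (ch \<beta>)\<^sup>2 + (sh \<beta>)\<^sup>2 + 2 * t"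
  have A0: "0 \<le> A" by (simp add: A_def t_def)
  have bound: "norm (\<Sum>j\<in>I. a j *\<^sub>R sqv \<beta> (h j)) \<le> A * sqrt K"
    if "finite I" "inj_on h I" "\<And>j. \<bar>a j\<bar> \<le> A * \<bar>(real j + 1) * c j\<bar>" for I h a
  proof (rule power2_le_imp_le)
    have "(norm (\<Sum>j\<in>I. a j *\<^sub>R sqv \<beta> (h j)))\<^sup>2 = (\<Sum>j\<in>I. (a j)\<^sup>2)"
      by (rule orthonormal_sum_norm[OF that(1,2)])
    also have "\<dots> \<le> (\<Sum>j\<in>I. A\<^sup>2 * ((real j + 1) * c j)\<^sup>2)"
    proof (rule sum_mono)
      fix j
      have "\<bar>a j\<bar>\<^sup>2 \<le> (A * \<bar>(real j + 1) * c j\<bar>)\<^sup>2" by (intro power_mono that) auto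
      then show "(a j)\<^sup>2 \<le> A\<^sup>2 * ((real j + 1) * c j)\<^sup>2" by (simp add: power_mult_distrib)
    qed
    also have "\<dots> \<le> A\<^sup>2 * K" unfolding sum_distrib_left[symmetric] by (intro mult_left_mono K that) auto
    also have "\<dots> = (A * sqrt K)\<^sup>2" using K0 by (simp add: power_mult_distrib)
    finally show "(norm (\<Sum>j\<in>I. a j *\<^sub>R sqv \<beta> (h j)))\<^sup>2 \<le> (A * sqrt K)\<^sup>2" .
  qed (use A0 K0 in simp)
  have gm: "sqrt a * sqrt b \<le> 2 * (real j + 1)" if "0 \<le> a" "a \<le> 2 * (real j + 1)" "0 \<le> b" "b \<le> 2 * (real j + 1)" for a b j
  proof -
    have "sqrt a * sqrt b \<le> sqrt (2 * (real j + 1)) * sqrt (2 * (real j + 1))"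
      using that by (intro mult_mono) auto
    then show ?thesis by simp
  qed
  have pb: "\<bar>p j\<bar> \<le> A * \<bar>(real j + 1) * c j\<bar>" for j
  proof -
    have "(ch \<beta>)\<^sup>2 * real j + (sh \<beta>)\<^sup>2 * (real j + 1) \<le> (ch \<beta>)\<^sup>2 * (real j + 1) + (sh \<beta>)\<^sup>2 * (real j + 1) + 2 * t * (real j + 1)"
      by (simp add: t_def algebra_simps)
    also have "\<dots> = A * (real j + 1)" by (simp add: A_def algebra_simps)
    finally show ?thesis by (simp add: p_def abs_mult mult_right_mono mult.assoc[symmetric])
  qed
  have qr: "\<bar>ch \<beta> * sh \<beta> * g * c j\<bar> \<le> A * \<bar>(real j + 1) * c j\<bar>" if "0 \<le> g" "g \<le> 2 * (real j + 1)" for g j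
  proof -
    have "t * g \<le> t * (2 * (real j + 1))" using that by (intro mult_left_mono) (auto simp: t_def)
    also have "\<dots> \<le> A * (real j + 1)" by (simp add: A_def algebra_simps)
    finally have "t * g * \<bar>c j\<bar> \<le> A * (real j + 1) * \<bar>c j\<bar>" by (intro mult_right_mono) auto
    then show ?thesis using that by (simp add: t_def abs_mult mult_ac)
  qed
  have qb: "\<bar>q j\<bar> \<le> A * \<bar>(real j + 1) * c j\<bar>" for j
    unfolding q_def by (intro qr gm) auto
  have rb: "\<bar>r j\<bar> \<le> A * \<bar>(real j + 1) * c j\<bar>" for j
    unfolding r_def by (intro qr gm) auto
  \<comment> \<open>Truncations of the number operator applied to \<open>x\<close>, split into its
    three bands so that each sum runs over an orthonormal family. The second starts at 2 to keep
    \<open>j - 2\<close> injective; \<open>q 0\<close> and \<open>q 1\<close> vanish.\<close>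
  define Y where "Y J = (\<Sum>j<J. p j *\<^sub>R sqv \<beta> j) - (\<Sum>j\<in>{2..<J}. q j *\<^sub>R sqv \<beta> (j - 2)) - (\<Sum>j<J. r j *\<^sub>R sqv \<beta> (j + 2))" for J
  have Y: "norm (Y J) \<le> 3 * (A * sqrt K)" for J
  proof -
    have "norm (Y J) \<le> norm (\<Sum>j<J. p j *\<^sub>R sqv \<beta> j) + norm (\<Sum>j\<in>{2..<J}. q j *\<^sub>R sqv \<beta> (j - 2)) + norm (\<Sum>j<J. r j *\<^sub>R sqv \<beta> (j + 2))"
      unfolding Y_def by (meson add_mono norm_triangle_ineq4 order_refl order_trans)
    also have "\<dots> \<le> A * sqrt K + A * sqrt K + A * sqrt K"
      by (intro add_mono bound pb qb rb) (auto simp: inj_on_def)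
    finally show ?thesis by simp
  qed
  have coordY: "coord (Y J) m = real m * (\<Sum>j<J. c j * coord (sqv \<beta> j) m)" for J m
  proof -
    have q: "(\<Sum>j\<in>{2..<J}. q j * squeezed \<beta> (j - 2) m) = (\<Sum>j<J. q j * squeezed \<beta> (j - 2) m)"
      by (rule sum.mono_neutral_left) (auto simp: q_def less_2_cases_iff)
    have "coord (Y J) m = (\<Sum>j<J. p j * squeezed \<beta> j m - q j * squeezed \<beta> (j - 2) m - r j * squeezed \<beta> (j + 2) m)"
      by (simp add: Y_def coord_sum coord_sqv[OF \<beta>] q sum_subtractf del: squeezed.simps)
    also have "\<dots> = (\<Sum>j<J. c j * (real m * squeezed \<beta> j m))"
      unfolding number_squeezed[OF \<beta>]
      by (intro sum.cong refl) (simp add: p_def q_def r_def algebra_simps del: squeezed.simps)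
    finally show ?thesis by (simp add: coord_sqv[OF \<beta>] sum_distrib_left mult_ac del: squeezed.simps)
  qed
  have lim: "(\<lambda>J. coord (Y J) m) \<longlonglongrightarrow> real m * coord x m" for m
  proof -
    have "(\<lambda>J. \<Sum>j<J. c j * coord (sqv \<beta> j) m) \<longlonglongrightarrow> coord x m"
      using parseval_polar[of x "unit_vec m"] by (simp add: sums_def c_def inner_unit_vec)
    then show ?thesis unfolding coordY by (intro tendsto_mult tendsto_const)
  qed
  \<comment> \<open>Coordinatewise convergence of \<open>Y J\<close> together with its uniform norm
    bound suffices: finite sums of squares pass to the limit.\<close>
  have "(\<Sum>m<M. (real m * coord x m)\<^sup>2) \<le> (3 * (A * sqrt K))\<^sup>2" for M
  proof (rule LIMSEQ_le_const2)
    show "(\<lambda>J. \<Sum>m<M. (coord (Y J) m)\<^sup>2) \<longlonglongrightarrow> (\<Sum>m<M. (real m * coord x m)\<^sup>2)"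
      by (intro tendsto_intros lim)
    have "(\<Sum>m<M. (coord (Y J) m)\<^sup>2) \<le> (3 * (A * sqrt K))\<^sup>2" for J
      using sum_coord_le[of "Y J" M] power_mono[OF Y[of J] norm_ge_zero, of 2] by linarith
    then show "\<exists>N. \<forall>n\<ge>N. (\<Sum>m<M. (coord (Y n) m)\<^sup>2) \<le> (3 * (A * sqrt K))\<^sup>2" by blast
  qed
  then show ?thesis by (intro summableI_nonneg_bounded) auto
qed

end

section \<open>The two-photon Rabi Hamiltonian\<close>

text \<open>The spin of the \<open>n\<close>-th basis vector in an invariant subspace:
  \<open>True\<close> selects the first subspace, \<open>False\<close> the second. One parameter
  lets both be treated at once.\<close>

definition label :: "bool \<Rightarrow> nat \<Rightarrow> spin" where
  "label b n = (if even (n div 2) = b then Up else Down)"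

definition labels :: "bool \<Rightarrow> (nat \<times> spin) set" where
  "labels b = {(n, s). s = label b n}"

definition label_sign :: "bool \<Rightarrow> real" where
  "label_sign b = (if b then 1 else - 1)"

definition state_of :: "bool \<Rightarrow> l2 \<Rightarrow> state" where
  "state_of b x = (\<lambda>(n, s). if s = label b n then of_real (coord x n) else 0)"

lemma basis_plus_labels: "basis_plus = labels True"
  by (auto simp: basis_plus_def labels_def label_def)

lemma basis_minus_labels: "basis_minus = labels False"
  by (auto simp: basis_minus_def labels_def label_def)

text \<open>The reason for invariance: the coupling changes \<open>n\<close> by two while
  \<open>sigma_x\<close> flips the spin, and along the labels these changes agree.\<close>

lemma flip_label: "flip (label b n) = label b (n + 2)"
  by (auto simp: label_def)

lemma flip_flip [simp]: "flip (flip s) = s"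
  by (cases s) auto

lemma flip_eq_iff: "flip s = t \<longleftrightarrow> s = flip t"
  by (cases s; cases t) auto

lemma label_sigma: "(case label b n of Up \<Rightarrow> z | Down \<Rightarrow> - z) = of_real (label_sign b * pattern n) * (z :: complex)"
  by (auto simp: label_def label_sign_def pattern_def)

lemma creation_annihilation: "creation (annihilation X) (n, s) = of_nat n * X (n, s)"
  by (cases n) (simp_all add: creation_def annihilation_def mult.assoc[symmetric] flip: of_real_mult)

lemma annihilation_twice:
  "annihilation (annihilation (sigma_x X)) (n, s) = of_real (sqrt (real n + 1) * sqrt (real (Suc n) + 1)) * X (n + 2, flip s)"
  by (simp add: annihilation_def sigma_x_def add.commute)

lemma creation_twice:
  "creation (creation (sigma_x X)) (n, s) = (if n < 2 then 0 else of_real (sqrt (real n) * sqrt (real (n - 1))) * X (n - 2, flip s))"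
proof -
  consider "n = 0" | "n = 1" | k where "n = k + 2" by (metis One_nat_def add_2_eq_Suc' not0_implies_Suc)
  then show ?thesis by cases (simp_all add: creation_def sigma_x_def)
qed

definition supported :: "bool \<Rightarrow> state \<Rightarrow> bool" where
  "supported b X \<longleftrightarrow> (\<forall>i. i \<notin> labels b \<longrightarrow> X i = 0)"

lemma supportedD: "supported b X \<Longrightarrow> s \<noteq> label b n \<Longrightarrow> X (n, s) = 0"
  by (auto simp: supported_def labels_def)

lemma ell2_supported:
  assumes "supported b X"
  shows "X \<in> ell2 \<longleftrightarrow> summable (\<lambda>n. (cmod (X (n, label b n)))\<^sup>2)"
proof -
  have "(\<lambda>i. (cmod (X i))\<^sup>2) summable_on UNIV \<longleftrightarrow> (\<lambda>i. (cmod (X i))\<^sup>2) summable_on (range (\<lambda>n. (n, label b n)))"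
    by (rule summable_on_cong_neutral) (use assms in \<open>auto simp: supported_def labels_def image_iff\<close>)
  also have "\<dots> \<longleftrightarrow> ((\<lambda>i. (cmod (X i))\<^sup>2) \<circ> (\<lambda>n. (n, label b n))) summable_on UNIV"
    by (rule summable_on_reindex) (auto simp: inj_on_def)
  also have "\<dots> \<longleftrightarrow> summable (\<lambda>n. (cmod (X (n, label b n)))\<^sup>2)"
    by (subst summable_on_UNIV_nonneg_real_iff) (auto simp: o_def)
  finally show ?thesis by (simp add: ell2_def)
qed

lemma supported_state_of: "supported b (state_of b x)"
  by (auto simp: supported_def labels_def state_of_def)

lemma supported_number: "supported b X \<Longrightarrow> supported b (creation (annihilation X))"
  by (auto simp: supported_def creation_annihilation)

lemma state_of_apply: "state_of b x (n, label b n) = of_real (coord x n)"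
  by (simp add: state_of_def)

lemma state_of_inj: "inj (state_of b)"
  by (rule injI, rule l2_eqI) (metis state_of_apply of_real_eq_iff)

lemma state_sum_apply: "(\<Sum>a\<in>A. (f a :: state)) i = (\<Sum>a\<in>A. f a i)"
  by (induct A rule: infinite_finite_induct) auto

lemma state_of_add: "state_of b (x + y) = state_of b x + state_of b y"
  by (auto simp: state_of_def)

lemma state_of_scale: "state_of b (r *\<^sub>R x) = state_scale (of_real r) (state_of b x)"
  by (auto simp: state_of_def state_scale_def)

lemma state_of_sum: "finite A \<Longrightarrow> state_of b (\<Sum>a\<in>A. f a) = (\<Sum>a\<in>A. state_of b (f a))"
proof (induct A rule: finite_induct)
  case empty
  then show ?case by (auto simp: state_of_def)
qed (simp add: state_of_add)

section \<open>Reduction of the complex eigenspaces to real sequences\<close>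

context
  fixes \<beta> :: real
  assumes \<beta>: "\<bar>\<beta>\<bar> < 1"
begin

lemma rabi_hamiltonian_off:
  assumes "supported b X" "s \<noteq> label b n"
  shows "rabi_hamiltonian \<Delta> g X (n, s) = 0"
proof -
  have "flip s \<noteq> label b (n + 2)"
    using assms(2) unfolding flip_label[symmetric] by (metis flip_flip)
  moreover have "flip s \<noteq> label b (n - 2)" if "\<not> n < 2"
  proof
    assume "flip s = label b (n - 2)"
    then have "s = label b (n - 2 + 2)" by (simp only: flip_eq_iff flip_label)
    moreover have "n - 2 + 2 = n" using that by simp
    ultimately have "s = label b n" by (simp only:)
    with assms(2) show False by contradiction
  qed
  ultimately show ?thesis
    using supportedD[OF assms(1)] assms(2)
    by (auto simp: rabi_hamiltonian_def sigma_z_def creation_annihilation annihilation_twice creation_twice split: spin.split)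
qed

text \<open>On a labelled subspace the matrix is real, so real and imaginary parts satisfy the same
  equation; \<open>f\<close> stands for either.\<close>

lemma rabi_hamiltonian_on:
  fixes \<Delta> :: real
  assumes f: "f = Re \<or> f = Im"
  shows "f (rabi_hamiltonian \<Delta> (coup \<beta>) X (n, label b n)) =
     free_action \<beta> (\<lambda>n. f (X (n, label b n))) n + label_sign b * (\<Delta> / 2) * (pattern n * f (X (n, label b n)))"
proof -
  have f_lin: "f (z + w) = f z + f w" "f (of_real r * z) = r * f z" "f 0 = 0" for z w r
    using f by auto
  have n2: "flip (label b n) = label b (n - 2)" if "\<not> n < 2"
  proof -
    have "n - 2 + 2 = n" using that by simp
    then have "flip (label b (n - 2)) = label b n" using flip_label[of b "n - 2"] by (simp only:)
    then show ?thesis by (metis flip_flip)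
  qed
  have nz: "(of_nat n * z :: complex) = of_real (real n) * z" for z by simp
  have "cre (cre (\<lambda>n. f (X (n, label b n)))) n = (if n < 2 then 0 else sqrt (real n) * sqrt (real (n - 1)) * f (X (n - 2, label b (n - 2))))"
    by (auto simp: cre_def numeral_2_eq_2)
  moreover have "f (creation (creation (sigma_x X)) (n, label b n)) = (if n < 2 then 0 else sqrt (real n) * sqrt (real (n - 1)) * f (X (n - 2, label b (n - 2))))"
    unfolding creation_twice using n2 by (simp only: f_lin split: if_splits) (simp add: f_lin)
  moreover have "ann (ann (\<lambda>n. f (X (n, label b n)))) n = f (annihilation (annihilation (sigma_x X)) (n, label b n))"
    unfolding annihilation_twice flip_label f_lin by (simp add: ann_def)
  moreover have "f (creation (annihilation X) (n, label b n)) = real n * f (X (n, label b n))"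
    unfolding creation_annihilation nz f_lin ..
  moreover have "f (sigma_z X (n, label b n)) = label_sign b * pattern n * f (X (n, label b n))"
    unfolding sigma_z_def prod.case label_sigma f_lin ..
  ultimately show ?thesis
    unfolding rabi_hamiltonian_def free_action_def[OF \<beta>] f_lin by (simp add: algebra_simps)
qed

text \<open>A weak eigenvector satisfies the equation coordinatewise; the domain condition of the
  Hamiltonian is supplied by \<open>weak_eigenvector_number\<close>.\<close>

lemma state_of_eigenvector:
  assumes x: "x \<in> weak_eigenspace \<beta> (label_sign b * (\<Delta> / 2)) l"
  shows "state_of b x \<in> rabi_eigenspace \<Delta> (coup \<beta>) (labels b) (of_real l)"
proof -
  note sup = supported_state_of[of b x]
  have e: "free_action \<beta> (coord x) m + label_sign b * (\<Delta> / 2) * (pattern m * coord x m) = l * coord x m" for m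
    using x unfolding weak_eigenspace_iff[OF \<beta>] by blast
  have "rabi_hamiltonian \<Delta> (coup \<beta>) (state_of b x) (n, s) = of_real l * state_of b x (n, s)" for n s
  proof (cases "s = label b n")
    case True
    then show ?thesis
      using rabi_hamiltonian_on[of Re \<Delta> "state_of b x" n b] rabi_hamiltonian_on[of Im \<Delta> "state_of b x" n b] e[of n]
      by (simp add: complex_eq_iff state_of_apply free_action_def[OF \<beta>] ann_def cre_def)
  next
    case False
    then show ?thesis using rabi_hamiltonian_off[OF sup False] supportedD[OF sup False] by simp
  qed
  then have "rabi_hamiltonian \<Delta> (coup \<beta>) (state_of b x) = (\<lambda>i. of_real l * state_of b x i)" by (auto simp: fun_eq_iff)
  moreover have l2: "state_of b x \<in> ell2"
    unfolding ell2_supported[OF sup] by (simp add: state_of_apply summable_coord)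
  moreover have "creation (annihilation (state_of b x)) \<in> ell2"
    unfolding ell2_supported[OF supported_number[OF sup]]
    using weak_eigenvector_number[OF \<beta> x]
    by (simp add: creation_annihilation state_of_apply norm_mult power_mult_distrib)
  ultimately show ?thesis
    using sup by (simp add: rabi_eigenspace_def rabi_domain_def subspace_of_def supported_def)
qed

lemma rabi_eigenvector_parts:
  assumes X: "X \<in> rabi_eigenspace \<Delta> (coup \<beta>) (labels b) (of_real l)"
  obtains x y where "x \<in> weak_eigenspace \<beta> (label_sign b * (\<Delta> / 2)) l" "y \<in> weak_eigenspace \<beta> (label_sign b * (\<Delta> / 2)) l"
    "X = state_of b x + state_scale \<i> (state_of b y)"
proof -
  have sup: "supported b X" and l2: "X \<in> ell2" and eig: "rabi_hamiltonian \<Delta> (coup \<beta>) X = (\<lambda>i. of_real l * X i)"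
    using X by (auto simp: rabi_eigenspace_def rabi_domain_def subspace_of_def supported_def)
  have s: "summable (\<lambda>n. (cmod (X (n, label b n)))\<^sup>2)" using l2 unfolding ell2_supported[OF sup] .
  have part: "coord (Abs_l2 (\<lambda>n. f (X (n, label b n)))) = (\<lambda>n. f (X (n, label b n))) \<and>
     Abs_l2 (\<lambda>n. f (X (n, label b n))) \<in> weak_eigenspace \<beta> (label_sign b * (\<Delta> / 2)) l"
    if f: "f = Re \<or> f = Im" for f
  proof -
    have "\<bar>f z\<bar> \<le> cmod z" for z using f abs_Re_le_cmod abs_Im_le_cmod by auto
    then have "(f z)\<^sup>2 \<le> (cmod z)\<^sup>2" for z by (simp add: abs_le_square_iff[symmetric])
    then have "summable (\<lambda>n. (f (X (n, label b n)))\<^sup>2)"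
      by (intro summable_comparison_test'[OF s, of 0]) simp
    then have c: "coord (Abs_l2 (\<lambda>n. f (X (n, label b n)))) = (\<lambda>n. f (X (n, label b n)))"
      by (intro Abs_l2_inverse) simp
    have "f (of_real l * X (n, label b n)) = l * f (X (n, label b n))" for n using f by auto
    then show ?thesis
      unfolding weak_eigenspace_iff[OF \<beta>] c using rabi_hamiltonian_on[OF f, of \<Delta> X _ b] by (simp add: eig)
  qed
  define x where "x = Abs_l2 (\<lambda>n. Re (X (n, label b n)))"
  define y where "y = Abs_l2 (\<lambda>n. Im (X (n, label b n)))"
  have "X (n, s) = state_of b x (n, s) + \<i> * state_of b y (n, s)" for n s
  proof (cases "s = label b n")
    case True
    then show ?thesis using part[of Re] part[of Im] by (simp add: state_of_apply x_def y_def complex_eq_iff)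
  next
    case False
    then show ?thesis using supportedD[OF sup False] by (simp add: state_of_def)
  qed
  then have "X = state_of b x + state_scale \<i> (state_of b y)" by (auto simp: state_scale_def fun_eq_iff)
  moreover have "x \<in> weak_eigenspace \<beta> (label_sign b * (\<Delta> / 2)) l" unfolding x_def using part[of Re] by blast
  moreover have "y \<in> weak_eigenspace \<beta> (label_sign b * (\<Delta> / 2)) l" unfolding y_def using part[of Im] by blast
  ultimately show ?thesis using that by blast
qed

text \<open>The complex eigenspace is the complexification of the real one. A real basis spans it by
  splitting vectors into two real parts, and stays independent because a complex relation splits
  into two real relations.\<close>

lemma dim_rabi_eigenspace:
  assumes B: "finite B" "independent B" "span B = weak_eigenspace \<beta> (label_sign b * (\<Delta> / 2)) l"
  shows "state.dim (rabi_eigenspace \<Delta> (coup \<beta>) (labels b) (of_real l)) = card B"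
proof -
  have inj: "inj_on (state_of b) B" using state_of_inj by (rule inj_on_subset) simp
  have sub: "state_of b ` B \<subseteq> rabi_eigenspace \<Delta> (coup \<beta>) (labels b) (of_real l)"
    using state_of_eigenvector B(3) span_superset by blast
  have emb: "state_of b x \<in> state.span (state_of b ` B)" if x: "x \<in> span B" for x
  proof -
    obtain r where "x = (\<Sum>a\<in>B. r a *\<^sub>R a)" using x span_finite[OF B(1)] by auto
    then have "state_of b x = (\<Sum>a\<in>B. state_scale (of_real (r a)) (state_of b a))"
      by (simp add: state_of_sum[OF B(1)] state_of_scale)
    then show ?thesis by (auto intro!: state.span_sum state.span_scale intro: state.span_base)
  qed
  have span: "rabi_eigenspace \<Delta> (coup \<beta>) (labels b) (of_real l) \<subseteq> state.span (state_of b ` B)"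
  proof
    fix X assume "X \<in> rabi_eigenspace \<Delta> (coup \<beta>) (labels b) (of_real l)"
    then obtain x y where "x \<in> span B" "y \<in> span B" "X = state_of b x + state_scale \<i> (state_of b y)"
      unfolding B(3) by (rule rabi_eigenvector_parts)
    then show "X \<in> state.span (state_of b ` B)" by (simp add: state.span_add state.span_scale emb)
  qed
  have "state.independent (state_of b ` B)"
  proof (rule state.independent_if_scalars_zero)
    show "finite (state_of b ` B)" using B(1) by simp
    fix r X assume r: "(\<Sum>X\<in>state_of b ` B. state_scale (r X) X) = 0" and "X \<in> state_of b ` B"
    then obtain a where a: "a \<in> B" "X = state_of b a" by blast
    have "(\<Sum>a\<in>B. state_scale (r (state_of b a)) (state_of b a)) = 0"
      using r by (simp add: sum.reindex[OF inj] o_def)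
    note zero = this
    have "(\<Sum>a\<in>B. state_scale (r (state_of b a)) (state_of b a) (n, label b n)) = 0" for n
    proof -
      have "(\<Sum>a\<in>B. state_scale (r (state_of b a)) (state_of b a) (n, label b n))
        = (\<Sum>a\<in>B. state_scale (r (state_of b a)) (state_of b a)) (n, label b n)"
        by (rule state_sum_apply[symmetric])
      then show ?thesis unfolding zero by simp
    qed
    then have z: "(\<Sum>a\<in>B. r (state_of b a) * of_real (coord a n)) = 0" for n
      by (simp only: state_scale_def state_of_apply)
    have "f (r (state_of b a)) = 0" if f: "f = Re \<or> f = Im" for f
    proof -
      have "(\<Sum>a\<in>B. f (r (state_of b a)) *\<^sub>R a) = 0"
      proof (rule l2_eqI)
        fix n
        have "f (\<Sum>a\<in>B. r (state_of b a) * of_real (coord a n)) = (\<Sum>a\<in>B. f (r (state_of b a)) * coord a n)"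
          using f by auto
        then show "coord (\<Sum>a\<in>B. f (r (state_of b a)) *\<^sub>R a) n = coord 0 n"
          using f by (auto simp: z coord_sum)
      qed
      then show ?thesis
        by (rule independentD[where u = "\<lambda>a. f (r (state_of b a))", OF B(2) B(1) subset_refl _ a(1)])
    qed
    from this[of Re] this[of Im] show "r X = 0" by (simp add: a complex_eq_iff)
  qed
  then have "card (state_of b ` B) = state.dim (rabi_eigenspace \<Delta> (coup \<beta>) (labels b) (of_real l))"
    using state.basis_card_eq_dim[OF sub span] by blast
  then show ?thesis by (simp add: card_image[OF inj])
qed

end

section \<open>From matrix elements to eigenvalues\<close>

context
  fixes \<beta> :: real
  assumes beta: "0 < \<beta>" "\<beta> < 1"
begin

lemma level_estimate:
  "\<exists>C n0. C \<ge> 0 \<and> (\<forall>n\<ge>n0. \<forall>x M. (\<lambda>j. freq \<beta> * \<bar>real j - real n\<bar> * (inner (sqv \<beta> j) x)\<^sup>2) sums M \<longrightarrow>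
     \<bar>inner x (s *\<^sub>R pattern_op x) - s * overlap \<beta> n n * inner x x\<bar> \<le> C * (ln (real n) / real n) * inner x x + M)"
proof -
  note ab = abs_beta[OF beta]
  interpret perturbed_oscillator "sqv \<beta>" "\<lambda>x. s *\<^sub>R pattern_op x" "freq \<beta>" "(freq \<beta> - 1) / 2" "\<bar>s\<bar>"
    by (rule oscillator[OF ab])
  define w where "w = freq \<beta>"
  have w: "0 < w" using freq_pos[OF ab] by (simp add: w_def)
  \<comment> \<open>The choice makes \<open>2 * \<bar>s\<bar> / sqrt K + \<bar>s\<bar> / K\<close>
    at most \<open>3 * \<bar>s\<bar> / sqrt K \<le> w / 4\<close>. The other quarter of
    \<open>w\<close> goes to \<open>(2 * K + 1) * \<epsilon>\<close>; only afterwards is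
    \<open>n\<close> taken large.\<close>
  define K where "K = nat \<lceil>(12 * \<bar>s\<bar> / w)\<^sup>2\<rceil> + 1"
  have K: "K > 0" by (simp add: K_def)
  have sK: "12 * \<bar>s\<bar> / w \<le> sqrt (real K)"
    by (rule real_le_rsqrt) (unfold K_def, linarith)
  define \<epsilon> where "\<epsilon> = w / 4 / (2 * real K + 1)"
  have \<epsilon>: "\<epsilon> > 0" using w by (simp add: \<epsilon>_def)
  have small: "2 * real K * \<epsilon> + 2 * \<bar>s\<bar> / sqrt (real K) + \<bar>s\<bar> / real K + \<epsilon> \<le> w / 2"
  proof -
    have "2 * real K * \<epsilon> + \<epsilon> = (2 * real K + 1) * \<epsilon>" by (simp add: algebra_simps)
    also have "\<dots> = w / 4"
    proof -
      have "q * (w / 4 / q) = w / 4" if "q \<noteq> 0" for q using that by simp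
      moreover have "2 * real K + 1 \<noteq> 0" using of_nat_0_le_iff[of K, where ?'a = real] by linarith
      ultimately show ?thesis unfolding \<epsilon>_def by blast
    qed
    finally have 1: "2 * real K * \<epsilon> + \<epsilon> = w / 4" .
    have "\<bar>s\<bar> / sqrt (real K) \<le> w / 12"
      using sK w K by (simp add: pos_divide_le_eq mult.commute)
    moreover have "\<bar>s\<bar> / real K \<le> \<bar>s\<bar> / sqrt (real K)"
    proof (rule divide_left_mono)
      have "sqrt (real K) \<le> sqrt (real K) * sqrt (real K)"
        using mult_left_mono[of 1 "sqrt (real K)" "sqrt (real K)"] K by simp
      then show "sqrt (real K) \<le> real K" by simp
    qed (use K in auto)
    ultimately show ?thesis using 1 by linarith
  qed
  \<comment> \<open>The denominator \<open>\<bar>s\<bar> + 1\<close> also covers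
    \<open>\<Delta> = 0\<close>.\<close>
  obtain n1 where n1: "\<And>n i j. n \<ge> n1 \<Longrightarrow> i \<le> n + K \<Longrightarrow> n \<le> i + K \<Longrightarrow> j \<le> n + K \<Longrightarrow> n \<le> j + K \<Longrightarrow>
     \<bar>overlap \<beta> i j\<bar> \<le> \<epsilon> / (\<bar>s\<bar> + 1)"
    using overlap_near_diagonal_small[OF beta, of "\<epsilon> / (\<bar>s\<bar> + 1)" K] \<epsilon> by (auto simp: add_nonneg_pos)
  obtain C n2 where C: "C \<ge> 0" and n2: "\<And>n F. n \<ge> n2 \<Longrightarrow> finite F \<Longrightarrow> n \<notin> F \<Longrightarrow>
     (\<Sum>m\<in>F. (overlap \<beta> m n)\<^sup>2 / \<bar>real m - real n\<bar>) \<le> C * (ln (real n) / real n)"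
    using overlap_row[OF beta] by blast
  define D where "D = 2 * (s\<^sup>2 * C / w)"
  have "\<bar>inner x (s *\<^sub>R pattern_op x) - s * overlap \<beta> n n * inner x x\<bar> \<le> D * (ln (real n) / real n) * inner x x + M"
    if n: "n \<ge> n1 + n2" and M: "(\<lambda>j. freq \<beta> * \<bar>real j - real n\<bar> * (inner (sqv \<beta> j) x)\<^sup>2) sums M" for n x M
  proof -
    have entry: "inner (sqv \<beta> i) (s *\<^sub>R pattern_op (sqv \<beta> j)) = s * overlap \<beta> i j" for i j
      by (simp add: overlap_def)
    have "\<bar>inner x (s *\<^sub>R pattern_op x) - inner (sqv \<beta> n) (s *\<^sub>R pattern_op (sqv \<beta> n)) * inner x x\<bar>
       \<le> 2 * (s\<^sup>2 * C / w * (ln (real n) / real n)) * inner x x + M"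
    proof (rule form_bound[OF K small[unfolded w_def] _ _ M])
      fix i j assume ij: "i \<le> n + K" "n \<le> i + K" "j \<le> n + K" "n \<le> j + K"
      have "\<bar>s\<bar> * \<bar>overlap \<beta> i j\<bar> \<le> (\<bar>s\<bar> + 1) * (\<epsilon> / (\<bar>s\<bar> + 1))"
        using n1[of n i j] n ij by (intro mult_mono) auto
      then show "\<bar>inner (sqv \<beta> i) (s *\<^sub>R pattern_op (sqv \<beta> j))\<bar> \<le> \<epsilon>"
        unfolding entry by (simp add: abs_mult add_nonneg_pos[THEN less_imp_neq])
    next
      fix F assume F: "finite F" "n \<notin> F"
      have "(\<Sum>m\<in>F. (s * overlap \<beta> m n)\<^sup>2 / \<bar>real m - real n\<bar>) = s\<^sup>2 * (\<Sum>m\<in>F. (overlap \<beta> m n)\<^sup>2 / \<bar>real m - real n\<bar>)"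
        by (simp add: power_mult_distrib sum_distrib_left)
      also have "\<dots> \<le> s\<^sup>2 * (C * (ln (real n) / real n))"
        using n F by (intro mult_left_mono n2) auto
      also have "\<dots> = freq \<beta> * (s\<^sup>2 * C / w * (ln (real n) / real n))" using w by (simp add: w_def)
      finally show "(\<Sum>m\<in>F. (inner (sqv \<beta> m) (s *\<^sub>R pattern_op (sqv \<beta> n)))\<^sup>2 / \<bar>real m - real n\<bar>)
        \<le> freq \<beta> * (s\<^sup>2 * C / w * (ln (real n) / real n))" unfolding entry .
    qed
    then show ?thesis unfolding entry D_def by (simp only: mult.assoc)
  qed
  moreover have "0 \<le> D" using C w by (simp add: D_def)
  ultimately show ?thesis by blast
qed

lemma abs_overlap_le_1: "\<bar>overlap \<beta> m n\<bar> \<le> 1"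
  using overlap_bessel[OF abs_beta[OF beta], of "{m}" n] by (simp add: abs_square_le_1)

lemma ln_over_le_1: "ln (real n) / real n \<le> 1"
  using ln_le_minus_one[of "real n"] by (cases "n = 0") (auto simp: divide_le_eq)

text \<open>Before \<open>eigenvalue_estimate\<close> applies, each eigenspace must have a finite
  basis, since the complex \<open>dim\<close> would report 0 for an infinite one. For given
  \<open>l\<close> some level has its lower bound above \<open>l\<close>, and
  \<open>card_eigenvectors_le\<close> then bounds every independent set in the eigenspace.\<close>

lemma eigenvalue_near_level:
  assumes E: "lists_eigenvalues \<Delta> (coup \<beta>) (labels b) E"
  shows "\<exists>C n0. C \<ge> 0 \<and> (\<forall>n\<ge>n0. \<bar>E n - (level \<beta> n + label_sign b * (\<Delta> / 2) * overlap \<beta> n n)\<bar> \<le> C * (ln (real n) / real n))"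
proof -
  note ab = abs_beta[OF beta]
  define s where "s = label_sign b * (\<Delta> / 2)"
  interpret perturbed_oscillator "sqv \<beta>" "\<lambda>x. s *\<^sub>R pattern_op x" "freq \<beta>" "(freq \<beta> - 1) / 2" "\<bar>s\<bar>"
    by (rule oscillator[OF ab])
  obtain C n0 where C: "C \<ge> 0" and bound: "\<And>n x M. n \<ge> n0 \<Longrightarrow>
      (\<lambda>j. freq \<beta> * \<bar>real j - real n\<bar> * (inner (sqv \<beta> j) x)\<^sup>2) sums M \<Longrightarrow>
     \<bar>inner x (s *\<^sub>R pattern_op x) - s * overlap \<beta> n n * inner x x\<bar> \<le> C * (ln (real n) / real n) * inner x x + M"
    using level_estimate[of s] by blast
  have basis: "\<exists>B. finite B \<and> independent B \<and> span B = eigenspace l" for l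
  proof -
    obtain n where n: "n \<ge> n0" "l < lam n + s * overlap \<beta> n n - C * (ln (real n) / real n)"
    proof -
      have w: "0 < freq \<beta>" by (rule freq_pos[OF ab])
      define n where "n = n0 + nat \<lceil>(\<bar>l\<bar> + \<bar>s\<bar> + C + \<bar>(freq \<beta> - 1) / 2\<bar>) / freq \<beta>\<rceil> + 1"
      have "real n > (\<bar>l\<bar> + \<bar>s\<bar> + C + \<bar>(freq \<beta> - 1) / 2\<bar>) / freq \<beta>" unfolding n_def by linarith
      then have "\<bar>l\<bar> + \<bar>s\<bar> + C + \<bar>(freq \<beta> - 1) / 2\<bar> < freq \<beta> * real n" using w by (simp add: field_simps)
      moreover have "C * (ln (real n) / real n) \<le> C * 1" by (intro mult_left_mono ln_over_le_1 C)
      moreover have "\<bar>s * overlap \<beta> n n\<bar> \<le> \<bar>s\<bar> * 1" unfolding abs_mult by (intro mult_left_mono abs_overlap_le_1) auto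
      ultimately have "l < lam n + s * overlap \<beta> n n - C * (ln (real n) / real n)"
        unfolding lam_def by linarith
      then show ?thesis using that[of n] by (simp add: n_def)
    qed
    have le: "card B \<le> n" if "finite B" "independent B" "B \<subseteq> eigenspace l" for B
    proof (rule card_eigenvectors_le[OF bound[OF n(1)] that(1,2)])
      fix b assume "b \<in> B"
      then have "b \<in> eigenspace l" using that(3) by blast
      with n(2) show "\<exists>l'<lam n + s * overlap \<beta> n n - C * (ln (real n) / real n). b \<in> eigenspace l'" by blast
    qed
    obtain B where B: "B \<subseteq> eigenspace l" "independent B" "eigenspace l \<subseteq> span B"
      using maximal_independent_subset[of "eigenspace l"] by blast
    have "finite B"
    proof (rule ccontr)
      assume "infinite B"
      then obtain B' where B': "finite B'" "card B' = Suc n" "B' \<subseteq> B"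
        using infinite_arbitrarily_large by blast
      then show False using le[of B'] B independent_mono[of B B'] by auto
    qed
    moreover have "span B = eigenspace l"
      using B span_minimal[OF B(1) subspace_eigenspace] by blast
    ultimately show ?thesis using B(2) by blast
  qed
  then obtain Bs where Bs: "\<And>l. finite (Bs l)" "\<And>l. independent (Bs l)" "\<And>l. span (Bs l) = eigenspace l"
    by metis
  have l_real: "{n. complex_of_real (E n) = of_real l} = {n. E n = l}" for l by auto
  have fin: "finite {k. E k = l}" for l
    using E unfolding lists_eigenvalues_def l_real[symmetric] by blast
  have card: "card (Bs l) = card {k. E k = l}" for l
    using E dim_rabi_eigenspace[OF ab Bs(1,2) Bs(3)[unfolded s_def], of l]
    unfolding lists_eigenvalues_def l_real[symmetric] by metis
  have mE: "mono E" using E by (simp add: lists_eigenvalues_def)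
  have "\<bar>E n - (lam n + s * overlap \<beta> n n)\<bar> \<le> C * (ln (real n) / real n)" if "n \<ge> n0" for n
    by (rule eigenvalue_estimate[OF bound[OF that] mE Bs card fin])
  then show ?thesis using C unfolding lam_level[OF ab] s_def by blast
qed

end

text \<open>With \<open>w = sqrt (1 - 4 * g\<^sup>2)\<close>,
  \<open>\<beta> = (1 - w) / (2 * g)\<close> is the root in \<open>(0, 1)\<close> of
  \<open>\<beta> / (1 + \<beta>\<^sup>2) = g\<close>. The angle with sine \<open>2 * g\<close> and
  cosine \<open>w\<close> is the Legendre angle, and the arctangent in the phase is its
  complement.\<close>

lemma rabi_parameters:
  fixes g :: real
  assumes g: "0 < g" "g < 1 / 2"
  obtains \<beta> \<theta> where "0 < \<beta>" "\<beta> < 1" "coup \<beta> = g" "freq \<beta> = sqrt (1 - 4 * g\<^sup>2)"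
    "0 < \<theta>" "\<theta> < pi / 2" "cos \<theta> = sqrt (1 - 4 * g\<^sup>2)" "sin \<theta> = 2 * g"
    "arctan (sqrt (1 - 4 * g\<^sup>2) / (2 * g)) = pi / 2 - \<theta>"
proof -
  define w where "w = sqrt (1 - 4 * g\<^sup>2)"
  have "g\<^sup>2 < (1 / 2)\<^sup>2" using g by (intro power_strict_mono) auto
  then have g2: "4 * g\<^sup>2 < 1" by (simp add: power2_eq_square)
  have w2: "w\<^sup>2 = 1 - 4 * g\<^sup>2" using g2 by (simp add: w_def)
  have w: "0 < w" "w < 1" using g2 g by (auto simp: w_def)
  define \<beta> where "\<beta> = (1 - w) / (2 * g)"
  have b2: "\<beta>\<^sup>2 = (1 - w) / (1 + w)"
  proof -
    have "4 * g\<^sup>2 = (1 - w) * (1 + w)" using w2 by (simp add: power2_eq_square algebra_simps)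
    then have "\<beta>\<^sup>2 = (1 - w) * (1 - w) / ((1 - w) * (1 + w))"
      by (simp add: \<beta>_def power_divide power_mult_distrib) (simp add: power2_eq_square)
    then show ?thesis using w by simp
  qed
  have b: "0 < \<beta>" using w g by (simp add: \<beta>_def)
  have "\<beta>\<^sup>2 < 1" unfolding b2 using w by simp
  then have b1: "\<beta> < 1" using b by (simp add: abs_square_less_1)
  have ab: "\<bar>\<beta>\<bar> < 1" using b b1 by simp
  have plus: "1 + \<beta>\<^sup>2 = 2 / (1 + w)" and minus: "1 - \<beta>\<^sup>2 = 2 * w / (1 + w)"
    unfolding b2 using w by (simp_all add: field_simps)
  have "freq \<beta> = w" unfolding freq_def[OF ab] plus minus using w by simp
  moreover have "coup \<beta> = g"
  proof -
    have "coup \<beta> = \<beta> / (2 / (1 + w))" unfolding coup_def[OF ab] plus ..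
    also have "\<dots> = (1 - w) * (1 + w) / (4 * g)" by (simp add: \<beta>_def)
    also have "(1 - w) * (1 + w) = 4 * g * g" using w2 by (simp add: power2_eq_square algebra_simps)
    finally show ?thesis using g by simp
  qed
  moreover define \<theta> where "\<theta> = arcsin (2 * g)"
  have th: "0 < \<theta>" "\<theta> < pi / 2" "sin \<theta> = 2 * g"
    using g arcsin_less_arcsin[of 0 "2 * g"] arcsin_less_arcsin[of "2 * g" 1] by (simp_all add: \<theta>_def)
  moreover have cos: "cos \<theta> = w"
    using g cos_arcsin[of "2 * g"] by (simp add: \<theta>_def w_def power_mult_distrib)
  moreover have "arctan (w / (2 * g)) = pi / 2 - \<theta>"
  proof -
    have "tan (pi / 2 - \<theta>) = w / (2 * g)"
      using th cos by (simp add: tan_def sin_diff cos_diff)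
    moreover have "arctan (tan (pi / 2 - \<theta>)) = pi / 2 - \<theta>"
      by (rule arctan_tan) (use th in linarith)+
    ultimately show ?thesis by simp
  qed
  ultimately show ?thesis using that[of \<beta> \<theta>] b b1 by (simp add: w_def)
qed

lemma rabi_asymptotic_labels:
  assumes g: "0 < g" "g < 1 / 2" and E: "lists_eigenvalues \<Delta> g (labels b) E"
  shows "(\<lambda>n. E n - rabi_asymptotic \<Delta> g (label_sign b) n) \<in> O(\<lambda>n. ln (real n) / real n)"
proof -
  obtain \<beta> \<theta> where par: "0 < \<beta>" "\<beta> < 1" "coup \<beta> = g" "freq \<beta> = sqrt (1 - 4 * g\<^sup>2)"
    "0 < \<theta>" "\<theta> < pi / 2" "cos \<theta> = sqrt (1 - 4 * g\<^sup>2)" "sin \<theta> = 2 * g"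
    "arctan (sqrt (1 - 4 * g\<^sup>2) / (2 * g)) = pi / 2 - \<theta>"
    using rabi_parameters[OF g] by metis
  have ab: "\<bar>\<beta>\<bar> < 1" using par by simp
  define w where "w = freq \<beta>"
  have w: "0 < w" using freq_pos[OF ab] by (simp add: w_def)
  define s where "s = label_sign b * (\<Delta> / 2)"
  obtain C n0 where C: "C \<ge> 0" and near: "\<And>n. n \<ge> n0 \<Longrightarrow>
     \<bar>E n - (level \<beta> n + s * overlap \<beta> n n)\<bar> \<le> C * (ln (real n) / real n)"
    using eigenvalue_near_level[OF par(1,2), of \<Delta> b E] E par(3) unfolding s_def by blast
  obtain D where D: "\<And>n. n \<ge> 2 \<Longrightarrow> \<bar>legendre (cos \<theta>) n
     - sqrt (2 / (pi * real n * sin \<theta>)) * cos ((real n + 1 / 2) * \<theta> - pi / 4)\<bar> \<le> D / real n"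
    using legendre_asymptotics[OF par(5,6)] by blast
  have "norm (E n - rabi_asymptotic \<Delta> g (label_sign b) n) \<le> (C + \<bar>s\<bar> * sqrt w * D) * norm (ln (real n) / real n)"
    if n: "n \<ge> n0 + 3" for n
  proof -
    define A where "A = sqrt (2 / (pi * real n * sin \<theta>)) * cos ((real n + 1 / 2) * \<theta> - pi / 4)"
    have ra: "rabi_asymptotic \<Delta> g (label_sign b) n = level \<beta> n + s * (pattern n * (sqrt w * A))"
    proof -
      have "sqrt (w / (pi * g * real n)) = sqrt w * sqrt (2 / (pi * real n * sin \<theta>))"
        unfolding par(8) by (simp flip: real_sqrt_mult add: mult_ac)
      \<comment> \<open>The argument on the left is \<open>pi / 4 - (n + 1 / 2) * \<theta>\<close>,
        the negative of the Legendre phase.\<close>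
      moreover have "cos ((pi / 2 - \<theta>) * (real n + 1 / 2) - pi / 2 * real n) = cos ((real n + 1 / 2) * \<theta> - pi / 4)"
        by (subst cos_minus[symmetric]) (simp add: algebra_simps)
      ultimately show ?thesis
        unfolding rabi_asymptotic_def par(9) unfolding par(4)[symmetric] w_def[symmetric]
        by (simp add: level_def[OF ab] s_def w_def[symmetric] A_def pattern_def)
    qed
    have ln1: "1 \<le> ln (real n)"
    proof -
      have "exp 1 \<le> real n" using exp_le n by linarith
      then show ?thesis using n by (simp add: ln_ge_iff)
    qed
    have "\<bar>s * overlap \<beta> n n - s * (pattern n * (sqrt w * A))\<bar> = \<bar>s\<bar> * sqrt w * \<bar>legendre w n - A\<bar>"
    proof -
      have "s * overlap \<beta> n n - s * (pattern n * (sqrt w * A)) = s * pattern n * sqrt w * (legendre w n - A)"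
        unfolding overlap_diag[OF ab] w_def[symmetric] by (simp add: algebra_simps)
      then show ?thesis using w by (simp add: abs_mult abs_pattern)
    qed
    also have "\<dots> \<le> \<bar>s\<bar> * sqrt w * (D / real n)"
      using D[of n] n w par(4,7) by (intro mult_left_mono) (auto simp: A_def w_def)
    also have "\<dots> \<le> \<bar>s\<bar> * sqrt w * (D * (ln (real n) / real n))"
    proof (intro mult_left_mono)
      have "0 \<le> D / real n" using D[of n] n by (intro order_trans[OF abs_ge_zero]) auto
      then have "0 \<le> D" using n by (simp add: zero_le_divide_iff)
      then have "D * 1 \<le> D * ln (real n)" using ln1 by (intro mult_left_mono) auto
      then show "D / real n \<le> D * (ln (real n) / real n)" by (simp add: divide_right_mono)
    qed (use w in auto)
    finally have "\<bar>E n - rabi_asymptotic \<Delta> g (label_sign b) n\<bar> \<le> C * (ln (real n) / real n) + \<bar>s\<bar> * sqrt w * (D * (ln (real n) / real n))"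
      unfolding ra using near[of n] n by linarith
    also have "\<dots> = (C + \<bar>s\<bar> * sqrt w * D) * (ln (real n) / real n)" by (simp only: distrib_right mult.assoc)
    finally show ?thesis using ln1 by simp
  qed
  then have "eventually (\<lambda>n. norm (E n - rabi_asymptotic \<Delta> g (label_sign b) n)
      \<le> (C + \<bar>s\<bar> * sqrt w * D) * norm (ln (real n) / real n)) sequentially"
    by (intro eventually_sequentiallyI)
  then show ?thesis by (rule bigoI)
qed

theorem theorem6p1:
  fixes \<Delta> g :: real and Eplus Eminus :: "nat \<Rightarrow> real"
  assumes "0 < g" and "g < 1 / 2"
    and "lists_eigenvalues \<Delta> g basis_plus Eplus"
    and "lists_eigenvalues \<Delta> g basis_minus Eminus"
  shows "(\<lambda>n. Eplus n - rabi_asymptotic \<Delta> g 1 n) \<in> O(\<lambda>n. ln (real n) / real n)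
       \<and> (\<lambda>n. Eminus n - rabi_asymptotic \<Delta> g (- 1) n) \<in> O(\<lambda>n. ln (real n) / real n)"
  using rabi_asymptotic_labels[of g \<Delta> True Eplus] rabi_asymptotic_labels[of g \<Delta> False Eminus] assms
  by (simp add: basis_plus_labels basis_minus_labels label_sign_def)

end
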